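(* Suppose that $p \in \Sigma_{4,4}$ lies on the boundary of the cone $\Sigma_{4,4}$ (as a subset of $H_{4,4}$) and $p$ is a strictly positive form, i.e. $p(x)>0$ for all nonzero $x\in\mathbb{R}^4$. Then $p$ is a sum of $4$ squares of forms in $H_{4,2}$ and cannot be written as a sum of $3$ squares of forms in $H_{4,2}$.
   Context: $H_{n,d}$ is the real vector space of real forms (homogeneous polynomials) of degree $d$ in $n$ variables. $\Sigma_{n,2d}=\{p\in H_{n,2d} : p=\sum_i q_i^2 \text{ (finite sum) for some } q_i\in H_{n,d}\}$; it is a full-dimensional closed convex cone in $H_{n,2d}$. *)

theory Defs
  imports "HOL-Analysis.Analysis" "HOL-Library.Poly_Mapping"
begin

text \<open>
  Real polynomials in variables indexed by a finite type \<open>'n\<close>: finitely supported maps from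
  exponent vectors to coefficients. The ring operations of \<^theory>\<open>HOL-Library.Poly_Mapping\<close>
  are then polynomial addition and (convolution) multiplication.
\<close>

type_synonym 'n rpoly = "('n \<Rightarrow>\<^sub>0 nat) \<Rightarrow>\<^sub>0 real"

definition poly_value :: "'n::finite rpoly \<Rightarrow> real ^ 'n \<Rightarrow> real" where
  "poly_value p x =
     (\<Sum>m\<in>Poly_Mapping.keys p. Poly_Mapping.lookup p m *
        (\<Prod>i\<in>UNIV. (x $ i) ^ Poly_Mapping.lookup m i))"

text \<open>\<open>forms d\<close> is $H_{n,d}$ with $n$ the cardinality of \<open>'n\<close>; it contains the zero polynomial.\<close>

definition forms :: "nat \<Rightarrow> 'n::finite rpoly set" where
  "forms d = {p. \<forall>m\<in>Poly_Mapping.keys p. (\<Sum>i\<in>UNIV. Poly_Mapping.lookup m i) = d}"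

text \<open>
  $H_{n,d}$ embeds by its coefficients into the functions on exponent vectors, where \<open>euclidean\<close> is the
  product topology. As only the finitely many exponent vectors of total degree \<open>d\<close> carry
  coefficients, the induced topology is the usual one of a finite-dimensional real vector space.
\<close>

definition forms_topology :: "nat \<Rightarrow> 'n::finite rpoly topology" where
  "forms_topology d = pullback_topology (forms d) Poly_Mapping.lookup euclidean"

text \<open>Some of the \<open>k\<close> squares may be zero.\<close>

definition sum_of_form_squares :: "nat \<Rightarrow> nat \<Rightarrow> 'n::finite rpoly \<Rightarrow> bool" where
  "sum_of_form_squares k d p \<longleftrightarrow> (\<exists>q. (\<forall>i<k. q i \<in> forms d) \<and> p = (\<Sum>i<k. (q i)\<^sup>2))"

text \<open>\<open>sos_cone d\<close> is $\Sigma_{n,2d}$: the argument is half the degree.\<close>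

definition sos_cone :: "nat \<Rightarrow> 'n::finite rpoly set" where
  "sos_cone d = {p \<in> forms (2 * d). \<exists>k. sum_of_form_squares k d p}"

end

theory Submission
  imports
    Defs
    "HOL-Analysis.Finite_Function_Topology"
    "HOL-Computational_Algebra.Fundamental_Theorem_Algebra"
begin

text \<open>The form \<open>p\<close> is annihilated by a nonzero functional \<open>l\<close> on quartic forms that is nonnegative on
squares of quadrics, because it lies on the boundary of the cone. Let \<open>W\<close> be the kernel of the
positive semidefinite form \<open>l (f * g)\<close> on quadrics. In every representation of \<open>p\<close> as a sum
of squares, all the squared quadrics belong to \<open>W\<close>, so the lengths of such representations are
decided by \<open>W\<close>.

Choose \<open>l\<close> with \<open>W\<close> as large as possible. Then \<open>l\<close> is extremal: a functional that kills
the products of \<open>W\<close> with quadrics is a multiple of \<open>l\<close> (\<open>exists_extremal_functional\<close>). Unless the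
ideal of \<open>W\<close> contains a power of every variable, extremality forces \<open>l\<close> to be a multiple of the evaluation at a real
point, which \<open>p > 0\<close> excludes (\<open>extremal_irrelevant\<close>). So \<open>W\<close> contains a regular sequence of four quadrics, and the quotient by
their ideal is a Gorenstein algebra with socle in degree four (\<open>regular_sequence_of_quadrics\<close>).
Hence the quartics in that ideal are exactly those in the kernel of \<open>l\<close>, and by Gorenstein
duality \<open>W\<close> is the span of the four quadrics. As \<open>W\<close> has dimension four, a sum of
squares from \<open>W\<close> can be rewritten with four squares (\<open>sum_of_squares_in_subspace\<close>).

Suppose now that three squares suffice. Choose a basis of \<open>W\<close> whose first three elements have the three
quadrics in their span, and let \<open>q\<close> be the last element. Modulo the other three basis elements, the fractions of even forms by powers of \<open>q\<close> are a
finite-dimensional real algebra, and \<open>l\<close> makes it a quadratic space on which multiplications are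
self-adjoint. The form is nonnegative on the kernel of \<open>l\<close>, a hyperplane, and vanishes there only on
the line of the unit, so there is just one negative direction. Commuting self-adjoint operators on such
a Lorentzian space have a common real eigenvector: a simple submodule with a complex structure uses up the
negative direction, and on its orthogonal complement the form is definite. The eigenvalues
of the products of two variables determine a real common zero of the three quadrics (\<open>common_real_zero\<close>), where \<open>p\<close>
would vanish.\<close>

section \<open>Forms as a graded algebra\<close>

lemma lookup_scaleR [simp]:
  "Poly_Mapping.lookup (c *\<^sub>R f) k = c *\<^sub>R Poly_Mapping.lookup f k"
proof -
  have "finite {k. c *\<^sub>R Poly_Mapping.lookup f k \<noteq> 0}"
    by (rule finite_subset[OF _ finite_lookup[of f]]) auto
  then show ?thesis
    by (simp add: scaleR_poly_mapping_def)
qed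

instance poly_mapping :: (comm_monoid_add, "{real_algebra_1, comm_ring_1}") real_algebra_1
proof
  have scaleR_eq: "c *\<^sub>R f = Poly_Mapping.single 0 (of_real c) * f" for c and f :: "'a \<Rightarrow>\<^sub>0 'b"
    by (rule poly_mapping_eqI)
      (simp add: mult_map_scale_conv_mult[symmetric] Poly_Mapping.map.rep_eq when_def scaleR_conv_of_real)
  fix c :: real and f g :: "'a \<Rightarrow>\<^sub>0 'b"
  show "c *\<^sub>R f * g = c *\<^sub>R (f * g)"
    by (simp add: scaleR_eq mult.assoc)
  show "f * c *\<^sub>R g = c *\<^sub>R (f * g)"
    by (simp add: scaleR_eq mult_ac)
qed

definition mdeg :: "('n::finite \<Rightarrow>\<^sub>0 nat) \<Rightarrow> nat" where
  "mdeg m = (\<Sum>i\<in>UNIV. Poly_Mapping.lookup m i)"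

abbreviation monomial :: "('n \<Rightarrow>\<^sub>0 nat) \<Rightarrow> 'n rpoly" where
  "monomial m \<equiv> Poly_Mapping.single m 1"

definition var :: "'n \<Rightarrow> 'n rpoly" where
  "var i = monomial (Poly_Mapping.single i 1)"

lemma mdeg_add: "mdeg (m + n) = mdeg m + mdeg n"
  by (simp add: mdeg_def lookup_add sum.distrib)

lemma mdeg_single [simp]: "mdeg (Poly_Mapping.single i k) = k"
  by (simp add: mdeg_def lookup_single when_def)

lemma mdeg_0 [simp]: "mdeg 0 = 0"
  by (simp add: mdeg_def)

lemma mdeg_eq_0_iff: "mdeg m = 0 \<longleftrightarrow> m = 0"
  by (auto simp: mdeg_def intro!: poly_mapping_eqI)

lemma forms_iff: "f \<in> forms d \<longleftrightarrow> (\<forall>m. Poly_Mapping.lookup f m \<noteq> 0 \<longrightarrow> mdeg m = d)"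
  by (auto simp: forms_def mdeg_def in_keys_iff)

lemma forms_0 [simp]: "0 \<in> forms d"
  by (simp add: forms_iff)

lemma forms_add: "f \<in> forms d \<Longrightarrow> g \<in> forms d \<Longrightarrow> f + g \<in> forms d"
  by (auto simp: forms_iff lookup_add) (metis add.right_neutral)

lemma forms_scaleR: "f \<in> forms d \<Longrightarrow> c *\<^sub>R f \<in> forms d"
  by (auto simp: forms_iff)

lemma subspace_forms: "subspace (forms d :: 'n::finite rpoly set)"
  by (auto intro!: real_vector.subspaceI forms_add forms_scaleR)

lemma forms_diff: "f \<in> forms d \<Longrightarrow> g \<in> forms d \<Longrightarrow> f - g \<in> forms d"
  by (rule real_vector.subspace_diff[OF subspace_forms])

lemma forms_sum: "(\<And>i. i \<in> I \<Longrightarrow> f i \<in> forms d) \<Longrightarrow> (\<Sum>i\<in>I. f i) \<in> forms d"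
  by (rule real_vector.subspace_sum[OF subspace_forms])

lemma forms_mult:
  assumes "f \<in> forms d" "g \<in> forms e" shows "f * g \<in> forms (d + e)"
proof -
  have "mdeg m = d + e" if "m \<in> Poly_Mapping.keys (f * g)" for m
  proof -
    from that keys_mult obtain a b where "m = a + b" "a \<in> Poly_Mapping.keys f" "b \<in> Poly_Mapping.keys g"
      by blast
    then show ?thesis using assms by (auto simp: forms_iff in_keys_iff mdeg_add)
  qed
  then show ?thesis by (auto simp: forms_iff in_keys_iff)
qed

lemma forms_mult_eq: "f \<in> forms d \<Longrightarrow> g \<in> forms e \<Longrightarrow> n = d + e \<Longrightarrow> f * g \<in> forms n"
  by (simp add: forms_mult)

lemma forms_monom: "monomial m \<in> forms (mdeg m)"
  by (auto simp: forms_iff lookup_single when_def)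

lemma forms_one [simp]: "1 \<in> forms 0"
  by (auto simp: forms_iff lookup_one when_def)

lemma forms_var [simp]: "var i \<in> forms (Suc 0)"
  using forms_monom[of "Poly_Mapping.single i 1"] by (simp add: var_def)

lemma forms_power:
  assumes "f \<in> forms d" shows "f ^ n \<in> forms (n * d)"
  by (induction n) (auto intro: forms_mult_eq assms)

lemma forms_power_eq: "f \<in> forms d \<Longrightarrow> e = n * d \<Longrightarrow> f ^ n \<in> forms e"
  by (simp add: forms_power)

lemma finite_mdeg: "finite {m :: 'n::finite \<Rightarrow>\<^sub>0 nat. mdeg m = d}"
proof (rule inj_on_finite[where f = "Poly_Mapping.lookup"])
  have le: "Poly_Mapping.lookup m i \<le> mdeg m" for m :: "'n \<Rightarrow>\<^sub>0 nat" and i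
    unfolding mdeg_def by (rule member_le_sum) auto
  show "inj_on Poly_Mapping.lookup {m. mdeg m = d}"
    by (meson inj_onI poly_mapping_eq_iff)
  show "Poly_Mapping.lookup ` {m :: 'n \<Rightarrow>\<^sub>0 nat. mdeg m = d} \<subseteq> PiE UNIV (\<lambda>_. {..d})"
    using le by (auto simp: PiE_def)
  show "finite (PiE (UNIV :: 'n set) (\<lambda>_. {..d}))"
    by (intro finite_PiE) auto
qed

lemma poly_eq_sum_monom:
  "(f :: 'n rpoly) = (\<Sum>m\<in>Poly_Mapping.keys f. Poly_Mapping.lookup f m *\<^sub>R monomial m)"
  by (rule poly_mapping_eqI)
    (auto simp: lookup_sum lookup_single when_def in_keys_iff if_distrib[where f="\<lambda>x. _ * x"] cong: if_cong)

lemma forms_subset_span_monom: "forms d \<subseteq> span (monomial ` {m. mdeg m = d})"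
proof
  fix f :: "'a rpoly" assume "f \<in> forms d"
  then have "(\<Sum>m\<in>Poly_Mapping.keys f. Poly_Mapping.lookup f m *\<^sub>R monomial m) \<in> span (monomial ` {m. mdeg m = d})"
    by (intro span_sum span_scale span_base) (auto simp: forms_iff in_keys_iff)
  then show "f \<in> span (monomial ` {m. mdeg m = d})"
    using poly_eq_sum_monom[of f] by simp
qed

lemma span_monom: "span (range monomial) = (UNIV :: 'n rpoly set)"
proof -
  have "f \<in> span (range monomial)" for f :: "'n rpoly"
  proof -
    have "(\<Sum>m\<in>Poly_Mapping.keys f. Poly_Mapping.lookup f m *\<^sub>R monomial m) \<in> span (range monomial)"
      by (intro span_sum span_scale span_base) auto
    then show ?thesis using poly_eq_sum_monom[of f] by simp
  qed
  then show ?thesis by blast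
qed

lemma linear_eq_monom:
  assumes "linear f" "linear g" "\<And>m. f (monomial m) = g (monomial m)"
  shows "f (p :: 'n rpoly) = g p"
  using linear_eq_on_span[of f g "range monomial" p] assms span_monom by auto

lemma linear_mult_left: "linear (\<lambda>g. f * (g :: 'n rpoly))"
  by (rule linearI) (simp_all add: distrib_left)

lemma forms_dim_bound: "\<exists>B. finite B \<and> B \<subseteq> forms d \<and> forms d \<subseteq> span (B :: 'n::finite rpoly set)"
  by (rule exI[of _ "monomial ` {m. mdeg m = d}"])
    (use forms_subset_span_monom finite_mdeg forms_monom in auto)

lemma exists_var_factor:
  assumes "mdeg m = Suc d" shows "\<exists>i m'. mdeg m' = d \<and> monomial m = var i * monomial m'"
proof -
  obtain i where i: "Poly_Mapping.lookup m i > 0"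
    using assms by (metis mdeg_eq_0_iff nat.distinct(1) neq0_conv poly_mapping_eqI lookup_zero)
  define m' where "m' = m - Poly_Mapping.single i 1"
  have "m = Poly_Mapping.single i 1 + m'"
    using i by (intro poly_mapping_eqI) (auto simp: m'_def lookup_add lookup_minus lookup_single when_def)
  moreover from this have "mdeg m' = d"
    using assms by (simp add: mdeg_add)
  ultimately show ?thesis
    by (intro exI[of _ i] exI[of _ m']) (simp add: var_def mult_single)
qed

lemma forms_Suc_subset_span:
  "forms (Suc d) \<subseteq> span {var i * g | i g. g \<in> forms d}"
proof -
  have "monomial ` {m :: 'a \<Rightarrow>\<^sub>0 nat. mdeg m = Suc d} \<subseteq> {var i * g | i g. g \<in> forms d}"
    using exists_var_factor forms_monom by blast
  then show ?thesis
    using forms_subset_span_monom[of "Suc d"] real_vector.span_mono by blast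
qed

lemma forms_0_eq: "f \<in> forms 0 \<Longrightarrow> \<exists>c. f = c *\<^sub>R 1"
  by (rule exI[of _ "Poly_Mapping.lookup f 0"], rule poly_mapping_eqI)
    (auto simp: forms_iff lookup_one when_def mdeg_eq_0_iff)

lemma forms_plus_subset_span:
  "forms (d + e) \<subseteq> span {f * g | f g. f \<in> forms d \<and> g \<in> forms e}"
proof (induction d)
  case 0
  have "g \<in> span {f * g | f g. f \<in> forms 0 \<and> g \<in> forms e}" if "g \<in> forms e" for g :: "'a rpoly"
    by (rule span_base) (use that forms_one in \<open>metis (mono_tags, lifting) CollectI mult_1\<close>)
  then show ?case by auto
next
  case (Suc d)
  let ?T = "{f * g | f g :: 'a rpoly. f \<in> forms (Suc d) \<and> g \<in> forms e}"
  have "var i * h \<in> span ?T" if "h \<in> forms (d + e)" for i h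
  proof -
    have "h \<in> span {f * g | f g. f \<in> forms d \<and> g \<in> forms e}" using Suc that by blast
    then have "var i * h \<in> span ((*) (var i) ` {f * g | f g. f \<in> forms d \<and> g \<in> forms e})"
      using linear_span_image[OF linear_mult_left] by blast
    moreover have "(*) (var i) ` {f * g | f g. f \<in> forms d \<and> g \<in> forms e} \<subseteq> ?T"
    proof clarsimp
      fix f g :: "'a rpoly" assume "f \<in> forms d" "g \<in> forms e"
      then show "\<exists>f' g'. var i * (f * g) = f' * g' \<and> f' \<in> forms (Suc d) \<and> g' \<in> forms e"
        by (intro exI[of _ "var i * f"] exI[of _ g]) (auto simp: mult.assoc intro: forms_mult_eq[OF forms_var])
    qed
    ultimately show ?thesis using real_vector.span_mono by blast
  qed
  then have "span {var i * g | i g. g \<in> forms (d + e)} \<subseteq> span ?T"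
    by (intro real_vector.span_minimal) auto
  then show ?case using forms_Suc_subset_span[of "d + e"] by auto
qed

lemma poly_value_superset:
  assumes "finite K" "Poly_Mapping.keys p \<subseteq> K"
  shows "poly_value p x = (\<Sum>m\<in>K. Poly_Mapping.lookup p m * (\<Prod>i\<in>UNIV. (x $ i) ^ Poly_Mapping.lookup m i))"
  unfolding poly_value_def by (rule sum.mono_neutral_left) (use assms in \<open>auto simp: in_keys_iff\<close>)

lemma linear_poly_value: "linear (\<lambda>p. poly_value p x)"
proof (rule linearI)
  fix f g :: "'a rpoly"
  show "poly_value (f + g) x = poly_value f x + poly_value g x"
    using poly_value_superset[of "Poly_Mapping.keys f \<union> Poly_Mapping.keys g"] keys_add[of f g]
    by (simp add: lookup_add distrib_right sum.distrib)
next
  fix c and f :: "'a rpoly"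
  show "poly_value (c *\<^sub>R f) x = c *\<^sub>R poly_value f x"
    using poly_value_superset[of "Poly_Mapping.keys f" "c *\<^sub>R f"] poly_value_superset[of "Poly_Mapping.keys f" f]
    by (simp add: sum_distrib_left in_keys_iff subset_iff mult.assoc)
qed

lemma poly_value_monom: "poly_value (monomial m) x = (\<Prod>i\<in>UNIV. (x $ i) ^ Poly_Mapping.lookup m i)"
  by (simp add: poly_value_def)

lemma poly_value_mult: "poly_value (f * g) x = poly_value f x * poly_value g x"
proof -
  have 1: "poly_value (monomial m * monomial n) x = poly_value (monomial m) x * poly_value (monomial n) x" for m n
    by (simp add: mult_single poly_value_monom lookup_add power_add prod.distrib)
  have 2: "poly_value (monomial m * g) x = poly_value (monomial m) x * poly_value g x" for m
    by (rule linear_eq_monom[where p = g and f = "\<lambda>g. poly_value (monomial m * g) x"])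
      (auto simp: 1 intro!: linear_compose[OF linear_mult_left linear_poly_value, unfolded o_def]
        linear_cmul[of "\<lambda>g. poly_value g x", simplified] linear_poly_value
        linear_compose[OF linear_poly_value linear_times, unfolded o_def])
  show ?thesis
    by (rule linear_eq_monom[where p = f and f = "\<lambda>f. poly_value (f * g) x"])
      (auto simp: 2 mult.commute[of _ g] mult.commute[of _ "poly_value g x"] 2[unfolded mult.commute[of _ g] mult.commute[of _ "poly_value g x"]]
        intro!: linear_compose[OF linear_mult_left linear_poly_value, unfolded o_def]
        linear_compose[OF linear_poly_value linear_times, unfolded o_def])
qed

lemma poly_value_var: "poly_value (var i) x = x $ i"
proof -
  have "poly_value (var i) x = (\<Prod>j\<in>UNIV. if j = i then x $ j else 1)"
    unfolding var_def poly_value_monom by (rule prod.cong) (auto simp: lookup_single when_def)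
  then show ?thesis by (simp add: prod.delta)
qed

section \<open>Ideals generated by forms\<close>

interpretation ideal: module "(*) :: 'a::comm_ring_1 \<Rightarrow> 'a \<Rightarrow> 'a"
  by standard (simp_all add: algebra_simps)

\<comment> \<open>As a rewrite rule this would work against associativity of multiplication.\<close>
declare ideal.scale_scale [simp del]

lemma subspace_ideal: "subspace (ideal.span A :: 'n rpoly set)"
proof (rule real_vector.subspaceI)
  fix c and x :: "'n rpoly" assume "x \<in> ideal.span A"
  then have "(c *\<^sub>R 1) * x \<in> ideal.span A" by (rule ideal.span_scale)
  then show "c *\<^sub>R x \<in> ideal.span A" by simp
qed (auto intro: ideal.span_zero ideal.span_add)

lemma span_subset_ideal: "span A \<subseteq> (ideal.span A :: 'n rpoly set)"
  by (rule real_vector.span_minimal[OF ideal.span_superset subspace_ideal])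

lemma ideal_scaleR: "x \<in> ideal.span A \<Longrightarrow> c *\<^sub>R x \<in> (ideal.span A :: 'n rpoly set)"
  by (rule real_vector.subspace_scale[OF subspace_ideal])

lemma ideal_multR: "x \<in> ideal.span A \<Longrightarrow> x * y \<in> ideal.span A"
  by (metis ideal.span_scale mult.commute)

definition hcomp :: "nat \<Rightarrow> 'n::finite rpoly \<Rightarrow> 'n rpoly" where
  "hcomp d f = Abs_poly_mapping (\<lambda>m. if mdeg m = d then Poly_Mapping.lookup f m else 0)"

lemma lookup_hcomp: "Poly_Mapping.lookup (hcomp d f) m = (if mdeg m = d then Poly_Mapping.lookup f m else 0)"
proof -
  have "finite {m. (if mdeg m = d then Poly_Mapping.lookup f m else 0) \<noteq> 0}"
    by (rule finite_subset[OF _ finite_lookup[of f]]) auto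
  then show ?thesis by (simp add: hcomp_def)
qed

lemma hcomp_forms: "hcomp d f \<in> forms d"
  by (auto simp: forms_iff lookup_hcomp)

lemma hcomp_id: "f \<in> forms d \<Longrightarrow> hcomp d f = f"
  by (rule poly_mapping_eqI) (auto simp: forms_iff lookup_hcomp)

lemma hcomp_other: "f \<in> forms e \<Longrightarrow> d \<noteq> e \<Longrightarrow> hcomp d f = 0"
  by (rule poly_mapping_eqI) (auto simp: forms_iff lookup_hcomp)

lemma linear_hcomp: "linear (hcomp d)"
  by (rule linearI; rule poly_mapping_eqI) (auto simp: lookup_hcomp lookup_add)

lemma hcomp_add: "hcomp d (f + g) = hcomp d f + hcomp d g"
  by (rule linear_add[OF linear_hcomp])

lemma hcomp_0 [simp]: "hcomp d 0 = 0"
  by (rule linear_0[OF linear_hcomp])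

lemma hcomp_mult:
  assumes "a \<in> forms e"
  shows "hcomp d (a * g) = (if e \<le> d then a * hcomp (d - e) g else 0)"
proof (rule linear_eq_monom[where p = g and f = "\<lambda>g. hcomp d (a * g)"])
  show "linear (\<lambda>g. hcomp d (a * g))"
    using linear_compose[OF linear_mult_left linear_hcomp] by (simp add: o_def)
  show "linear (\<lambda>g. if e \<le> d then a * hcomp (d - e) g else 0)"
    using linear_compose[OF linear_hcomp linear_mult_left]
    by (cases "e \<le> d") (auto simp: o_def linear_zero)
  fix m
  have am: "a * monomial m \<in> forms (e + mdeg m)"
    by (rule forms_mult[OF assms forms_monom])
  show "hcomp d (a * monomial m) = (if e \<le> d then a * hcomp (d - e) (monomial m) else 0)"
  proof (cases "d = e + mdeg m")
    case True
    then show ?thesis using am hcomp_id[OF forms_monom, of m] by (simp add: hcomp_id)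
  next
    case False
    then show ?thesis using hcomp_other[OF am] hcomp_other[OF forms_monom, of "d - e" m] by auto
  qed
qed

definition homogeneous :: "'n::finite rpoly \<Rightarrow> bool" where
  "homogeneous f \<longleftrightarrow> (\<exists>d. f \<in> forms d)"

lemma hcomp_ideal:
  assumes "\<And>a. a \<in> A \<Longrightarrow> homogeneous a" "f \<in> ideal.span A"
  shows "hcomp d f \<in> ideal.span A"
  using assms(2)
proof (induction rule: ideal.span_induct_alt)
  case base
  then show ?case by (simp add: ideal.span_zero)
next
  case (step c a f)
  obtain e where e: "a \<in> forms e" using assms(1) step homogeneous_def by blast
  have "hcomp d (a * c) \<in> ideal.span A"
    using step by (auto simp: hcomp_mult[OF e] intro: ideal_multR ideal.span_zero ideal.span_base)
  then show ?case using step by (simp add: hcomp_add mult.commute ideal.span_add)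
qed

text \<open>Components of the right degree of any representation do the job. This keeps all divisions
below inside a single degree, so that one can argue by induction on it. The last clause treats forms of
negative degree, which truncated subtraction would otherwise turn into constants.\<close>

lemma ideal_insert_forms:
  assumes "\<And>a. a \<in> A \<Longrightarrow> homogeneous a" "a \<in> forms e" "f \<in> forms d" "f \<in> ideal.span (insert a A)"
  shows "\<exists>g. g \<in> forms (d - e) \<and> f - a * g \<in> ideal.span A \<and> (d < e \<longrightarrow> g = 0)"
proof -
  obtain k where k: "f - k * a \<in> ideal.span A" using assms(4) by (auto simp: ideal.span_insert)
  have "hcomp d (f - k * a) \<in> ideal.span A" by (rule hcomp_ideal[OF assms(1) k])
  moreover have "hcomp d (f - k * a) = f - (if e \<le> d then a * hcomp (d - e) k else 0)"
    using hcomp_id[OF assms(3)] hcomp_mult[OF assms(2), of d k]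
    by (simp add: linear_diff[OF linear_hcomp] mult.commute)
  ultimately show ?thesis
    by (intro exI[of _ "if e \<le> d then hcomp (d - e) k else 0"]) (auto simp: hcomp_forms)
qed

section \<open>Linear algebra\<close>

lemma dependent_family:
  fixes s :: "nat \<Rightarrow> 'a::real_vector"
  assumes "finite B" "card B \<le> n" "\<And>i. i \<le> n \<Longrightarrow> s i \<in> span B"
  shows "\<exists>p. (\<exists>i\<le>n. p i \<noteq> 0) \<and> (\<Sum>i\<le>n. p i *\<^sub>R s i) = 0"
proof (cases "inj_on s {..n}")
  case True
  have "dependent (s ` {..n})"
  proof (rule ccontr)
    assume "independent (s ` {..n})"
    then have "card (s ` {..n}) \<le> card B"
      using real_vector.independent_span_bound[OF assms(1)] assms(3) by blast
    then show False using assms(2) True by (simp add: card_image)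
  qed
  then obtain u v where u: "(\<Sum>v\<in>s ` {..n}. u v *\<^sub>R v) = 0" "v \<in> s ` {..n}" "u v \<noteq> 0"
    using real_vector.dependent_finite[of "s ` {..n}"] by auto
  then show ?thesis
    by (intro exI[of _ "\<lambda>i. u (s i)"]) (auto simp: sum.reindex[OF True] o_def)
next
  case False
  then obtain i j where ij: "i \<le> n" "j \<le> n" "i \<noteq> j" "s i = s j" by (auto simp: inj_on_def)
  define p :: "nat \<Rightarrow> real" where "p k = (if k = i then 1 else 0) - (if k = j then 1 else 0)" for k
  have "(\<Sum>k\<le>n. p k *\<^sub>R s k) = (\<Sum>k\<le>n. if k = i then s k else 0) - (\<Sum>k\<le>n. if k = j then s k else 0)"
    unfolding sum_subtractf[symmetric] by (rule sum.cong) (auto simp: p_def algebra_simps)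
  also have "\<dots> = 0" using ij by simp
  finally show ?thesis using ij by (intro exI[of _ p]) (auto simp: p_def)
qed

lemma dependent_family_mod:
  fixes y :: "nat \<Rightarrow> 'a::real_vector"
  assumes "subspace J" "finite B" "card B \<le> n" "\<And>i. i \<le> n \<Longrightarrow> \<exists>b\<in>span B. y i - b \<in> J"
  shows "\<exists>p. (\<exists>i\<le>n. p i \<noteq> 0) \<and> (\<Sum>i\<le>n. p i *\<^sub>R y i) \<in> J"
proof -
  obtain s where s: "\<And>i. i \<le> n \<Longrightarrow> s i \<in> span B \<and> y i - s i \<in> J" using assms(4) by metis
  obtain p where p: "\<exists>i\<le>n. p i \<noteq> 0" "(\<Sum>i\<le>n. p i *\<^sub>R s i) = 0"
    using dependent_family[OF assms(2,3), of s] s by auto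
  have "(\<Sum>i\<le>n. p i *\<^sub>R (y i - s i)) \<in> J"
    by (intro real_vector.subspace_sum[OF assms(1)] real_vector.subspace_scale[OF assms(1)]) (use s in auto)
  then have "(\<Sum>i\<le>n. p i *\<^sub>R y i) \<in> J" by (simp add: algebra_simps sum_subtractf p)
  with p show ?thesis by blast
qed

text \<open>The functional is assumed to be linear only on the subspace, because the functionals of
interest below are defined separately on each degree.\<close>

lemma subset_span_insert_kernel:
  fixes \<phi> :: "'a::real_vector \<Rightarrow> real"
  assumes U: "subspace U" and \<phi>: "\<And>x y c. x \<in> U \<Longrightarrow> y \<in> U \<Longrightarrow> \<phi> (x - c *\<^sub>R y) = \<phi> x - c * \<phi> y"
  shows "\<exists>e\<in>U. U \<subseteq> span (insert e {u\<in>U. \<phi> u = 0})"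
proof (cases "\<exists>e\<in>U. \<phi> e \<noteq> 0")
  case True
  then obtain e where e: "e \<in> U" "\<phi> e \<noteq> 0" by blast
  have "u \<in> span (insert e {u\<in>U. \<phi> u = 0})" if "u \<in> U" for u
  proof -
    have "u - (\<phi> u / \<phi> e) *\<^sub>R e \<in> {u\<in>U. \<phi> u = 0}"
      using U e that by (auto simp: \<phi> real_vector.subspace_diff real_vector.subspace_scale)
    then show ?thesis
      by (metis (no_types, lifting) real_vector.span_base real_vector.span_breakdown_eq)
  qed
  with e show ?thesis by blast
next
  case False
  then have "U \<subseteq> span {u\<in>U. \<phi> u = 0}" using real_vector.span_superset by fastforce
  then show ?thesis using real_vector.subspace_0[OF U]
    by (intro bexI[of _ 0]) (auto simp: real_vector.span_insert_0)
qed

lemma subspace_eq_of_dim_le: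
  fixes A B :: "'a::real_vector set"
  assumes AB: "subspace A" "subspace B" "A \<subseteq> B" "dim B \<le> dim A" and F: "finite F" "B \<subseteq> span F"
  shows "A = B"
proof (rule ccontr)
  assume "A \<noteq> B"
  then obtain b where b: "b \<in> B" "b \<notin> A" using AB by blast
  obtain Z where Z: "Z \<subseteq> A" "independent Z" "A \<subseteq> span Z" "card Z = dim A"
    by (rule real_vector.basis_exists)
  obtain Z' where Z': "Z' \<subseteq> B" "independent Z'" "B \<subseteq> span Z'" "card Z' = dim B"
    by (rule real_vector.basis_exists)
  have "span Z \<subseteq> A" by (rule real_vector.span_minimal[OF Z(1) AB(1)])
  then have "b \<notin> span Z" using b by blast
  then have ind: "independent (insert b Z)" using Z by (simp add: real_vector.independent_insertI)
  have "Z \<subseteq> span F" "Z' \<subseteq> span F" using Z(1) Z'(1) AB(3) F(2) by auto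
  then have fin: "finite Z" "finite Z'"
    using real_vector.independent_span_bound[OF F(1) Z(2)] real_vector.independent_span_bound[OF F(1) Z'(2)] by auto
  have sub: "insert b Z \<subseteq> span Z'" using Z(1) Z'(3) AB(3) b(1) by auto
  have "card (insert b Z) \<le> card Z'"
    using real_vector.independent_span_bound[OF fin(2) ind sub] by auto
  moreover have "b \<notin> Z" using \<open>b \<notin> span Z\<close> by (meson real_vector.span_base)
  then have "card (insert b Z) = Suc (card Z)" using fin by simp
  ultimately show False using Z Z' AB by simp
qed

lemma forms_2_subset_span: "forms 2 \<subseteq> span {var i * var j | i j. True}"
proof -
  have "monomial m \<in> {var i * var j | i j. True}" if m: "mdeg m = 2" for m :: "'a \<Rightarrow>\<^sub>0 nat"
  proof -
    obtain i m' where 1: "mdeg m' = Suc 0" "monomial m = var i * monomial m'"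
      using exists_var_factor[of m "Suc 0"] m by auto
    obtain j m'' where 2: "mdeg m'' = 0" "monomial m' = var j * monomial m''"
      using exists_var_factor[of m' 0] 1 by auto
    then have "monomial m = var i * var j" using 1 by (simp add: mdeg_eq_0_iff)
    then show ?thesis by blast
  qed
  then have "monomial ` {m :: 'a \<Rightarrow>\<^sub>0 nat. mdeg m = 2} \<subseteq> {var i * var j | i j. True}" by blast
  then show ?thesis using forms_subset_span_monom[of 2] real_vector.span_mono by blast
qed

section \<open>Regular sequences\<close>

text \<open>Nonzerodivisors modulo a homogeneous ideal, tested on homogeneous elements so that induction
on the degree is available.\<close>

definition nzd :: "'n::finite rpoly \<Rightarrow> 'n rpoly set \<Rightarrow> bool" where
  "nzd a I \<longleftrightarrow> (\<forall>y. homogeneous y \<longrightarrow> a * y \<in> I \<longrightarrow> y \<in> I)"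

text \<open>Regular sequences, with the generators that are already divided out collected in \<open>X\<close>, so that
a sequence can be cut at any place.\<close>

primrec regular_over :: "'n::finite rpoly set \<Rightarrow> 'n rpoly list \<Rightarrow> bool" where
  "regular_over X [] \<longleftrightarrow> True"
| "regular_over X (a # as) \<longleftrightarrow> nzd a (ideal.span X) \<and> regular_over (insert a X) as"

definition posform :: "'n::finite rpoly \<Rightarrow> bool" where
  "posform a \<longleftrightarrow> (\<exists>d>0. a \<in> forms d)"

lemma homogeneousI: "f \<in> forms d \<Longrightarrow> homogeneous f"
  by (auto simp: homogeneous_def)

lemma posform_homogeneous: "posform a \<Longrightarrow> homogeneous a"
  by (auto simp: posform_def homogeneous_def)

lemma nzdD: "nzd a I \<Longrightarrow> y \<in> forms d \<Longrightarrow> a * y \<in> I \<Longrightarrow> y \<in> I"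
  by (auto simp: nzd_def homogeneous_def)

lemma nzd_power:
  assumes "nzd a I" "a \<in> forms e" "y \<in> forms d" "a ^ n * y \<in> I" shows "y \<in> I"
  using assms(4)
proof (induction n)
  case (Suc n)
  have "a ^ n * y \<in> forms (n * e + d)"
    by (intro forms_mult forms_power assms)
  moreover have "a * (a ^ n * y) \<in> I" using Suc.prems by (simp add: mult.assoc)
  ultimately have "a ^ n * y \<in> I" by (rule nzdD[OF assms(1)])
  then show ?case by (rule Suc.IH)
qed simp

lemma regular_over_append:
  "regular_over X (as @ bs) \<longleftrightarrow> regular_over X as \<and> regular_over (X \<union> set as) bs"
  by (induction as arbitrary: X) auto

lemma ideal_mono: "A \<subseteq> B \<Longrightarrow> x \<in> ideal.span A \<Longrightarrow> x \<in> ideal.span B"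
  using ideal.span_mono by blast

text \<open>This is why homogeneous regular sequences may be permuted. If \<open>c * y\<close> is in the ideal of \<open>X\<close>, then
\<open>y\<close> is a multiple \<open>b * g\<close> modulo \<open>X\<close>, as \<open>c\<close> is regular modulo \<open>b\<close>; cancelling \<open>b\<close> leaves
\<open>c * g\<close> with \<open>g\<close> of smaller degree, and the descent ends.\<close>

lemma nzd_swap:
  assumes X: "\<And>x. x \<in> X \<Longrightarrow> homogeneous x" and b: "posform b" and c: "homogeneous c"
    and nb: "nzd b (ideal.span X)" and nc: "nzd c (ideal.span (insert b X))"
  shows "nzd c (ideal.span X)" "nzd b (ideal.span (insert c X))"
proof -
  obtain e where e: "b \<in> forms e" "e > 0" using b posform_def by blast
  obtain e' where e': "c \<in> forms e'" using c homogeneous_def by blast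
  have up: "x \<in> ideal.span X \<Longrightarrow> x \<in> ideal.span (insert b X)" for x
    by (rule ideal_mono) auto
  have "y \<in> ideal.span X" if "y \<in> forms d" "c * y \<in> ideal.span X" for d y
    using that
  proof (induction d arbitrary: y rule: less_induct)
    case (less d)
    have "y \<in> ideal.span (insert b X)" by (rule nzdD[OF nc less(2) up[OF less(3)]])
    then obtain g where g: "g \<in> forms (d - e)" "y - b * g \<in> ideal.span X" "d < e \<Longrightarrow> g = 0"
      using ideal_insert_forms[OF X e(1) less(2)] by blast
    have "c * y - c * (y - b * g) \<in> ideal.span X"
      by (intro ideal.span_diff ideal.span_scale less(3) g)
    then have "b * (c * g) \<in> ideal.span X" by (simp add: algebra_simps)
    then have "c * g \<in> ideal.span X" by (rule nzdD[OF nb forms_mult[OF e' g(1)]])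
    then have "g \<in> ideal.span X"
      using less.IH[of "d - e" g] g e by (cases "d < e") (auto intro: ideal.span_zero)
    then have "(y - b * g) + b * g \<in> ideal.span X" by (intro ideal.span_add ideal.span_scale g)
    then show ?case by simp
  qed
  then show "nzd c (ideal.span X)" by (auto simp: nzd_def homogeneous_def)
  have "y \<in> ideal.span (insert c X)" if y: "y \<in> forms d" "b * y \<in> ideal.span (insert c X)" for d y
  proof -
    obtain z where z: "z \<in> forms (e + d - e')" "b * y - c * z \<in> ideal.span X" "e + d < e' \<Longrightarrow> z = 0"
      using ideal_insert_forms[OF X e' forms_mult[OF e(1) y(1)] y(2)] by blast
    have "b * y - (b * y - c * z) \<in> ideal.span (insert b X)"
      by (intro ideal.span_diff up z ideal_multR ideal.span_base) auto
    then have "z \<in> ideal.span (insert b X)" using nzdD[OF nc z(1)] by simp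
    then obtain w where w: "w \<in> forms (e + d - e' - e)" "z - b * w \<in> ideal.span X" "e + d - e' < e \<Longrightarrow> w = 0"
      using ideal_insert_forms[OF X e(1) z(1)] by blast
    have "(b * y - c * z) + c * (z - b * w) \<in> ideal.span X"
      by (intro ideal.span_add ideal.span_scale z w)
    then have *: "b * (y - c * w) \<in> ideal.span X" by (simp add: algebra_simps)
    have "c * w \<in> forms d"
    proof (cases "e' \<le> d")
      case True
      then show ?thesis using w(1) e' by (intro forms_mult_eq[of _ e' _ "e + d - e' - e"]) auto
    next
      case False
      then have "w = 0" using w(3) e(2) by simp
      then show ?thesis by simp
    qed
    then have "y - c * w \<in> ideal.span X" using nzdD[OF nb _ *] forms_diff y by blast
    then have "(y - c * w) + c * w \<in> ideal.span (insert c X)"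
      by (intro ideal.span_add ideal_multR[OF ideal.span_base]) (auto intro: ideal_mono[of X])
    then show ?thesis by simp
  qed
  then show "nzd b (ideal.span (insert c X))" by (auto simp: nzd_def homogeneous_def)
qed

lemma regular_over_move_last:
  assumes "\<And>x. x \<in> X \<Longrightarrow> homogeneous x" "\<And>x. x \<in> set as \<Longrightarrow> posform x" "posform a"
    "regular_over X (as @ [a])"
  shows "regular_over X (a # as)"
  using assms
proof (induction as arbitrary: X)
  case (Cons b as)
  have "regular_over (insert b X) (a # as)"
    by (rule Cons.IH) (use Cons.prems posform_homogeneous in auto)
  then show ?case
    using nzd_swap[of X b a] Cons.prems posform_homogeneous by (auto simp: insert_commute)
qed simp

lemma regular_over_move_first:
  assumes "\<And>x. x \<in> X \<Longrightarrow> homogeneous x" "\<And>x. x \<in> set as \<Longrightarrow> posform x" "posform a"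
    "regular_over X (a # as)"
  shows "regular_over X (as @ [a])"
  using assms
proof (induction as arbitrary: X)
  case (Cons b as)
  have *: "nzd b (ideal.span X)" "nzd a (ideal.span (insert b X))"
    using nzd_swap[of X a b] Cons.prems posform_homogeneous by auto
  have "regular_over (insert b X) (as @ [a])"
    by (rule Cons.IH) (use Cons.prems posform_homogeneous * in \<open>auto simp: insert_commute\<close>)
  then show ?case using * by simp
qed simp

section \<open>Irrelevant ideals\<close>

text \<open>For forms this means that the only common complex zero is the origin. Stating it through powers of the
variables keeps all arguments over the real numbers.\<close>

definition irrelevant :: "'n::finite rpoly set \<Rightarrow> bool" where
  "irrelevant A \<longleftrightarrow> (\<forall>i. \<exists>N. var i ^ N \<in> ideal.span A)"

lemma var_power: "var i ^ k = monomial (Poly_Mapping.single i k)"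
  by (induction k) (auto simp: var_def mult_single single_add[symmetric])

lemma irrelevant_forms:
  assumes "irrelevant (A :: 'n::finite rpoly set)"
  shows "\<exists>N. \<forall>d\<ge>N. forms d \<subseteq> ideal.span A"
proof -
  obtain N where N: "\<And>i. var i ^ N i \<in> ideal.span A" using assms irrelevant_def by metis
  have "monomial m \<in> ideal.span A" if "mdeg m \<ge> (\<Sum>i\<in>UNIV. N i)" for m :: "'n \<Rightarrow>\<^sub>0 nat"
  proof -
    have "\<exists>i. Poly_Mapping.lookup m i \<ge> N i"
    proof (rule ccontr)
      assume "\<not> ?thesis"
      then have "mdeg m < (\<Sum>i\<in>UNIV. N i)"
        unfolding mdeg_def by (intro sum_strict_mono) (auto simp: not_le)
      with that show False by simp
    qed
    then obtain i where i: "Poly_Mapping.lookup m i \<ge> N i" by blast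
    have "m = (m - Poly_Mapping.single i (N i)) + Poly_Mapping.single i (N i)"
      using i by (intro poly_mapping_eqI) (auto simp: lookup_add lookup_minus lookup_single when_def)
    then have "monomial m = monomial (m - Poly_Mapping.single i (N i)) * var i ^ N i"
      by (metis mult_single var_power mult_1)
    then show ?thesis by (metis N ideal.span_scale)
  qed
  then have "forms d \<subseteq> ideal.span A" if "d \<ge> (\<Sum>i\<in>UNIV. N i)" for d
    using forms_subset_span_monom[of d] real_vector.span_minimal[OF _ subspace_ideal, of "monomial ` {m. mdeg m = d}" A] that
    by auto
  then show ?thesis by blast
qed

lemma irrelevant_power:
  assumes "irrelevant A" "posform a" shows "\<exists>N. a ^ N \<in> ideal.span A"
proof -
  obtain N where N: "\<forall>d\<ge>N. forms d \<subseteq> ideal.span A" using irrelevant_forms[OF assms(1)] by blast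
  obtain e where e: "e > 0" "a \<in> forms e" using assms(2) posform_def by blast
  have "a ^ N \<in> forms (N * e)" by (rule forms_power[OF e(2)])
  moreover have "N * e \<ge> N" using e by simp
  ultimately show ?thesis using N by blast
qed

lemma irrelevant_mono: "irrelevant A \<Longrightarrow> A \<subseteq> ideal.span B \<Longrightarrow> irrelevant B"
  unfolding irrelevant_def using ideal.span_minimal[OF _ ideal.subspace_span, of A B] by blast

text \<open>A power of \<open>a\<close> is a multiple of \<open>w\<close> modulo \<open>Y\<close>. So if \<open>w\<close> annihilates \<open>y\<close> modulo
\<open>Y\<close>, a power of \<open>a\<close> does, and \<open>a\<close> can be cancelled.\<close>

lemma nzd_exchange:
  assumes "nzd a (ideal.span Y)" "posform a" "irrelevant (insert w Y)"
  shows "nzd w (ideal.span Y)"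
  unfolding nzd_def
proof (intro allI impI)
  fix y assume y: "homogeneous y" "w * y \<in> ideal.span Y"
  obtain N where "a ^ N \<in> ideal.span (insert w Y)" using irrelevant_power[OF assms(3,2)] by blast
  then obtain k where "a ^ N - k * w \<in> ideal.span Y" by (auto simp: ideal.span_insert)
  then have "(a ^ N - k * w) * y + k * (w * y) \<in> ideal.span Y"
    by (intro ideal.span_add ideal_multR ideal.span_scale y)
  then have "a ^ N * y \<in> ideal.span Y" by (simp add: algebra_simps)
  then show "y \<in> ideal.span Y"
    using nzd_power[OF assms(1)] assms(2) y(1) by (auto simp: posform_def homogeneous_def)
qed

lemma scaleR_power_rpoly: "(c *\<^sub>R f) ^ n = c ^ n *\<^sub>R (f :: 'n rpoly) ^ n"
  by (induction n) (auto simp: mult.commute)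

text \<open>In high degrees every form is a multiple of \<open>a\<close> modulo \<open>Y\<close>, so the dimension of the quotient stops
growing: the quotient has Krull dimension at most one.\<close>

lemma quotient_dim_bounded:
  assumes Y: "\<And>y. y \<in> Y \<Longrightarrow> homogeneous y" and a: "a \<in> forms e" "e > 0"
    and irr: "irrelevant (insert a Y)"
  shows "\<exists>C. \<forall>d. \<exists>B. finite B \<and> card B \<le> C \<and> (\<forall>y\<in>forms d. \<exists>b\<in>span B. y - b \<in> ideal.span Y)"
proof -
  obtain N where N: "\<forall>d\<ge>N. forms d \<subseteq> ideal.span (insert a Y)" using irrelevant_forms[OF irr] by blast
  have "\<forall>d. \<exists>B. finite B \<and> forms d \<subseteq> span (B :: 'a rpoly set)" using forms_dim_bound by blast
  then obtain B :: "nat \<Rightarrow> 'a rpoly set" where B: "\<And>d. finite (B d)" "\<And>d. forms d \<subseteq> span (B d)"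
    by metis
  define C where "C = (\<Sum>d<N+e. card (B d))"
  have "\<exists>B. finite B \<and> card B \<le> C \<and> (\<forall>y\<in>forms d. \<exists>b\<in>span B. y - b \<in> ideal.span Y)" for d
  proof (induction d rule: less_induct)
    case (less d)
    show ?case
    proof (cases "d < N + e")
      case True
      then have "card (B d) \<le> C" unfolding C_def by (intro member_le_sum) auto
      then show ?thesis using B ideal.span_zero by (intro exI[of _ "B d"]) force
    next
      case False
      then obtain B' where B': "finite B'" "card B' \<le> C"
        "\<And>y. y \<in> forms (d - e) \<Longrightarrow> \<exists>b\<in>span B'. y - b \<in> ideal.span Y"
        using less[of "d - e"] a(2) by auto
      have "\<exists>b\<in>span ((*) a ` B'). y - b \<in> ideal.span Y" if y: "y \<in> forms d" for y
      proof -
        have "y \<in> ideal.span (insert a Y)" using N[rule_format, of d] False y by auto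
        then obtain g where g: "g \<in> forms (d - e)" "y - a * g \<in> ideal.span Y"
          using ideal_insert_forms[OF Y a(1) y] by blast
        obtain b where b: "b \<in> span B'" "g - b \<in> ideal.span Y" using B' g by blast
        have "(y - a * g) + a * (g - b) \<in> ideal.span Y"
          by (intro ideal.span_add ideal.span_scale g b)
        then have "y - a * b \<in> ideal.span Y" by (simp add: algebra_simps)
        moreover have "a * b \<in> span ((*) a ` B')"
          using linear_span_image[OF linear_mult_left, of a B'] b by blast
        ultimately show ?thesis by blast
      qed
      then show ?thesis using B' card_image_le[of B' "(*) a"]
        by (intro exI[of _ "(*) a ` B'"]) auto
    qed
  qed
  then show ?thesis by blast
qed

text \<open>Noether normalisation for a quotient of dimension one. Two elements \<open>w1\<close> and \<open>w2\<close> of \<open>W\<close> satisfy a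
homogeneous relation modulo \<open>Y\<close>, since their monomials of high degree outnumber the dimension. After the
substitution \<open>w1 = w + c w2\<close>, with \<open>c\<close> not a root of the relation, a power of \<open>w2\<close> is a
multiple of \<open>w\<close>, so \<open>w\<close> replaces both.\<close>

lemma generic_parameter:
  assumes Y: "\<And>y. y \<in> Y \<Longrightarrow> homogeneous y" and a: "posform a" "irrelevant (insert a Y)"
    and W: "subspace W" "W \<subseteq> forms e"
    and ts: "set ts \<subseteq> W" "irrelevant (set ts \<union> Y)"
  shows "\<exists>w\<in>W. irrelevant (insert w Y)"
  using ts
proof (induction "length ts" arbitrary: ts rule: less_induct)
  case less
  consider "ts = []" | w where "ts = [w]" | w1 w2 us where "ts = w1 # w2 # us"
    by (metis list.exhaust)
  then show ?case
  proof cases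
    case 1
    then have "irrelevant (insert 0 Y)"
      using less.prems irrelevant_mono[of Y "insert 0 Y"] ideal.span_superset[of "insert 0 Y"] by auto
    then show ?thesis using real_vector.subspace_0[OF W(1)] by blast
  next
    case 2
    then show ?thesis using less.prems by auto
  next
    case 3
    obtain C where C: "\<And>d. \<exists>B. finite B \<and> card B \<le> C \<and> (\<forall>y\<in>forms d. \<exists>b\<in>span B. y - b \<in> ideal.span Y)"
      using quotient_dim_bounded[OF Y _ _ a(2)] a(1) posform_def by metis
    have wf: "w1 \<in> forms e" "w2 \<in> forms e" "w1 \<in> W" "w2 \<in> W" using 3 less.prems W by auto
    have pf: "w1 ^ i * w2 ^ (C - i) \<in> forms (C * e)" if "i \<le> C" for i
    proof -
      have "C * e = i * e + (C - i) * e" using that by (simp add: add_mult_distrib[symmetric])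
      then show ?thesis by (rule forms_mult_eq[OF forms_power[OF wf(1)] forms_power[OF wf(2)]])
    qed
    obtain B where B: "finite B" "card B \<le> C" "\<And>y. y \<in> forms (C * e) \<Longrightarrow> \<exists>b\<in>span B. y - b \<in> ideal.span Y"
      using C[of "C * e"] by blast
    obtain p where p: "\<exists>i\<le>C. p i \<noteq> 0" "(\<Sum>i\<le>C. p i *\<^sub>R (w1 ^ i * w2 ^ (C - i))) \<in> ideal.span Y"
      using dependent_family_mod[OF subspace_ideal B(1,2), of "\<lambda>i. w1 ^ i * w2 ^ (C - i)"] B(3)[OF pf] by blast
    have "finite {x :: real. (\<Sum>i\<le>C. p i * x ^ i) = 0}"
      using p(1) by (simp add: polyfun_finite_roots)
    then obtain c :: real where c: "(\<Sum>i\<le>C. p i * c ^ i) \<noteq> 0"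
      using infinite_UNIV_char_0 by (metis (mono_tags, lifting) UNIV_eq_I mem_Collect_eq)
    define w where "w = w1 - c *\<^sub>R w2"
    have wW: "w \<in> W" unfolding w_def using wf W by (intro real_vector.subspace_diff real_vector.subspace_scale) auto
    define K where "K = insert w (set us \<union> Y)"
    have wK: "w \<in> ideal.span K" unfolding K_def by (rule ideal.span_base) auto
    have "w1 ^ i * w2 ^ (C - i) - c ^ i *\<^sub>R w2 ^ C \<in> ideal.span K" if "i \<le> C" for i
    proof -
      have "w1 ^ i - (c *\<^sub>R w2) ^ i \<in> ideal.span K"
        unfolding power_diff_sumr2 using ideal_multR[OF wK] by (simp add: w_def)
      then have "(w1 ^ i - (c *\<^sub>R w2) ^ i) * w2 ^ (C - i) \<in> ideal.span K" by (rule ideal_multR)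
      moreover have "w2 ^ i * w2 ^ (C - i) = w2 ^ C" using that by (metis le_add_diff_inverse power_add)
      ultimately show ?thesis by (simp add: left_diff_distrib scaleR_power_rpoly)
    qed
    then have "(\<Sum>i\<le>C. p i *\<^sub>R (w1 ^ i * w2 ^ (C - i) - c ^ i *\<^sub>R w2 ^ C)) \<in> ideal.span K"
      by (intro ideal.span_sum ideal_scaleR) auto
    moreover have "(\<Sum>i\<le>C. p i *\<^sub>R (w1 ^ i * w2 ^ (C - i))) \<in> ideal.span K"
      using ideal_mono[OF _ p(2), of K] K_def by auto
    ultimately have "(\<Sum>i\<le>C. p i *\<^sub>R (w1 ^ i * w2 ^ (C - i))) -
        (\<Sum>i\<le>C. p i *\<^sub>R (w1 ^ i * w2 ^ (C - i) - c ^ i *\<^sub>R w2 ^ C)) \<in> ideal.span K"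
      by (rule ideal.span_diff[rotated])
    then have "(\<Sum>i\<le>C. p i * c ^ i) *\<^sub>R w2 ^ C \<in> ideal.span K"
      by (simp add: algebra_simps sum_subtractf scaleR_sum_left)
    then have "inverse (\<Sum>i\<le>C. p i * c ^ i) *\<^sub>R (\<Sum>i\<le>C. p i * c ^ i) *\<^sub>R w2 ^ C \<in> ideal.span K"
      by (rule ideal_scaleR)
    then have w2: "w2 ^ C \<in> ideal.span K" using c by simp
    have "irrelevant K"
      unfolding irrelevant_def
    proof
      fix i
      obtain N where N: "var i ^ N \<in> ideal.span (set ts \<union> Y)"
        using less.prems irrelevant_def by blast
      have "set ts \<union> Y \<subseteq> ideal.span (insert w2 K)"
      proof -
        have "w + (c *\<^sub>R 1) * w2 \<in> ideal.span (insert w2 K)"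
          by (intro ideal.span_add ideal.span_scale ideal.span_base) (auto simp: K_def)
        then have "w1 \<in> ideal.span (insert w2 K)" by (simp add: w_def)
        then show ?thesis using 3 ideal.span_superset[of "insert w2 K"] by (auto simp: K_def)
      qed
      then have "var i ^ N \<in> ideal.span (insert w2 K)"
        using N ideal.span_minimal[OF _ ideal.subspace_span] by blast
      then obtain k where k: "var i ^ N - k * w2 \<in> ideal.span K" by (auto simp: ideal.span_insert)
      have "(var i ^ N) ^ C - (k * w2) ^ C \<in> ideal.span K"
        unfolding power_diff_sumr2 by (rule ideal_multR[OF k])
      moreover have "(k * w2) ^ C \<in> ideal.span K"
        unfolding power_mult_distrib by (rule ideal.span_scale[OF w2])
      ultimately have "(var i ^ N) ^ C - (k * w2) ^ C + (k * w2) ^ C \<in> ideal.span K" by (rule ideal.span_add)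
      then show "\<exists>N. var i ^ N \<in> ideal.span K" by (auto simp: power_mult[symmetric])
    qed
    then show ?thesis
      using less.hyps[of "w # us"] less.prems 3 wW by (auto simp: K_def)
  qed
qed

section \<open>Socles\<close>

definition socle :: "'n::finite rpoly set \<Rightarrow> nat \<Rightarrow> 'n rpoly set" where
  "socle I d = {y \<in> forms d. \<forall>i. var i * y \<in> I}"

text \<open>The socle of the quotient by \<open>I\<close> lives in degree \<open>s\<close> and is at most one-dimensional there. For
an irrelevant ideal this is the statement that the quotient is Gorenstein (or zero).\<close>

definition simple_socle :: "'n::finite rpoly set \<Rightarrow> nat \<Rightarrow> bool" where
  "simple_socle I s \<longleftrightarrow> (\<forall>d. d \<noteq> s \<longrightarrow> socle I d \<subseteq> I) \<and>
     (\<forall>y\<in>socle I s. \<forall>y'\<in>socle I s. \<exists>c c'. (c \<noteq> 0 \<or> c' \<noteq> 0) \<and> c *\<^sub>R y + c' *\<^sub>R y' \<in> I)"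

lemma socle_mult:
  assumes "y \<in> socle (ideal.span A) d" "posform a" shows "a * y \<in> ideal.span A"
proof -
  obtain e where "a \<in> forms (Suc e)" using assms(2) by (metis gr0_conv_Suc posform_def)
  then have "a \<in> span {var i * g | i g. g \<in> forms e}" using forms_Suc_subset_span by blast
  then show ?thesis
  proof (induction rule: real_vector.span_induct_alt)
    case base
    then show ?case by (simp add: ideal.span_zero)
  next
    case (step c x z)
    then obtain i g where x: "x = var i * g" by blast
    have "(var i * y) * g \<in> ideal.span A" using assms(1) by (intro ideal_multR[of "var i * y"]) (simp add: socle_def)
    then have "c *\<^sub>R (x * y) + z * y \<in> ideal.span A"
      using step by (intro ideal.span_add ideal_scaleR) (simp_all add: x mult_ac)
    then show ?case by (simp add: distrib_right)
  qed
qed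

text \<open>The relation \<open>a * y = b * z\<close> modulo \<open>Y\<close> matches socle elements \<open>y\<close> modulo \<open>b\<close> with socle
elements \<open>z\<close> modulo \<open>a\<close>: both socles describe the same Ext module of the quotient by \<open>Y\<close>. The
degrees of \<open>y\<close> and \<open>z\<close> differ by the difference of the degrees of \<open>a\<close> and \<open>b\<close>.\<close>

lemma socle_transport:
  assumes Y: "\<And>y. y \<in> Y \<Longrightarrow> homogeneous y" and a: "a \<in> forms e" "e > 0" and b: "b \<in> forms e'" "e' > 0"
    and na: "nzd a (ideal.span Y)" and nb: "nzd b (ideal.span Y)"
    and s: "simple_socle (ideal.span (insert a Y)) s" and s': "s' + e = s + e'"
  shows "simple_socle (ideal.span (insert b Y)) s'"
proof -
  let ?A = "ideal.span (insert a Y)" and ?B = "ideal.span (insert b Y)"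
  have up: "\<And>x c. x \<in> ideal.span Y \<Longrightarrow> x \<in> ideal.span (insert c Y)"
    by (rule ideal_mono) auto
  have into: "\<exists>z. z \<in> socle ?A (e + d - e') \<and> a * y - b * z \<in> ideal.span Y \<and> (e + d < e' \<longrightarrow> z = 0)"
    if y: "y \<in> socle ?B d" for d y
  proof -
    have yf: "y \<in> forms d" using y socle_def by blast
    have "a * y \<in> ?B" by (rule socle_mult[OF y]) (use a posform_def in blast)
    then obtain z where z: "z \<in> forms (e + d - e')" "a * y - b * z \<in> ideal.span Y" "e + d < e' \<Longrightarrow> z = 0"
      using ideal_insert_forms[OF Y b(1) forms_mult[OF a(1) yf]] by blast
    have "var i * z \<in> ?A" for i
    proof -
      have "var i * y \<in> ?B" using y socle_def by blast
      then obtain w where w: "w \<in> forms (Suc d - e')" "var i * y - b * w \<in> ideal.span Y" "Suc d < e' \<Longrightarrow> w = 0"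
        using ideal_insert_forms[OF Y b(1), where f = "var i * y" and d = "Suc d"] forms_mult[OF forms_var yf, of i] by auto
      have "a * (var i * y - b * w) - var i * (a * y - b * z) \<in> ideal.span Y"
        by (intro ideal.span_diff ideal.span_scale w z)
      then have *: "b * (var i * z - a * w) \<in> ideal.span Y" by (simp add: algebra_simps)
      have "homogeneous (var i * z - a * w)"
      proof (cases "Suc d < e'")
        case True
        then show ?thesis using w(3) homogeneousI[OF forms_mult[OF forms_var z(1)]] by simp
      next
        case False
        then have "Suc (e + d - e') = e + (Suc d - e')" using a by simp
        then show ?thesis
          using forms_diff[OF forms_mult[OF forms_var z(1)] forms_mult_eq[OF a(1) w(1)], of i]
          by (auto intro: homogeneousI)
      qed
      then have "var i * z - a * w \<in> ideal.span Y" using nb * by (simp add: nzd_def)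
      then have "(var i * z - a * w) + a * w \<in> ?A"
        by (intro ideal.span_add ideal_multR[OF ideal.span_base] up) auto
      then show ?thesis by simp
    qed
    with z show ?thesis by (auto simp: socle_def)
  qed
  have pull: "y \<in> ?B" if y: "y \<in> forms d" "z \<in> forms (e + d - e')" "a * y - b * z \<in> ideal.span Y"
      "e + d < e' \<Longrightarrow> z = 0" "z \<in> ?A" for d y z
  proof -
    obtain u where u: "u \<in> forms (e + d - e' - e)" "z - a * u \<in> ideal.span Y" "e + d - e' < e \<Longrightarrow> u = 0"
      using ideal_insert_forms[OF Y a(1) y(2,5)] by blast
    have "(a * y - b * z) + b * (z - a * u) \<in> ideal.span Y"
      by (intro ideal.span_add ideal.span_scale u y)
    then have *: "a * (y - b * u) \<in> ideal.span Y" by (simp add: algebra_simps)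
    have "b * u \<in> forms d"
    proof (cases "e' \<le> d")
      case True
      then show ?thesis using u(1) b by (intro forms_mult_eq[of _ e' _ "e + d - e' - e"]) auto
    next
      case False
      then have "u = 0" using u(3) a b by simp
      then show ?thesis by simp
    qed
    then have "y - b * u \<in> ideal.span Y" using nzdD[OF na _ *] forms_diff y by blast
    then have "(y - b * u) + b * u \<in> ?B"
      by (intro ideal.span_add ideal_multR[OF ideal.span_base] up) auto
    then show ?thesis by simp
  qed
  have sf: "y \<in> socle I d \<Longrightarrow> y \<in> forms d" for y d and I :: "'a rpoly set" by (simp add: socle_def)
  show ?thesis
    unfolding simple_socle_def
  proof (intro conjI allI impI ballI subsetI)
    fix d y assume d: "d \<noteq> s'" and y: "y \<in> socle ?B d"
    obtain z where z: "z \<in> socle ?A (e + d - e')" "a * y - b * z \<in> ideal.span Y" "e + d < e' \<Longrightarrow> z = 0"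
      using into[OF y] by blast
    have "z \<in> ?A"
    proof (cases "e + d < e'")
      case True
      then show ?thesis using z ideal.span_zero by simp
    next
      case False
      then have "e + d - e' \<noteq> s" using d s' by simp
      then show ?thesis using s z(1) unfolding simple_socle_def by blast
    qed
    then show "y \<in> ?B" using pull[OF sf[OF y] sf[OF z(1)] z(2,3)] by blast
  next
    fix y y' assume y: "y \<in> socle ?B s'" "y' \<in> socle ?B s'"
    have se: "e + s' - e' = s" "\<not> e + s' < e'" using s' by auto
    obtain z z' where z: "z \<in> socle ?A s" "a * y - b * z \<in> ideal.span Y"
        "z' \<in> socle ?A s" "a * y' - b * z' \<in> ideal.span Y"
      using into[OF y(1)] into[OF y(2)] se by auto
    obtain c c' where c: "c \<noteq> 0 \<or> c' \<noteq> 0" "c *\<^sub>R z + c' *\<^sub>R z' \<in> ?A"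
      using s z unfolding simple_socle_def by blast
    have "c *\<^sub>R (a * y - b * z) + c' *\<^sub>R (a * y' - b * z') \<in> ideal.span Y"
      by (intro ideal.span_add ideal_scaleR z)
    then have "a * (c *\<^sub>R y + c' *\<^sub>R y') - b * (c *\<^sub>R z + c' *\<^sub>R z') \<in> ideal.span Y"
      by (simp add: algebra_simps)
    then have "c *\<^sub>R y + c' *\<^sub>R y' \<in> ?B"
      using c(2) se sf y z by (intro pull[where d = s']) (auto intro!: forms_add forms_scaleR)
    with c(1) show "\<exists>c c'. (c \<noteq> 0 \<or> c' \<noteq> 0) \<and> c *\<^sub>R y + c' *\<^sub>R y' \<in> ?B" by blast
  qed
qed

lemma lookup_var_mult: "Poly_Mapping.lookup (var j * y) (Poly_Mapping.single j 1 + m) = Poly_Mapping.lookup y m"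
proof (rule linear_eq_monom[where p = y and f = "\<lambda>y. Poly_Mapping.lookup (var j * y) (Poly_Mapping.single j 1 + m)"])
  show "linear (\<lambda>y. Poly_Mapping.lookup (var j * y) (Poly_Mapping.single j 1 + m))"
    by (rule linearI) (simp_all add: distrib_left lookup_add)
  show "linear (\<lambda>y :: 'a rpoly. Poly_Mapping.lookup y m)"
    by (rule linearI) (simp_all add: lookup_add)
qed (auto simp: var_def mult_single lookup_single when_def)

lemma lookup_ideal_var:
  assumes "f \<in> ideal.span (var ` S)" "Poly_Mapping.lookup f m \<noteq> 0"
  shows "\<exists>i\<in>S. Poly_Mapping.lookup m i > 0"
  using assms
proof (induction arbitrary: m rule: ideal.span_induct_alt)
  case (step c a f)
  then obtain i where i: "i \<in> S" "a = var i" by blast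
  show ?case
  proof (cases "Poly_Mapping.lookup f m = 0")
    case True
    then have "m \<in> Poly_Mapping.keys (c * a)" using step.prems by (simp add: lookup_add in_keys_iff)
    then obtain n k where "m = n + k" "k \<in> Poly_Mapping.keys a" using keys_mult by blast
    then have "m = n + Poly_Mapping.single i 1" using i by (simp add: var_def)
    then show ?thesis using i by (auto simp: lookup_add intro!: bexI[of _ i])
  qed (use step in blast)
qed simp

lemma in_ideal_varI:
  assumes "\<And>m. Poly_Mapping.lookup f m \<noteq> 0 \<Longrightarrow> \<exists>i\<in>S. Poly_Mapping.lookup m i > 0"
  shows "f \<in> ideal.span (var ` S)"
proof -
  have "monomial m \<in> ideal.span (var ` S)" if "i \<in> S" "Poly_Mapping.lookup m i > 0" for m i
  proof -
    have "m = (m - Poly_Mapping.single i 1) + Poly_Mapping.single i 1"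
      using that by (intro poly_mapping_eqI) (auto simp: lookup_add lookup_minus lookup_single when_def)
    then have "monomial m = monomial (m - Poly_Mapping.single i 1) * var i"
      by (metis mult_single var_def mult_1)
    then show ?thesis by (metis that(1) ideal.span_scale ideal.span_base imageI)
  qed
  then have "(\<Sum>m\<in>Poly_Mapping.keys f. Poly_Mapping.lookup f m *\<^sub>R monomial m) \<in> ideal.span (var ` S)"
    using assms by (intro ideal.span_sum ideal_scaleR) (metis in_keys_iff)
  then show ?thesis using poly_eq_sum_monom[of f] by simp
qed

lemma nzd_var: "j \<notin> S \<Longrightarrow> nzd (var j) (ideal.span (var ` S))"
  unfolding nzd_def
proof (intro allI impI in_ideal_varI)
  fix y m assume "j \<notin> S" and y: "var j * y \<in> ideal.span (var ` S)" "Poly_Mapping.lookup y m \<noteq> 0"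
  then obtain i where "i \<in> S" "Poly_Mapping.lookup (Poly_Mapping.single j 1 + m) i > 0"
    using lookup_ideal_var[OF y(1)] lookup_var_mult by metis
  then show "\<exists>i\<in>S. Poly_Mapping.lookup m i > 0"
    using \<open>j \<notin> S\<close> by (auto simp: lookup_add lookup_single when_def split: if_splits)
qed

lemma regular_over_vars:
  "distinct vs \<Longrightarrow> set vs \<inter> S = {} \<Longrightarrow> regular_over (var ` S) (map var vs)"
proof (induction vs arbitrary: S)
  case (Cons v vs)
  then show ?case using nzd_var[of v S] Cons.IH[of "insert v S"] by auto
qed simp

lemma simple_socle_vars: "simple_socle (ideal.span (range var)) 0"
  unfolding simple_socle_def
proof (intro conjI allI impI ballI subsetI)
  fix d and y :: "'a rpoly" assume d: "d \<noteq> 0" and y: "y \<in> socle (ideal.span (range var)) d"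
  show "y \<in> ideal.span (range var)"
  proof (rule in_ideal_varI)
    fix m assume "Poly_Mapping.lookup y m \<noteq> 0"
    then have "mdeg m \<noteq> 0" using d y by (auto simp: socle_def forms_iff)
    then show "\<exists>i\<in>UNIV. Poly_Mapping.lookup m i > 0"
      by (metis UNIV_I gr0I lookup_zero mdeg_eq_0_iff poly_mapping_eqI)
  qed
next
  fix y y' :: "'a rpoly"
  assume "y \<in> socle (ideal.span (range var)) 0" "y' \<in> socle (ideal.span (range var)) 0"
  then obtain c c' where "y = c *\<^sub>R 1" "y' = c' *\<^sub>R 1" using forms_0_eq by (metis (no_types, lifting) mem_Collect_eq socle_def)
  then have "(if c = 0 then 1 else c') *\<^sub>R y + (- c) *\<^sub>R y' = 0"
    by auto
  then show "\<exists>d d'. (d \<noteq> 0 \<or> d' \<noteq> 0) \<and> d *\<^sub>R y + d' *\<^sub>R y' \<in> ideal.span (range var)"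
    by (rule_tac x = "if c = 0 then 1 else c'" in exI, rule_tac x = "- c" in exI)
      (auto simp only: ideal.span_zero split: if_splits)
qed

text \<open>The variables form a regular sequence whose quotient is the field of constants, with socle in
degree zero. They are exchanged one after the other for generic elements of \<open>W\<close>; every
exchange replaces degree one by degree two and so raises the degree of the socle by one.\<close>

theorem regular_sequence_of_quadrics:
  fixes W :: "'n::finite rpoly set"
  assumes W: "subspace W" "W \<subseteq> forms 2" and T: "finite T" "T \<subseteq> W" "irrelevant T"
  shows "\<exists>ws. length ws = CARD('n) \<and> set ws \<subseteq> W \<and> regular_over {} ws \<and> irrelevant (set ws)
     \<and> simple_socle (ideal.span (set ws)) CARD('n)"
proof -
  obtain ts where ts: "set ts = T" using T(1) finite_list by blast
  have "\<exists>ws us. length ws = k \<and> length us = CARD('n) - k \<and> set ws \<subseteq> W \<and> set us \<subseteq> range var \<and>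
     regular_over {} (ws @ us) \<and> irrelevant (set (ws @ us)) \<and> simple_socle (ideal.span (set (ws @ us))) k"
    if "k \<le> CARD('n)" for k
    using that
  proof (induction k)
    case 0
    obtain vs :: "'n list" where vs: "set vs = UNIV" "distinct vs" using finite_distinct_list[OF finite] by blast
    then have "length vs = CARD('n)" by (metis distinct_card)
    moreover have "irrelevant (range var :: 'n rpoly set)"
      unfolding irrelevant_def by (intro allI exI[of _ 1]) (auto intro: ideal.span_base)
    ultimately show ?case
      using regular_over_vars[OF vs(2), of "{}"] vs simple_socle_vars
      by (intro exI[of _ "[]"] exI[of _ "map var vs"]) auto
  next
    case (Suc k)
    then obtain ws us where IH: "length ws = k" "length us = CARD('n) - k" "set ws \<subseteq> W" "set us \<subseteq> range var"
      "regular_over {} (ws @ us)" "irrelevant (set (ws @ us))" "simple_socle (ideal.span (set (ws @ us))) k"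
      by auto
    have "us \<noteq> []" using IH(2) Suc.prems by auto
    then obtain us' u where us: "us = us' @ [u]" by (metis rev_exhaust)
    let ?Y = "set ws \<union> set us'"
    have pf: "posform x" if "x \<in> W \<or> x \<in> range var" for x
      using that W(2) unfolding posform_def by (metis forms_var imageE pos2 subsetD zero_less_Suc)
    have Y: "\<And>y. y \<in> ?Y \<Longrightarrow> homogeneous y" using IH us pf posform_homogeneous by auto
    have u: "posform u" "u \<in> forms (Suc 0)" using IH us pf by auto
    have Yu: "set (ws @ us) = insert u ?Y" using us by auto
    have nu: "nzd u (ideal.span ?Y)" "regular_over {} (ws @ us')"
      using IH(5) by (auto simp: us regular_over_append)
    have "irrelevant (set ts \<union> ?Y)"
      by (rule irrelevant_mono[OF T(3)]) (use ts in \<open>auto intro: ideal.span_base\<close>)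
    then obtain w where w: "w \<in> W" "irrelevant (insert w ?Y)"
      using generic_parameter[OF Y u(1) _ W] IH(6) ts T(2) Yu by metis
    have wf: "w \<in> forms 2" using w W by blast
    have nw: "nzd w (ideal.span ?Y)" by (rule nzd_exchange[OF nu(1) u(1) w(2)])
    have "simple_socle (ideal.span (insert w ?Y)) (Suc k)"
      by (rule socle_transport[OF Y u(2) _ wf _ nu(1) nw]) (use IH(7) Yu in auto)
    moreover have "regular_over {} (ws @ w # us')"
    proof -
      have "regular_over (set ws) (us' @ [w])" using nu(2) nw by (auto simp: regular_over_append)
      then have "regular_over (set ws) (w # us')"
        by (rule regular_over_move_last[rotated 3]) (use Y IH us pf w in auto)
      then show ?thesis using nu(2) by (auto simp: regular_over_append)
    qed
    ultimately show ?case
      using IH us w by (intro exI[of _ "ws @ [w]"] exI[of _ us']) auto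
  qed
  from this[of "CARD('n)"] show ?thesis by auto
qed

text \<open>Replacing a basis element of \<open>W\<close> by another vector with a nonzero coefficient there does not change the
ideal, so the exchange lemma applies along the Steinitz replacement of one basis by another.\<close>

lemma regular_sequence_steinitz:
  fixes W :: "'n::finite rpoly set"
  assumes W: "subspace W" "W \<subseteq> forms 2"
    and ws: "length ws = n" "set ws \<subseteq> W" "W \<subseteq> span (set ws)" "regular_over {} ws" "irrelevant (set ws)"
    and qs: "set qs \<subseteq> W" "independent (set qs)" "distinct qs"
  shows "\<exists>bs. length (qs @ bs) = n \<and> set bs \<subseteq> W \<and> W \<subseteq> span (set (qs @ bs)) \<and> regular_over {} (qs @ bs)"
  using qs
proof (induction qs rule: rev_induct)
  case Nil
  then show ?case using ws by auto
next
  case (snoc q qs)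
  have "independent (set qs)" by (rule real_vector.independent_mono[OF snoc.prems(2)]) auto
  then obtain bs where IH: "length (qs @ bs) = n" "set bs \<subseteq> W" "W \<subseteq> span (set (qs @ bs))" "regular_over {} (qs @ bs)"
    using snoc by auto
  have qn: "q \<notin> span (set qs)"
    using snoc.prems by (auto simp: real_vector.independent_insert)
  \<comment> \<open>the last element of the shortest prefix that spans \<open>q\<close> is the one to be replaced\<close>
  define j where "j = (LEAST j. q \<in> span (set qs \<union> set (take j bs)))"
  have ex: "q \<in> span (set qs \<union> set (take (length bs) bs))" using IH(3) snoc.prems by auto
  have j: "q \<in> span (set qs \<union> set (take j bs))" "j \<le> length bs"
    unfolding j_def using LeastI[of "\<lambda>j. q \<in> span (set qs \<union> set (take j bs))", OF ex]
      Least_le[of "\<lambda>j. q \<in> span (set qs \<union> set (take j bs))", OF ex] by auto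
  have "j \<noteq> 0" using j(1) qn by (metis sup_bot.right_neutral take0 list.set(1))
  then obtain j' where j': "j = Suc j'" by (cases j) auto
  define b bs1 bs2 where "b = bs ! j'" and "bs1 = take j' bs" and "bs2 = drop (Suc j') bs"
  have bs: "bs = bs1 @ b # bs2" unfolding b_def bs1_def bs2_def using j j' by (simp add: id_take_nth_drop)
  have tk: "take j bs = bs1 @ [b]" unfolding b_def bs1_def using j j' by (simp add: take_Suc_conv_app_nth)
  have "q \<notin> span (set qs \<union> set bs1)"
    using not_less_Least[of j' "\<lambda>j. q \<in> span (set qs \<union> set (take j bs))"] j' unfolding j_def bs1_def by auto
  moreover have "q \<in> span (insert b (set qs \<union> set bs1))" using j(1) tk by simp
  ultimately have b: "b \<in> span (insert q (set qs \<union> set bs1))"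
    using real_vector.in_span_insert by blast
  let ?Y = "set qs \<union> set bs1 \<union> set bs2"
  have bY: "b \<in> span (insert q ?Y)" using b real_vector.span_mono[of "insert q (set qs \<union> set bs1)" "insert q ?Y"] by auto
  have "set (qs @ bs) \<subseteq> span (insert q ?Y)"
    using bY real_vector.span_superset[of "insert q ?Y"] bs by auto
  then have "span (set (qs @ bs)) \<subseteq> span (insert q ?Y)"
    by (intro real_vector.span_minimal) auto
  then have Wsp: "W \<subseteq> span (insert q ?Y)" using IH(3) by blast
  have irr: "irrelevant (insert q ?Y)"
    by (rule irrelevant_mono[OF ws(5)]) (use ws(2) Wsp span_subset_ideal in blast)
  have pf: "posform x" if "x \<in> W" for x
    using that W(2) unfolding posform_def by (metis pos2 subsetD)
  have YW: "?Y \<subseteq> W" "b \<in> W" "q \<in> W" using IH(2) bs snoc.prems by auto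
  have hom: "homogeneous x" if "x \<in> W" for x using pf posform_homogeneous that by blast
  have r1: "regular_over {} qs" "regular_over (set qs) bs1" "regular_over (set qs \<union> set bs1) (b # bs2)"
    using IH(4) by (auto simp: bs regular_over_append)
  have r2: "regular_over (set qs \<union> set bs1) (bs2 @ [b])"
    by (rule regular_over_move_first[OF _ _ _ r1(3)]) (use YW pf hom in auto)
  have "nzd q (ideal.span ?Y)"
    by (rule nzd_exchange[of b]) (use r2 irr pf YW in \<open>auto simp: regular_over_append\<close>)
  then have "regular_over (set qs) ((bs1 @ bs2) @ [q])"
    using r1 r2 by (auto simp: regular_over_append Un_assoc)
  then have "regular_over (set qs) (q # bs1 @ bs2)"
    by (rule regular_over_move_last[rotated 3]) (use YW pf hom in auto)
  then have "regular_over {} ((qs @ [q]) @ bs1 @ bs2)" using r1 by (auto simp: regular_over_append)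
  then show ?case using IH bs Wsp by (intro exI[of _ "bs1 @ bs2"]) (auto simp: Un_assoc)
qed

section \<open>Real factorisation\<close>

definition cpoly :: "real poly \<Rightarrow> complex \<Rightarrow> complex" where
  "cpoly P z = poly (map_poly complex_of_real P) z"

lemma cpoly_pCons [simp]: "cpoly (pCons a P) z = of_real a + z * cpoly P z"
  by (simp add: cpoly_def map_poly_pCons)

lemma cpoly_0 [simp]: "cpoly 0 z = 0"
  by (simp add: cpoly_def)

lemma cpoly_add: "cpoly (P + R) z = cpoly P z + cpoly R z"
  by (induction P R rule: poly_induct2) (simp_all add: algebra_simps)

lemma cpoly_smult: "cpoly (smult c P) z = of_real c * cpoly P z"
  by (induction P) (simp_all add: algebra_simps)

lemma cpoly_mult: "cpoly (P * R) z = cpoly P z * cpoly R z"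
  by (induction P) (simp_all add: cpoly_add cpoly_smult algebra_simps)

lemma cpoly_of_real: "cpoly P (of_real x) = of_real (poly P x)"
  by (induction P) simp_all

text \<open>The quadratic factor is \<open>(X - b)\<^sup>2 + c\<^sup>2\<close>, expanded, for a complex root with real part \<open>b\<close> and imaginary part
\<open>c\<close>.\<close>

lemma real_poly_factor:
  fixes P :: "real poly"
  assumes "degree P > 0"
  shows "(\<exists>r R. P = [:- r, 1:] * R) \<or> (\<exists>b c R. c \<noteq> 0 \<and> P = [:b\<^sup>2 + c\<^sup>2, - (b + b), 1:] * R)"
proof -
  have "degree (map_poly complex_of_real P) = degree P"
    by (rule degree_map_poly) auto
  then have "\<not> constant (poly (map_poly complex_of_real P))"
    using assms by (simp add: constant_degree)
  then obtain z where z: "cpoly P z = 0"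
    using fundamental_theorem_of_algebra cpoly_def by metis
  show ?thesis
  proof (cases "Im z = 0")
    case True
    then have "z = of_real (Re z)" by (simp add: complex_eq_iff)
    then have "poly P (Re z) = 0" using z cpoly_of_real by (metis of_real_eq_0_iff)
    then have "[:- Re z, 1:] dvd P" by (simp add: poly_eq_0_iff_dvd)
    then show ?thesis by (elim dvdE) blast
  next
    case False
    let ?m = "[:(Re z)\<^sup>2 + (Im z)\<^sup>2, - (Re z + Re z), 1:]"
    have mz: "cpoly ?m z = 0"
      by (simp add: complex_eq_iff power2_eq_square algebra_simps)
    have "degree (P mod ?m) < 2" using degree_mod_less[of ?m P] by auto
    then have "P mod ?m = [:coeff (P mod ?m) 0, coeff (P mod ?m) 1:]"
      by (intro poly_eqI) (auto simp: coeff_pCons coeff_eq_0 split: nat.split)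
    then obtain r0 r1 where r: "P mod ?m = [:r0, r1:]" by blast
    have "cpoly P z = cpoly (P div ?m * ?m + P mod ?m) z" by (simp only: div_mult_mod_eq)
    also have "\<dots> = cpoly (P mod ?m) z" by (simp only: cpoly_add cpoly_mult mz) simp
    finally have "of_real r0 + z * of_real r1 = 0" using z r by simp
    then have "r0 + Re z * r1 = 0" "Im z * r1 = 0" by (auto simp: complex_eq_iff)
    then have "r0 = 0" "r1 = 0" using False by auto
    then have "P = ?m * (P div ?m)" using r by (metis div_mult_mod_eq add.right_neutral mult.commute pCons_0_0)
    then show ?thesis using False by blast
  qed
qed

section \<open>Functionals with Lorentzian squares\<close>

lemma numeral_mult_eq_scaleR: "numeral k * f = numeral k *\<^sub>R (f :: 'n rpoly)"
  by (simp add: scaleR_conv_of_real)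

text \<open>Fractions \<open>y / q ^ m\<close> with \<open>y\<close> of degree \<open>2 * m\<close> form, modulo \<open>Q\<close>, a finite-dimensional algebra in
which all fractions are represented by quartics over \<open>q\<^sup>2\<close>. Evaluating \<open>l\<close> on the product of two such fractions
gives a symmetric bilinear form for which multiplications are self-adjoint. The assumptions say that
this form is Lorentzian: it is nonnegative on the hyperplane where \<open>l\<close> vanishes, which is the orthogonal complement
of the isotropic unit, and is zero there only on multiples of the unit. The last assumption
says that quadrics modulo \<open>Q\<close> have dimension at least three.\<close>

locale lorentzian =
  fixes l :: "'n::finite rpoly \<Rightarrow> real" and Q :: "'n rpoly set" and q :: "'n rpoly"
  assumes linear_l: "linear l"
    and Q_forms: "Q \<subseteq> forms 2" and q_forms: "q \<in> forms 2"
    and nzd_q: "nzd q (ideal.span Q)"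
    and reach: "d \<ge> 5 \<Longrightarrow> forms d \<subseteq> ideal.span (insert q Q)"
    and kernel_l: "y \<in> forms 4 \<Longrightarrow> l y = 0 \<longleftrightarrow> y \<in> ideal.span (insert q Q)"
    and l_square_nonneg: "u \<in> forms 2 \<Longrightarrow> l (u\<^sup>2) \<ge> 0"
    and l_square_zero: "u \<in> forms 2 \<Longrightarrow> l (u\<^sup>2) = 0 \<Longrightarrow> \<exists>c. u - c *\<^sub>R q \<in> ideal.span Q"
    and codim: "\<not> forms 2 \<subseteq> span (insert e1 (insert e2 (ideal.span Q \<inter> forms 2)))"
begin

abbreviation J :: "'n rpoly set" where "J \<equiv> ideal.span Q"

lemma Q_homogeneous: "x \<in> Q \<Longrightarrow> homogeneous x"
  using Q_forms homogeneousI by blast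

lemma qpow_forms: "q ^ m \<in> forms (2 * m)"
  by (rule forms_power_eq[OF q_forms]) simp

lemma q_cancel: "q * y \<in> J \<Longrightarrow> y \<in> forms d \<Longrightarrow> y \<in> J"
  using nzdD[OF nzd_q] by blast

lemma qpow_cancel: "q ^ m * y \<in> J \<Longrightarrow> y \<in> forms d \<Longrightarrow> y \<in> J"
  using nzd_power[OF nzd_q q_forms] by blast

lemma one_notin_J: "1 \<notin> J"
proof
  assume "1 \<in> J"
  then have "J = UNIV" using ideal.span_scale[of 1 Q] by auto
  then have "forms 2 \<subseteq> span (insert 0 (insert 0 (J \<inter> forms 2)))"
    by (auto intro: real_vector.span_base)
  then show False using codim by blast
qed

lemma scaled_qpow_in_J: "c *\<^sub>R q ^ m \<in> J \<Longrightarrow> c = 0"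
proof (rule ccontr)
  assume "c *\<^sub>R q ^ m \<in> J" "c \<noteq> 0"
  then have "q ^ m * 1 \<in> J" using ideal_scaleR[of "c *\<^sub>R q ^ m" Q "inverse c"] by simp
  then show False using qpow_cancel[OF _ forms_one] one_notin_J by blast
qed

lemma reduce: "z \<in> forms (2 * m + 4) \<Longrightarrow> \<exists>g\<in>forms 4. z - q ^ m * g \<in> J"
proof (induction m arbitrary: z)
  case 0
  then show ?case by (intro bexI[of _ z]) (auto intro: ideal.span_zero)
next
  case (Suc m)
  have "z \<in> ideal.span (insert q Q)" using reach[of "2 * Suc m + 4"] Suc.prems by auto
  then obtain z' where z': "z' \<in> forms (2 * Suc m + 4 - 2)" "z - q * z' \<in> J"
    using ideal_insert_forms[OF Q_homogeneous q_forms Suc.prems] by blast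
  then obtain g where g: "g \<in> forms 4" "z' - q ^ m * g \<in> J"
    using Suc.IH[of z'] by (auto simp: add.commute)
  have "(z - q * z') + q * (z' - q ^ m * g) \<in> J"
    by (intro ideal.span_add ideal.span_scale z' g)
  then show ?case using g(1) by (intro bexI[of _ g]) (simp_all add: algebra_simps)
qed

text \<open>The value of \<open>l\<close> at the fraction \<open>y / q ^ m\<close>, whose representative \<open>g / q\<^sup>2\<close> satisfies
\<open>q\<^sup>2 * y = q ^ m * g\<close> modulo \<open>Q\<close>.\<close>

definition L :: "nat \<Rightarrow> 'n rpoly \<Rightarrow> real" where
  "L m y = l (SOME g. g \<in> forms 4 \<and> q\<^sup>2 * y - q ^ m * g \<in> J)"

lemma l_J: "g \<in> forms 4 \<Longrightarrow> g \<in> J \<Longrightarrow> l g = 0"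
  using kernel_l ideal_mono[of Q "insert q Q"] by blast

lemma L_eq:
  assumes "g \<in> forms 4" "q\<^sup>2 * y - q ^ m * g \<in> J"
  shows "L m y = l g"
proof -
  define h where "h = (SOME g. g \<in> forms 4 \<and> q\<^sup>2 * y - q ^ m * g \<in> J)"
  have h: "h \<in> forms 4" "q\<^sup>2 * y - q ^ m * h \<in> J"
    unfolding h_def using someI[of "\<lambda>g. g \<in> forms 4 \<and> q\<^sup>2 * y - q ^ m * g \<in> J" g] assms by auto
  have "(q\<^sup>2 * y - q ^ m * g) - (q\<^sup>2 * y - q ^ m * h) \<in> J" by (rule ideal.span_diff[OF assms(2) h(2)])
  then have "q ^ m * (h - g) \<in> J" by (simp add: algebra_simps)
  then have "h - g \<in> J" using qpow_cancel forms_diff h(1) assms(1) by blast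
  then have "l (h - g) = 0" using l_J forms_diff h(1) assms(1) by blast
  then show ?thesis unfolding L_def h_def[symmetric] by (simp add: linear_diff[OF linear_l])
qed

lemma L_witness:
  assumes "y \<in> forms (2 * m)"
  shows "\<exists>g\<in>forms 4. q\<^sup>2 * y - q ^ m * g \<in> J \<and> L m y = l g"
proof -
  have "q\<^sup>2 * y \<in> forms (2 * m + 4)"
    by (rule forms_mult_eq[OF forms_power[OF q_forms] assms]) simp
  then show ?thesis using reduce L_eq by blast
qed

lemma L_diff:
  assumes "x \<in> forms (2 * m)" "y \<in> forms (2 * m)"
  shows "L m (x - c *\<^sub>R y) = L m x - c * L m y"
proof -
  obtain g h where g: "g \<in> forms 4" "q\<^sup>2 * x - q ^ m * g \<in> J" "L m x = l g"
    and h: "h \<in> forms 4" "q\<^sup>2 * y - q ^ m * h \<in> J" "L m y = l h"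
    using L_witness assms by blast
  have "(q\<^sup>2 * x - q ^ m * g) - c *\<^sub>R (q\<^sup>2 * y - q ^ m * h) \<in> J"
    by (intro ideal.span_diff ideal_scaleR g h)
  then have "L m (x - c *\<^sub>R y) = l (g - c *\<^sub>R h)"
    by (intro L_eq forms_diff forms_scaleR g h) (simp add: algebra_simps)
  then show ?thesis using g h by (simp add: linear_diff[OF linear_l] linear_cmul[OF linear_l])
qed

lemma L_0: "L m 0 = 0"
  using L_diff[of 0 m 0 1] by simp

lemma L_add:
  assumes "x \<in> forms (2 * m)" "y \<in> forms (2 * m)"
  shows "L m (x + y) = L m x + L m y"
  using L_diff[OF assms, of "- 1"] by simp

lemma L_J: "y \<in> J \<Longrightarrow> L m y = 0"
  using L_eq[of 0 y m] by (simp add: ideal.span_scale linear_0[OF linear_l])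

lemma L_cong: 
  assumes "x \<in> forms (2 * m)" "y \<in> forms (2 * m)" "x - y \<in> J"
  shows "L m x = L m y"
  using L_diff[OF assms(1,2), of 1] L_J[OF assms(3)] by simp

lemma L_q: "y \<in> forms (2 * m) \<Longrightarrow> L (Suc m) (q * y) = L m y"
proof -
  assume "y \<in> forms (2 * m)"
  then obtain g where g: "g \<in> forms 4" "q\<^sup>2 * y - q ^ m * g \<in> J" "L m y = l g" using L_witness by blast
  have "q * (q\<^sup>2 * y - q ^ m * g) \<in> J" by (rule ideal.span_scale[OF g(2)])
  then have "L (Suc m) (q * y) = l g" by (intro L_eq g) (simp add: algebra_simps)
  then show ?thesis using g by simp
qed

lemma L_qpow: "y \<in> forms (2 * m) \<Longrightarrow> L (k + m) (q ^ k * y) = L m y"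
proof (induction k)
  case (Suc k)
  have "q ^ k * y \<in> forms (2 * (k + m))"
    by (rule forms_mult_eq[OF qpow_forms Suc.prems]) simp
  then show ?case using L_q[of "q ^ k * y" "k + m"] Suc by (simp add: mult.assoc)
qed simp

lemma square_forms: "v \<in> forms (2 * m) \<Longrightarrow> v\<^sup>2 \<in> forms (2 * (2 * m))"
  by (rule forms_power_eq) auto

text \<open>Quartics in the kernel of \<open>l\<close> are multiples of \<open>q\<close> modulo \<open>Q\<close>. So the fraction of \<open>v\<close> equals \<open>u / q\<close> for a
quadric \<open>u\<close>, and its square is measured by \<open>l (u\<^sup>2)\<close>.\<close>

lemma lorentz:
  assumes v: "v \<in> forms (2 * m)" "L m v = 0"
  shows "L (2 * m) (v\<^sup>2) \<ge> 0" "L (2 * m) (v\<^sup>2) = 0 \<Longrightarrow> \<exists>c. v - c *\<^sub>R q ^ m \<in> J"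
proof -
  obtain g where g: "g \<in> forms 4" "q\<^sup>2 * v - q ^ m * g \<in> J" "l g = 0" using L_witness v by metis
  then have "g \<in> ideal.span (insert q Q)" using kernel_l by blast
  then obtain u where u: "u \<in> forms 2" "g - q * u \<in> J"
    using ideal_insert_forms[OF Q_homogeneous q_forms g(1)] by auto
  have "(q\<^sup>2 * v - q ^ m * g) + q ^ m * (g - q * u) \<in> J"
    by (intro ideal.span_add ideal.span_scale u g)
  then have "q * (q * v - q ^ m * u) \<in> J" by (simp add: algebra_simps power2_eq_square)
  moreover have "q * v - q ^ m * u \<in> forms (2 * m + 2)"
    by (intro forms_diff forms_mult_eq[OF q_forms v(1)] forms_mult_eq[OF qpow_forms u(1)]) auto
  ultimately have r: "q * v - q ^ m * u \<in> J" using q_cancel by blast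
  then have "(q * v - q ^ m * u) * (q * v + q ^ m * u) \<in> J" by (rule ideal_multR)
  then have "q\<^sup>2 * v\<^sup>2 - q ^ (2 * m) * u\<^sup>2 \<in> J"
    by (simp add: power_even_eq) (simp add: algebra_simps power2_eq_square)
  moreover have "u\<^sup>2 \<in> forms 4" by (rule forms_power_eq[OF u(1)]) simp
  ultimately have L: "L (2 * m) (v\<^sup>2) = l (u\<^sup>2)" by (rule L_eq[rotated])
  then show "L (2 * m) (v\<^sup>2) \<ge> 0" using l_square_nonneg u by simp
  assume "L (2 * m) (v\<^sup>2) = 0"
  then obtain c where c: "u - c *\<^sub>R q \<in> J" using L l_square_zero u by auto
  have "(q * v - q ^ m * u) + q ^ m * (u - c *\<^sub>R q) \<in> J" by (intro ideal.span_add ideal.span_scale r c)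
  then have "q * (v - c *\<^sub>R q ^ m) \<in> J" by (simp add: algebra_simps)
  then show "\<exists>c. v - c *\<^sub>R q ^ m \<in> J" using q_cancel forms_diff[OF v(1) forms_scaleR[OF qpow_forms]] by blast
qed

text \<open>The value of \<open>P\<close> at the fraction \<open>a / q\<close>, with denominators cleared by \<open>q ^ n\<close>.\<close>

definition hom2 :: "'n rpoly \<Rightarrow> nat \<Rightarrow> real poly \<Rightarrow> 'n rpoly" where
  "hom2 a n P = (\<Sum>i\<le>n. coeff P i *\<^sub>R (a ^ i * q ^ (n - i)))"

lemma hom2_pCons: "hom2 a (Suc n) (pCons c P) = c *\<^sub>R q ^ Suc n + a * hom2 a n P"
  unfolding hom2_def by (subst sum.atMost_Suc_shift) (simp add: sum_distrib_left mult.assoc)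

lemma hom2_add: "hom2 a n (P + R) = hom2 a n P + hom2 a n R"
  by (simp add: hom2_def algebra_simps sum.distrib)

lemma hom2_smult: "hom2 a n (smult c P) = c *\<^sub>R hom2 a n P"
  by (simp add: hom2_def scaleR_sum_right)

lemma hom2_Suc: "degree P \<le> n \<Longrightarrow> hom2 a (Suc n) P = q * hom2 a n P"
proof -
  assume "degree P \<le> n"
  then have "hom2 a (Suc n) P = (\<Sum>i\<le>n. coeff P i *\<^sub>R (a ^ i * q ^ (Suc n - i)))"
    by (simp add: hom2_def coeff_eq_0)
  also have "\<dots> = (\<Sum>i\<le>n. q * (coeff P i *\<^sub>R (a ^ i * q ^ (n - i))))"
    by (rule sum.cong) (auto simp: Suc_diff_le mult_ac)
  finally show ?thesis by (simp add: hom2_def sum_distrib_left)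
qed

lemma hom2_linear_factor:
  assumes "degree P \<le> n"
  shows "hom2 a (Suc n) ([:r, s:] * P) = (r *\<^sub>R q + s *\<^sub>R a) * hom2 a n P"
proof -
  have "[:r, s:] * P = smult r P + pCons 0 (smult s P)" by simp
  then show ?thesis
    using assms by (simp only: hom2_add hom2_smult hom2_Suc hom2_pCons) (simp add: algebra_simps)
qed

lemma hom2_quadratic_factor:
  assumes "degree P \<le> n"
  shows "hom2 a (Suc (Suc n)) ([:b\<^sup>2 + c\<^sup>2, - (b + b), 1:] * P) = ((a - b *\<^sub>R q)\<^sup>2 + c\<^sup>2 *\<^sub>R q\<^sup>2) * hom2 a n P"
proof -
  have "[:b\<^sup>2 + c\<^sup>2, - (b + b), 1:] * P = smult (b\<^sup>2 + c\<^sup>2) P + pCons 0 ([:- (b + b), 1:] * P)" by simp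
  moreover have "hom2 a (Suc (Suc n)) P = q\<^sup>2 * hom2 a n P"
    using hom2_Suc[of P n a] hom2_Suc[of P "Suc n" a] assms by (simp add: power2_eq_square mult.assoc)
  ultimately show ?thesis
    by (simp only: hom2_add hom2_smult hom2_pCons hom2_linear_factor[OF assms])
      (simp add: algebra_simps power2_eq_square numeral_mult_eq_scaleR)
qed

lemma hom2_forms: "a \<in> forms 2 \<Longrightarrow> hom2 a n P \<in> forms (2 * n)"
  unfolding hom2_def
  by (intro forms_sum forms_scaleR forms_mult_eq[OF forms_power qpow_forms]) auto

text \<open>Apply the real linear and quadratic factors of \<open>P\<close> to \<open>f\<close> one by one. The factor that first
produces zero gives an eigenvalue or a pair of conjugate complex eigenvalues.\<close>

lemma eigenvalue_or_complex:
  assumes a: "a \<in> forms 2" and f: "f \<in> forms d" "f \<notin> J"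
  shows "P \<noteq> 0 \<Longrightarrow> degree P \<le> n \<Longrightarrow> hom2 a n P * f \<in> J \<Longrightarrow>
    \<exists>h k. h \<in> forms (2 * k) \<and> h * f \<notin> J \<and> ((\<exists>r. (a - r *\<^sub>R q) * (h * f) \<in> J) \<or>
      (\<exists>b c. c \<noteq> 0 \<and> ((a - b *\<^sub>R q)\<^sup>2 + c\<^sup>2 *\<^sub>R q\<^sup>2) * (h * f) \<in> J))"
proof (induction "degree P" arbitrary: P n rule: less_induct)
  case less
  show ?case
  proof (cases "degree P = 0")
    case True
    then obtain c where c: "P = [:c:]" "c \<noteq> 0" using less.prems by (metis degree_eq_zeroE pCons_0_0)
    have "hom2 a n P = c *\<^sub>R q ^ n"
      using c hom2_pCons[of a _ c 0] by (cases n) (auto simp: hom2_def)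
    then have "inverse c *\<^sub>R (c *\<^sub>R q ^ n * f) \<in> J" using less.prems by (intro ideal_scaleR) simp
    then have "q ^ n * f \<in> J" using c by simp
    then show ?thesis using qpow_cancel f by blast
  next
    case False
    then consider (real) r R where "P = [:- r, 1:] * R"
      | (complex) b c R where "c \<noteq> 0" "P = [:b\<^sup>2 + c\<^sup>2, - (b + b), 1:] * R"
      using real_poly_factor[of P] by blast
    then show ?thesis
    proof cases
      case real
      then have R: "R \<noteq> 0" using less.prems(1) by auto
      have deg: "degree P = Suc (degree R)" unfolding real by (subst degree_mult_eq) (use R in auto)
      then obtain n' where n: "n = Suc n'" "degree R \<le> n'" using less.prems(2) deg by (cases n) auto
      have *: "hom2 a n P = (a - r *\<^sub>R q) * hom2 a n' R"
        unfolding n(1) real hom2_linear_factor[OF n(2)] by simp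
      show ?thesis
      proof (cases "hom2 a n' R * f \<in> J")
        case True
        then show ?thesis using less.hyps[of R n'] R deg n by simp
      next
        case False
        then show ?thesis using * less.prems(3) hom2_forms[OF a, of n' R]
          by (intro exI[of _ "hom2 a n' R"] exI[of _ n']) (auto simp: mult.assoc)
      qed
    next
      case complex
      then have R: "R \<noteq> 0" using less.prems(1) by auto
      have deg: "degree P = Suc (Suc (degree R))" unfolding complex(2) by (subst degree_mult_eq) (use R in auto)
      then obtain n' where n: "n = Suc (Suc n')" "degree R \<le> n'" using less.prems(2) deg
        by (metis Suc_le_D Suc_le_mono)
      have *: "hom2 a n P = ((a - b *\<^sub>R q)\<^sup>2 + c\<^sup>2 *\<^sub>R q\<^sup>2) * hom2 a n' R"
        unfolding n(1) complex(2) hom2_quadratic_factor[OF n(2)] by simp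
      show ?thesis
      proof (cases "hom2 a n' R * f \<in> J")
        case True
        then show ?thesis using less.hyps[of R n'] R deg n by simp
      next
        case False
        have "((a - b *\<^sub>R q)\<^sup>2 + c\<^sup>2 *\<^sub>R q\<^sup>2) * (hom2 a n' R * f) \<in> J"
          using * less.prems(3) by (simp add: mult.assoc)
        then show ?thesis using False complex(1) hom2_forms[OF a, of n' R] by blast
      qed
    qed
  qed
qed

text \<open>All fractions are represented by quartics, so the powers of \<open>a / q\<close> are linearly
dependent.\<close>

lemma annihilating_polynomial:
  assumes a: "a \<in> forms 2"
  shows "\<exists>P n. P \<noteq> 0 \<and> degree P \<le> n \<and> hom2 a n P \<in> J"
proof -
  obtain B :: "'n rpoly set" where B: "finite B" "forms 4 \<subseteq> span B" using forms_dim_bound by blast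
  define n where "n = card B + 2"
  have "\<exists>g\<in>forms 4. a ^ i * q ^ (n - i) - q ^ card B * g \<in> J" if "i \<le> n" for i
    by (rule reduce, rule forms_mult_eq[OF forms_power[OF a] qpow_forms]) (use that in \<open>simp add: n_def\<close>)
  then obtain g where g: "\<And>i. i \<le> n \<Longrightarrow> g i \<in> forms 4"
      "\<And>i. i \<le> n \<Longrightarrow> a ^ i * q ^ (n - i) - q ^ card B * g i \<in> J" by metis
  obtain p where p: "\<exists>i\<le>n. p i \<noteq> 0" "(\<Sum>i\<le>n. p i *\<^sub>R g i) = 0"
    using dependent_family[OF B(1), of n g] g(1) B(2) by (auto simp: n_def)
  define P where "P = (\<Sum>i\<le>n. Polynomial.monom (p i) i)"
  have P: "coeff P i = p i" if "i \<le> n" for i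
    using that by (simp add: P_def coeff_sum)
  have "degree P \<le> n" unfolding P_def by (intro degree_sum_le) (auto intro: order_trans[OF degree_monom_le])
  moreover have "P \<noteq> 0" using P p(1) by force
  moreover have "hom2 a n P \<in> J"
  proof -
    have "(\<Sum>i\<le>n. p i *\<^sub>R (a ^ i * q ^ (n - i) - q ^ card B * g i)) \<in> J"
      by (intro ideal.span_sum ideal_scaleR) (use g in auto)
    moreover have "(\<Sum>i\<le>n. p i *\<^sub>R (q ^ card B * g i)) = 0"
      using p(2) by (simp add: sum_distrib_left[symmetric] flip: mult_scaleR_right)
    ultimately show ?thesis by (simp add: hom2_def P algebra_simps sum_subtractf)
  qed
  ultimately show ?thesis by blast
qed

text \<open>An element with maximal annihilator generates a simple submodule, whose endomorphism field is
the real or the complex numbers. Indeed, its nonzero multiples all have the same annihilator, so an eigenvalue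
found on some multiple is already present on the element itself. Annihilators are compared in degree four:
this covers the quadratic expressions directly and the quadrics after multiplication by \<open>q\<close>.\<close>

lemma simple_element:
  assumes I: "\<And>f. f \<in> I \<Longrightarrow> \<exists>k. f \<in> forms (2 * k)" "\<And>f h k. f \<in> I \<Longrightarrow> h \<in> forms (2 * k) \<Longrightarrow> h * f \<in> I"
    and ne: "f0 \<in> I" "f0 \<notin> J"
  shows "\<exists>f\<in>I. f \<notin> J \<and> ((\<forall>a\<in>forms 2. \<exists>r. (a - r *\<^sub>R q) * f \<in> J) \<or> (\<exists>b\<in>forms 2. (b\<^sup>2 + q\<^sup>2) * f \<in> J))"
proof -
  define Ann where "Ann f = {u \<in> forms 4. u * f \<in> J}" for f
  obtain B :: "'n rpoly set" where B: "finite B" "forms 4 \<subseteq> span B" using forms_dim_bound by blast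
  have AB: "Ann f \<subseteq> span B" for f using B(2) by (auto simp: Ann_def)
  have sub: "subspace (Ann f)" for f
    unfolding Ann_def
    by (rule real_vector.subspaceI) (auto simp: distrib_right ideal.span_zero intro: forms_add forms_scaleR ideal.span_add ideal_scaleR)
  have "\<exists>f. (f \<in> I \<and> f \<notin> J) \<and> (\<forall>f'. f' \<in> I \<and> f' \<notin> J \<longrightarrow> dim (Ann f') \<le> dim (Ann f))"
    by (rule ex_has_greatest_nat[of _ f0 _ "Suc (card B)"])
      (use ne real_vector.dim_le_card[OF AB B(1)] in \<open>auto simp: less_Suc_eq_le\<close>)
  then obtain f where f: "f \<in> I" "f \<notin> J" and max: "\<And>f'. f' \<in> I \<Longrightarrow> f' \<notin> J \<Longrightarrow> dim (Ann f') \<le> dim (Ann f)"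
    by blast
  obtain kf where kf: "f \<in> forms (2 * kf)" using I f by blast
  have Ann: "Ann (h * f) = Ann f" if "h \<in> forms (2 * k)" "h * f \<notin> J" for h k
  proof -
    have "Ann f \<subseteq> Ann (h * f)" using ideal.span_scale[of _ Q h] by (auto simp: Ann_def mult.left_commute[of _ h])
    then show ?thesis
      using subspace_eq_of_dim_le[OF sub sub _ _ B(1) AB] max I f that by metis
  qed
  have main: "(\<exists>r. (a - r *\<^sub>R q) * f \<in> J) \<or> (\<exists>b\<in>forms 2. (b\<^sup>2 + q\<^sup>2) * f \<in> J)" if a: "a \<in> forms 2" for a
  proof -
    obtain P n where P: "P \<noteq> 0" "degree P \<le> n" "hom2 a n P \<in> J"
      using annihilating_polynomial[OF a] by blast
    have "hom2 a n P * f \<in> J" by (rule ideal_multR[OF P(3)])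
    then obtain h k where h: "h \<in> forms (2 * k)" "h * f \<notin> J"
      and cases: "(\<exists>r. (a - r *\<^sub>R q) * (h * f) \<in> J) \<or>
      (\<exists>b c. c \<noteq> 0 \<and> ((a - b *\<^sub>R q)\<^sup>2 + c\<^sup>2 *\<^sub>R q\<^sup>2) * (h * f) \<in> J)"
      using eigenvalue_or_complex[OF a kf f(2) P(1,2)] by blast
    from cases show ?thesis
    proof (elim disjE exE conjE)
      fix r assume r: "(a - r *\<^sub>R q) * (h * f) \<in> J"
      have ar: "a - r *\<^sub>R q \<in> forms 2" by (intro forms_diff forms_scaleR a q_forms)
      have "q * (a - r *\<^sub>R q) \<in> Ann (h * f)"
        using ideal.span_scale[OF r, of q] forms_mult[OF q_forms ar] by (simp add: Ann_def mult.assoc)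
      then have "q * (a - r *\<^sub>R q) \<in> Ann f" using Ann[OF h] by simp
      then have "q * ((a - r *\<^sub>R q) * f) \<in> J" by (simp add: Ann_def mult.assoc)
      then show ?thesis using q_cancel[OF _ forms_mult[OF ar kf]] by blast
    next
      fix b c assume c: "c \<noteq> 0" and r: "((a - b *\<^sub>R q)\<^sup>2 + c\<^sup>2 *\<^sub>R q\<^sup>2) * (h * f) \<in> J"
      have ab: "a - b *\<^sub>R q \<in> forms 2" by (intro forms_diff forms_scaleR a q_forms)
      have "(a - b *\<^sub>R q)\<^sup>2 + c\<^sup>2 *\<^sub>R q\<^sup>2 \<in> Ann (h * f)"
        using r by (auto simp: Ann_def intro!: forms_add forms_scaleR forms_power_eq[OF ab] forms_power_eq[OF q_forms])
      then have "(a - b *\<^sub>R q)\<^sup>2 + c\<^sup>2 *\<^sub>R q\<^sup>2 \<in> Ann f" using Ann[OF h] by simp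
      then have "((a - b *\<^sub>R q)\<^sup>2 + c\<^sup>2 *\<^sub>R q\<^sup>2) * f \<in> J" by (simp add: Ann_def)
      then have "inverse (c\<^sup>2) *\<^sub>R (((a - b *\<^sub>R q)\<^sup>2 + c\<^sup>2 *\<^sub>R q\<^sup>2) * f) \<in> J" by (rule ideal_scaleR)
      moreover have "inverse (c\<^sup>2) *\<^sub>R (((a - b *\<^sub>R q)\<^sup>2 + c\<^sup>2 *\<^sub>R q\<^sup>2) * f)
          = ((inverse c *\<^sub>R (a - b *\<^sub>R q))\<^sup>2 + q\<^sup>2) * f"
        using c by (simp only: scaleR_power_rpoly distrib_right scaleR_add_right mult_scaleR_left) (simp add: power_inverse)
      ultimately show ?thesis using forms_scaleR[OF ab] by metis
    qed
  qed
  show ?thesis using main f by blast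
qed

text \<open>Eigenvalues are multiplicative, hence those of the products of two variables form a symmetric matrix of
rank one. Its factor is a point at which every quadric takes its eigenvalue, up to a common scalar, and the elements of \<open>Q\<close>
have eigenvalue zero.\<close>

lemma eigenvector_zero:
  assumes f: "f \<in> forms d" "f \<notin> J" and eig: "\<And>a. a \<in> forms 2 \<Longrightarrow> \<exists>r. (a - r *\<^sub>R q) * f \<in> J"
  shows "\<exists>v. v \<noteq> 0 \<and> (\<forall>g\<in>Q. poly_value g v = 0)"
proof -
  obtain lam where lam: "\<And>a. a \<in> forms 2 \<Longrightarrow> (a - lam a *\<^sub>R q) * f \<in> J" using eig by metis
  have qf: "c = 0" if "c *\<^sub>R (q ^ k * f) \<in> J" for c k
  proof (rule ccontr)
    assume "c \<noteq> 0"
    then have "q ^ k * f \<in> J" using ideal_scaleR[OF that, of "inverse c"] by simp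
    then show False using qpow_cancel f by blast
  qed
  have uniq: "lam a = r" if "a \<in> forms 2" "(a - r *\<^sub>R q) * f \<in> J" for a r
  proof -
    have "(a - r *\<^sub>R q) * f - (a - lam a *\<^sub>R q) * f \<in> J" by (rule ideal.span_diff[OF that(2) lam[OF that(1)]])
    then have "(lam a - r) *\<^sub>R (q ^ 1 * f) \<in> J" by (simp add: algebra_simps)
    then show ?thesis using qf by fastforce
  qed
  have lam_add: "lam (a + b) = lam a + lam b" if "a \<in> forms 2" "b \<in> forms 2" for a b
  proof (rule uniq[OF forms_add[OF that]])
    have "(a - lam a *\<^sub>R q) * f + (b - lam b *\<^sub>R q) * f \<in> J" by (intro ideal.span_add lam that)
    then show "(a + b - (lam a + lam b) *\<^sub>R q) * f \<in> J" by (simp add: algebra_simps)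
  qed
  have lam_scale: "lam (c *\<^sub>R a) = c * lam a" if "a \<in> forms 2" for a c
  proof (rule uniq[OF forms_scaleR[OF that]])
    have "c *\<^sub>R ((a - lam a *\<^sub>R q) * f) \<in> J" by (intro ideal_scaleR lam that)
    then show "(c *\<^sub>R a - (c * lam a) *\<^sub>R q) * f \<in> J" by (simp add: algebra_simps)
  qed
  have lam_q: "lam q = 1" by (rule uniq[OF q_forms]) (simp add: ideal.span_zero)
  have lam_0: "lam 0 = 0" by (rule uniq) (simp_all add: ideal.span_zero)
  have prod: "(a * b - (lam a * lam b) *\<^sub>R q\<^sup>2) * f \<in> J" if "a \<in> forms 2" "b \<in> forms 2" for a b
  proof -
    have "b * ((a - lam a *\<^sub>R q) * f) + lam a *\<^sub>R (q * ((b - lam b *\<^sub>R q) * f)) \<in> J"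
      by (intro ideal.span_add ideal.span_scale ideal_scaleR lam that)
    then show ?thesis by (simp add: algebra_simps power2_eq_square)
  qed
  have lam_mult: "lam a * lam b = lam c * lam e"
    if "a \<in> forms 2" "b \<in> forms 2" "c \<in> forms 2" "e \<in> forms 2" "a * b = c * e" for a b c e
  proof -
    have "(a * b - (lam a * lam b) *\<^sub>R q\<^sup>2) * f - (c * e - (lam c * lam e) *\<^sub>R q\<^sup>2) * f \<in> J"
      by (intro ideal.span_diff prod that)
    then have "(lam c * lam e - lam a * lam b) *\<^sub>R (q ^ 2 * f) \<in> J" using that(5) by (simp add: algebra_simps)
    then show ?thesis using qf by fastforce
  qed
  have xx: "var i * var j \<in> forms 2" for i j :: 'n
    using forms_mult[OF forms_var forms_var, of i j] by (simp add: numeral_2_eq_2)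
  have on_gen: "lam a = poly_value a v / s" if a: "a \<in> forms 2"
    and gen: "\<And>i j. lam (var i * var j) = v $ i * v $ j / s" for a v s
  proof -
    have "subspace {a \<in> forms 2. lam a = poly_value a v / s}"
      by (rule real_vector.subspaceI)
        (auto simp: lam_0 lam_add lam_scale linear_0[OF linear_poly_value] linear_add[OF linear_poly_value]
          linear_cmul[OF linear_poly_value] add_divide_distrib intro: forms_add forms_scaleR)
    moreover have "{var i * var j | i j. True} \<subseteq> {a \<in> forms 2. lam a = poly_value a v / s}"
      using gen xx by (auto simp: poly_value_mult poly_value_var)
    ultimately have "span {var i * var j | i j. True} \<subseteq> {a \<in> forms 2. lam a = poly_value a v / s}"
      by (rule real_vector.span_minimal[rotated])
    then show ?thesis using forms_2_subset_span a by blast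
  qed
  have "\<exists>i. lam (var i * var i) \<noteq> 0"
  proof (rule ccontr)
    assume *: "\<not> ?thesis"
    have "lam (var i * var j) * lam (var i * var j) = lam (var i * var i) * lam (var j * var j)" for i j
      by (rule lam_mult) (auto simp: xx mult_ac)
    then have "lam (var i * var j) = 0" for i j using * by (metis mult_eq_0_iff)
    then have "lam q = poly_value q 0 / 0" by (intro on_gen q_forms) simp
    then show False using lam_q by simp
  qed
  then obtain i where i: "lam (var i * var i) \<noteq> 0" by blast
  define s where "s = lam (var i * var i)"
  define v :: "real ^ 'n" where "v = (\<chi> j. lam (var i * var j))"
  have "lam (var j * var k) = v $ j * v $ k / s" for j k
  proof -
    have "lam (var i * var i) * lam (var j * var k) = lam (var i * var j) * lam (var i * var k)"
      by (rule lam_mult) (auto simp: xx mult_ac)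
    then show ?thesis using i by (simp add: v_def s_def field_simps)
  qed
  then have lv: "lam a = poly_value a v / s" if "a \<in> forms 2" for a using on_gen that by blast
  have "poly_value g v = 0" if g: "g \<in> Q" for g
  proof -
    have "lam g = 0" using g Q_forms by (intro uniq) (auto intro: ideal_multR ideal.span_base)
    then show ?thesis using lv[of g] g Q_forms i by (auto simp: s_def)
  qed
  moreover have "v \<noteq> 0" using i by (metis v_def vec_lambda_beta zero_index)
  ultimately show ?thesis by blast
qed

text \<open>If the simple submodule generated by \<open>f\<close> is complex, with \<open>b / q\<close> acting as an imaginary unit, then
multiplication by \<open>b / q\<close> changes the sign of the form, so the submodule contains a timelike vector \<open>n\<close>. The
annihilator of \<open>f\<close> is orthogonal to \<open>n\<close>, hence spacelike, and for the same reason none of its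
simple submodules is complex. The annihilator is not zero: two linear conditions on a quadric \<open>u\<close> make
\<open>u * f\<close> isotropic, hence zero.\<close>

theorem common_real_zero: "\<exists>v. v \<noteq> 0 \<and> (\<forall>g\<in>Q. poly_value g v = 0)"
proof -
  have "\<exists>f\<in>{f. \<exists>k. f \<in> forms (2 * k)}. f \<notin> J \<and>
     ((\<forall>a\<in>forms 2. \<exists>r. (a - r *\<^sub>R q) * f \<in> J) \<or> (\<exists>b\<in>forms 2. (b\<^sup>2 + q\<^sup>2) * f \<in> J))"
  proof (rule simple_element)
    show "1 \<in> {f. \<exists>k. f \<in> forms (2 * k)}" using forms_one by (auto intro!: exI[of _ 0])
    show "1 \<notin> J" by (rule one_notin_J)
    fix f h :: "'n rpoly" and k assume "f \<in> {f. \<exists>k. f \<in> forms (2 * k)}" "h \<in> forms (2 * k)"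
    then obtain m where "f \<in> forms (2 * m)" by blast
    then have "h * f \<in> forms (2 * (k + m))"
      using \<open>h \<in> forms (2 * k)\<close> by (auto intro: forms_mult_eq)
    then show "h * f \<in> {f. \<exists>k. f \<in> forms (2 * k)}" by blast
  qed simp
  then obtain f k where f: "f \<in> forms (2 * k)" "f \<notin> J" and
    cases: "(\<forall>a\<in>forms 2. \<exists>r. (a - r *\<^sub>R q) * f \<in> J) \<or> (\<exists>b\<in>forms 2. (b\<^sup>2 + q\<^sup>2) * f \<in> J)" by blast
  from cases show ?thesis
  proof
    assume "\<forall>a\<in>forms 2. \<exists>r. (a - r *\<^sub>R q) * f \<in> J"
    then show ?thesis using eigenvector_zero[OF f] by blast
  next
    assume "\<exists>b\<in>forms 2. (b\<^sup>2 + q\<^sup>2) * f \<in> J"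
    then obtain b where b: "b \<in> forms 2" "(b\<^sup>2 + q\<^sup>2) * f \<in> J" by blast
    have b2: "b\<^sup>2 \<in> forms 4" and q2: "q\<^sup>2 \<in> forms 4"
      by (rule forms_power_eq[OF b(1)], simp) (rule forms_power_eq[OF q_forms], simp)
    \<comment> \<open>otherwise \<open>b\<close> would be isotropic in the hyperplane, hence a multiple of \<open>q\<close>\<close>
    have bq: "b\<^sup>2 + q\<^sup>2 \<notin> J"
    proof
      assume *: "b\<^sup>2 + q\<^sup>2 \<in> J"
      have "l (b\<^sup>2 + q\<^sup>2) = 0" using * l_J forms_add b2 q2 by blast
      moreover have "q\<^sup>2 \<in> ideal.span (insert q Q)"
        unfolding power2_eq_square by (intro ideal_multR ideal.span_base) simp
      then have "l (q\<^sup>2) = 0" using kernel_l q2 by blast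
      ultimately have "l (b\<^sup>2) = 0" by (simp add: linear_add[OF linear_l])
      then obtain c where c: "b - c *\<^sub>R q \<in> J" using l_square_zero b by blast
      have "(b\<^sup>2 + q\<^sup>2) - (b - c *\<^sub>R q) * (b + c *\<^sub>R q) \<in> J"
        by (intro ideal.span_diff * ideal_multR c)
      then have "(c\<^sup>2 + 1) *\<^sub>R q ^ 2 \<in> J" by (simp add: algebra_simps power2_eq_square)
      then have "c\<^sup>2 + 1 = 0" by (rule scaled_qpow_in_J)
      then show False by (metis add_nonneg_eq_0_iff zero_le_one zero_le_power2 zero_neq_one)
    qed
    \<comment> \<open>\<open>b\<^sup>2 + q\<^sup>2\<close> annihilates the multiples of \<open>f\<close>, but not the unit\<close>
    have no_q: "c = 0" if "s * f - c *\<^sub>R q ^ m \<in> J" for s c m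
    proof (rule ccontr)
      assume "c \<noteq> 0"
      have "s * ((b\<^sup>2 + q\<^sup>2) * f) - (b\<^sup>2 + q\<^sup>2) * (s * f - c *\<^sub>R q ^ m) \<in> J"
        by (intro ideal.span_diff ideal.span_scale b that)
      then have "c *\<^sub>R (q ^ m * (b\<^sup>2 + q\<^sup>2)) \<in> J" by (simp add: algebra_simps)
      then have "inverse c *\<^sub>R c *\<^sub>R (q ^ m * (b\<^sup>2 + q\<^sup>2)) \<in> J" by (rule ideal_scaleR)
      then have "q ^ m * (b\<^sup>2 + q\<^sup>2) \<in> J" using \<open>c \<noteq> 0\<close> by simp
      then show False using bq qpow_cancel[OF _ forms_add[OF b2 q2]] by blast
    qed
    have isotropic: "s * f \<in> J" if "s * f \<in> forms (2 * m)" "L m (s * f) = 0" "L (2 * m) ((s * f)\<^sup>2) = 0" for s m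
      using lorentz(2)[OF that] no_q by (metis diff_zero scaleR_zero_left)
    have balance: "L (2 * Suc (Suc k)) ((b * (s * f))\<^sup>2) = - L (2 * Suc k) ((s * f)\<^sup>2)" if s: "s \<in> forms 2" for s
    proof -
      have sf: "s * f \<in> forms (2 * Suc k)" by (rule forms_mult_eq[OF s f(1)]) simp
      have sf2: "(s * f)\<^sup>2 \<in> forms (2 * (2 * Suc k))" by (rule square_forms[OF sf])
      have "(s\<^sup>2 * f) * ((b\<^sup>2 + q\<^sup>2) * f) \<in> J" by (rule ideal.span_scale[OF b(2)])
      then have "L (2 * Suc (Suc k)) ((s\<^sup>2 * f) * ((b\<^sup>2 + q\<^sup>2) * f)) = 0" by (rule L_J)
      moreover have "(s\<^sup>2 * f) * ((b\<^sup>2 + q\<^sup>2) * f) = (b * (s * f))\<^sup>2 + q\<^sup>2 * (s * f)\<^sup>2"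
        by (simp add: algebra_simps power2_eq_square)
      moreover have "L (2 * Suc (Suc k)) ((b * (s * f))\<^sup>2 + q\<^sup>2 * (s * f)\<^sup>2) =
          L (2 * Suc (Suc k)) ((b * (s * f))\<^sup>2) + L (2 * Suc (Suc k)) (q\<^sup>2 * (s * f)\<^sup>2)"
        by (intro L_add square_forms forms_mult_eq[OF b(1) sf] forms_mult_eq[OF q2 sf2]) simp_all
      moreover have "L (2 + 2 * Suc k) (q\<^sup>2 * (s * f)\<^sup>2) = L (2 * Suc k) ((s * f)\<^sup>2)"
        by (rule L_qpow[OF sf2])
      ultimately show ?thesis by simp
    qed
    \<comment> \<open>the combination of \<open>b\<close> and \<open>q\<close> that maps \<open>f\<close> into the hyperplane yields a spacelike vector; its product with \<open>b\<close> is timelike\<close>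
    have sf: "s * f \<in> forms (2 * Suc k)" and bsf: "b * (s * f) \<in> forms (2 * Suc (Suc k))" if "s \<in> forms 2" for s
    proof -
      show 1: "s * f \<in> forms (2 * Suc k)" by (rule forms_mult_eq[OF that f(1)]) simp
      show "b * (s * f) \<in> forms (2 * Suc (Suc k))" by (rule forms_mult_eq[OF b(1) 1]) simp
    qed
    have L_lin: "L (Suc k) ((x - c *\<^sub>R y) * f) = L (Suc k) (x * f) - c * L (Suc k) (y * f)"
      if "x \<in> forms 2" "y \<in> forms 2" for x y c
      using L_diff[OF sf[OF that(1)] sf[OF that(2)], of c] by (simp add: left_diff_distrib)
    have L_lin2: "L (Suc (Suc k)) (b * ((x - c *\<^sub>R y) * f)) = L (Suc (Suc k)) (b * (x * f)) - c * L (Suc (Suc k)) (b * (y * f))"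
      if "x \<in> forms 2" "y \<in> forms 2" for x y c
      using L_diff[OF bsf[OF that(1)] bsf[OF that(2)], of c] by (simp add: left_diff_distrib right_diff_distrib)
    obtain c1 c2 where c: "c1 \<noteq> 0 \<or> c2 \<noteq> 0" "c1 * L (Suc k) (b * f) - c2 * L (Suc k) (q * f) = 0"
    proof (cases "L (Suc k) (q * f) = 0 \<and> L (Suc k) (b * f) = 0")
      case True
      then show thesis using that[of 1 0] by simp
    next
      case False
      then show thesis using that[of "L (Suc k) (q * f)" "L (Suc k) (b * f)"] by simp
    qed
    define s where "s = c1 *\<^sub>R b - c2 *\<^sub>R q"
    have s: "s \<in> forms 2" unfolding s_def by (intro forms_diff forms_scaleR b q_forms)
    have Ls: "L (Suc k) (s * f) = 0"
    proof -
      have "L (Suc k) (c1 *\<^sub>R b * f) = c1 * L (Suc k) (b * f)"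
        using L_lin[OF forms_0 b(1), of "- c1"] by (simp add: L_0)
      then show ?thesis using L_lin[OF forms_scaleR[OF b(1), of c1] q_forms, of c2] c(2) by (simp add: s_def)
    qed
    have "s * f \<notin> J"
    proof
      assume sfJ: "s * f \<in> J"
      have "(c1\<^sup>2) *\<^sub>R ((b\<^sup>2 + q\<^sup>2) * f) - (c1 *\<^sub>R b + c2 *\<^sub>R q) * (s * f) \<in> J"
        by (rule ideal.span_diff[OF ideal_scaleR[OF b(2)] ideal.span_scale[OF sfJ]])
      then have *: "(c1\<^sup>2 + c2\<^sup>2) *\<^sub>R (q\<^sup>2 * f) \<in> J"
        by (simp add: s_def algebra_simps power2_eq_square)
      have "c1\<^sup>2 + c2\<^sup>2 \<noteq> 0" using c(1) by (simp add: sum_power2_eq_zero_iff)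
      then have "q\<^sup>2 * f \<in> J" using ideal_scaleR[OF *, of "inverse (c1\<^sup>2 + c2\<^sup>2)"] by simp
      then show False using qpow_cancel f by blast
    qed
    then have "L (2 * Suc k) ((s * f)\<^sup>2) \<noteq> 0" using isotropic[OF sf[OF s] Ls] by blast
    then have "L (2 * Suc k) ((s * f)\<^sup>2) > 0" using lorentz(1)[OF sf[OF s] Ls] by simp
    define n where "n = b * (s * f)"
    have n: "n \<in> forms (2 * Suc (Suc k))" unfolding n_def by (rule bsf[OF s])
    have nneg: "L (2 * Suc (Suc k)) (n\<^sup>2) < 0"
      using balance[OF s] \<open>L (2 * Suc k) ((s * f)\<^sup>2) > 0\<close> by (simp add: n_def)
    have Ln: "L (Suc (Suc k)) n \<noteq> 0" using lorentz(1)[OF n] nneg by fastforce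
    \<comment> \<open>subtracting a multiple of \<open>n\<close> moves \<open>g\<close> into the hyperplane without mixed terms\<close>
    have spacelike: "L (2 * m) (g\<^sup>2) > 0" if g: "g \<in> forms (2 * m)" "g * f \<in> J" "g \<notin> J" for g m
    proof (rule ccontr)
      assume neg: "\<not> ?thesis"
      let ?k = "Suc (Suc k)"
      define t where "t = L m g / L ?k n"
      define w where "w = q ^ ?k * g - t *\<^sub>R (q ^ m * n)"
      have g': "q ^ ?k * g \<in> forms (2 * (?k + m))" by (rule forms_mult_eq[OF qpow_forms g(1)]) simp
      have n': "q ^ m * n \<in> forms (2 * (?k + m))" by (rule forms_mult_eq[OF qpow_forms n]) simp
      have w: "w \<in> forms (2 * (?k + m))" unfolding w_def by (intro forms_diff forms_scaleR g' n')
      have "L (?k + m) w = L m g - t * L ?k n"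
        unfolding w_def L_diff[OF g' n'] using L_qpow[OF g(1), of ?k] L_qpow[OF n, of m] by (simp add: add.commute)
      then have Lw: "L (?k + m) w = 0" using Ln by (simp add: t_def)
      have gn: "g * n \<in> J" using ideal.span_scale[OF g(2), of "b * s"] by (simp add: n_def mult_ac)
      have "L (2 * (?k + m)) (w\<^sup>2) = L (2 * (?k + m)) (q ^ (2 * ?k) * g\<^sup>2 - (- (t\<^sup>2)) *\<^sub>R (q ^ (2 * m) * n\<^sup>2))"
      proof (rule L_cong)
        have 1: "q ^ (2 * ?k) * g\<^sup>2 = (q ^ ?k * g)\<^sup>2" "q ^ (2 * m) * n\<^sup>2 = (q ^ m * n)\<^sup>2"
          by (simp_all only: power_mult_distrib power_mult[symmetric] mult.commute)
        show "w\<^sup>2 \<in> forms (2 * (2 * (?k + m)))" by (rule square_forms[OF w])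
        show "q ^ (2 * ?k) * g\<^sup>2 - (- (t\<^sup>2)) *\<^sub>R (q ^ (2 * m) * n\<^sup>2) \<in> forms (2 * (2 * (?k + m)))"
          unfolding 1 by (intro forms_diff forms_scaleR square_forms g' n')
        have "(- (2 * t)) *\<^sub>R (q ^ ?k * q ^ m * (g * n)) \<in> J" by (intro ideal_scaleR ideal.span_scale gn)
        moreover have "w\<^sup>2 - (q ^ (2 * ?k) * g\<^sup>2 - (- (t\<^sup>2)) *\<^sub>R (q ^ (2 * m) * n\<^sup>2)) = (- (2 * t)) *\<^sub>R (q ^ ?k * q ^ m * (g * n))"
          unfolding 1 w_def by (simp add: power2_diff scaleR_power_rpoly numeral_mult_eq_scaleR mult_ac)
        ultimately show "w\<^sup>2 - (q ^ (2 * ?k) * g\<^sup>2 - (- (t\<^sup>2)) *\<^sub>R (q ^ (2 * m) * n\<^sup>2)) \<in> J" by simp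
      qed
      also have "\<dots> = L (2 * (?k + m)) (q ^ (2 * ?k) * g\<^sup>2) - (- (t\<^sup>2)) * L (2 * (?k + m)) (q ^ (2 * m) * n\<^sup>2)"
        by (rule L_diff; rule forms_mult_eq[OF qpow_forms square_forms[OF g(1)]] forms_mult_eq[OF qpow_forms square_forms[OF n]]) simp_all
      also have "L (2 * (?k + m)) (q ^ (2 * ?k) * g\<^sup>2) = L (2 * m) (g\<^sup>2)"
        using L_qpow[OF square_forms[OF g(1)], of "2 * ?k"] by (simp only: distrib_left)
      also have "L (2 * (?k + m)) (q ^ (2 * m) * n\<^sup>2) = L (2 * ?k) (n\<^sup>2)"
        using L_qpow[OF square_forms[OF n], of "2 * m"] by (simp only: distrib_left add.commute)
      finally have "L (2 * m) (g\<^sup>2) + t\<^sup>2 * L (2 * ?k) (n\<^sup>2) \<ge> 0" using lorentz(1)[OF w Lw] by simp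
      moreover have "t\<^sup>2 * L (2 * ?k) (n\<^sup>2) \<le> 0" using nneg by (simp add: mult_nonneg_nonpos)
      ultimately have "L (2 * m) (g\<^sup>2) = 0" "t\<^sup>2 * L (2 * ?k) (n\<^sup>2) = 0" using neg by linarith+
      then have "t = 0" using nneg by auto
      then have "L m g = 0" using Ln by (simp add: t_def)
      then obtain c where c: "g - c *\<^sub>R q ^ m \<in> J" using lorentz(2) g \<open>L (2 * m) (g\<^sup>2) = 0\<close> by blast
      have "g * f - (g - c *\<^sub>R q ^ m) * f \<in> J" by (intro ideal.span_diff ideal_multR c g)
      then have *: "c *\<^sub>R (q ^ m * f) \<in> J" by (simp add: algebra_simps)
      have "c = 0"
      proof (rule ccontr)
        assume "c \<noteq> 0"
        then have "q ^ m * f \<in> J" using ideal_scaleR[OF *, of "inverse c"] by simp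
        then show False using qpow_cancel f by blast
      qed
      then show False using c g by simp
    qed
    \<comment> \<open>if both \<open>u * f\<close> and \<open>b * u * f\<close> are in the hyperplane, then \<open>u * f\<close> is isotropic, hence zero; these are two linear conditions on \<open>u\<close>\<close>
    have "\<exists>g\<in>forms 2. g * f \<in> J \<and> g \<notin> J"
    proof (rule ccontr)
      assume neg: "\<not> ?thesis"
      define U1 where "U1 = {u \<in> forms 2. L (Suc k) (u * f) = 0}"
      define U2 where "U2 = {u \<in> U1. L (Suc (Suc k)) (b * (u * f)) = 0}"
      obtain e1 where e1: "forms 2 \<subseteq> span (insert e1 U1)"
        using subset_span_insert_kernel[OF subspace_forms[of 2], of "\<lambda>u. L (Suc k) (u * f)"] L_lin
        unfolding U1_def by blast
      have "subspace U1"
        unfolding U1_def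
        by (rule real_vector.subspaceI)
          (use L_lin[of _ _ "- 1"] L_lin[OF forms_0, of _ "- c" for c] in
            \<open>auto simp: L_0 intro: forms_add forms_scaleR\<close>)
      then obtain e2 where e2: "U1 \<subseteq> span (insert e2 U2)"
        using subset_span_insert_kernel[of U1 "\<lambda>u. L (Suc (Suc k)) (b * (u * f))"] L_lin2
        unfolding U1_def U2_def by blast
      have "U2 \<subseteq> J"
      proof
        fix u assume "u \<in> U2"
        then have u: "u \<in> forms 2" "L (Suc k) (u * f) = 0" "L (Suc (Suc k)) (b * (u * f)) = 0"
          by (auto simp: U1_def U2_def)
        have "L (2 * Suc k) ((u * f)\<^sup>2) = 0"
          using lorentz(1)[OF sf u(2)] lorentz(1)[OF bsf u(3)] balance[OF u(1)] u(1) by simp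
        then have "u * f \<in> J" using isotropic[OF sf u(2)] u(1) by blast
        then show "u \<in> J" using neg u(1) by blast
      qed
      then have "U2 \<subseteq> J \<inter> forms 2" by (auto simp: U1_def U2_def)
      then have "span (insert e2 U2) \<subseteq> span (insert e1 (insert e2 (J \<inter> forms 2)))"
        by (intro real_vector.span_mono) auto
      then have "insert e1 U1 \<subseteq> span (insert e1 (insert e2 (J \<inter> forms 2)))"
        using e2 by (auto intro: real_vector.span_base)
      then have "span (insert e1 U1) \<subseteq> span (insert e1 (insert e2 (J \<inter> forms 2)))"
        by (rule real_vector.span_minimal) auto
      then show False using e1 codim by blast
    qed
    then obtain g0 where g0: "g0 \<in> forms 2" "g0 * f \<in> J" "g0 \<notin> J" by blast
    have "\<exists>f'\<in>{g. (\<exists>m. g \<in> forms (2 * m)) \<and> g * f \<in> J}. f' \<notin> J \<and>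
     ((\<forall>a\<in>forms 2. \<exists>r. (a - r *\<^sub>R q) * f' \<in> J) \<or> (\<exists>b\<in>forms 2. (b\<^sup>2 + q\<^sup>2) * f' \<in> J))"
    proof (rule simple_element)
      show "g0 \<in> {g. (\<exists>m. g \<in> forms (2 * m)) \<and> g * f \<in> J}" using g0 by (auto intro!: exI[of _ 1])
      show "g0 \<notin> J" by (rule g0)
      fix g h :: "'n rpoly" and k
      assume "g \<in> {g. (\<exists>m. g \<in> forms (2 * m)) \<and> g * f \<in> J}" "h \<in> forms (2 * k)"
      then obtain m where "g \<in> forms (2 * m)" "g * f \<in> J" "h * g \<in> forms (2 * k + 2 * m)"
        using forms_mult by blast
      then show "h * g \<in> {g. (\<exists>m. g \<in> forms (2 * m)) \<and> g * f \<in> J}"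
        using ideal.span_scale[of "g * f" Q h] by (auto simp: mult.assoc intro!: exI[of _ "k + m"])
    qed simp
    then obtain f2 k2 where f2: "f2 \<in> forms (2 * k2)" "f2 \<notin> J" "f2 * f \<in> J" and
      cases: "(\<forall>a\<in>forms 2. \<exists>r. (a - r *\<^sub>R q) * f2 \<in> J) \<or> (\<exists>b\<in>forms 2. (b\<^sup>2 + q\<^sup>2) * f2 \<in> J)" by blast
    from cases show ?thesis
    proof
      assume "\<forall>a\<in>forms 2. \<exists>r. (a - r *\<^sub>R q) * f2 \<in> J"
      then show ?thesis using eigenvector_zero[OF f2(1,2)] by blast
    next
      assume "\<exists>b\<in>forms 2. (b\<^sup>2 + q\<^sup>2) * f2 \<in> J"
      then obtain b where b: "b \<in> forms 2" "(b\<^sup>2 + q\<^sup>2) * f2 \<in> J" by blast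
      have qf: "q * f2 \<in> forms (2 * Suc k2)" by (rule forms_mult_eq[OF q_forms f2(1)]) simp
      have bf: "b * f2 \<in> forms (2 * Suc k2)" by (rule forms_mult_eq[OF b(1) f2(1)]) simp
      have "q * f2 \<notin> J" using q_cancel f2 by blast
      moreover have "q * f2 * f \<in> J" "b * f2 * f \<in> J"
        using ideal.span_scale[OF f2(3)] by (simp_all add: mult.assoc)
      ultimately have pos: "L (2 * Suc k2) ((q * f2)\<^sup>2) > 0" using spacelike qf by blast
      have "L (2 * Suc k2) ((b * f2)\<^sup>2) \<ge> 0"
      proof (cases "b * f2 \<in> J")
        case True
        then have "(b * f2)\<^sup>2 \<in> J" by (simp add: power2_eq_square ideal.span_scale)
        then show ?thesis using L_J by simp
      next
        case False
        then show ?thesis using spacelike[OF bf \<open>b * f2 * f \<in> J\<close>] by simp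
      qed
      moreover have "f2 * ((b\<^sup>2 + q\<^sup>2) * f2) \<in> J" by (rule ideal.span_scale[OF b(2)])
      then have "L (2 * Suc k2) ((b * f2)\<^sup>2 + (q * f2)\<^sup>2) = 0"
        by (intro L_J) (simp add: algebra_simps power2_eq_square)
      then have "L (2 * Suc k2) ((b * f2)\<^sup>2) + L (2 * Suc k2) ((q * f2)\<^sup>2) = 0"
        using L_add[OF square_forms[OF bf] square_forms[OF qf]] by simp
      ultimately show ?thesis using pos by simp
    qed
  qed
qed

end

section \<open>Supporting functionals of a cone of forms\<close>

text \<open>The supporting hyperplane theorem for Euclidean space, transported to forms. Coordinates are indexed by a finite
type that may name a monomial more than once; the section \<open>s\<close> distributes a coefficient evenly over the
indices of its monomial. It is continuous for the topology of coefficients, so an interior point of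
the preimage of the cone would come from an interior point of the cone.\<close>

lemma supporting_functional:
  fixes mon :: "'k::finite \<Rightarrow> ('n::finite \<Rightarrow>\<^sub>0 nat)" and C :: "'n rpoly set"
  assumes mon: "range mon = {m. mdeg m = D}"
    and C: "C \<subseteq> forms D" "0 \<in> C" "\<And>x y. x \<in> C \<Longrightarrow> y \<in> C \<Longrightarrow> x + y \<in> C"
      "\<And>c x. c \<ge> 0 \<Longrightarrow> x \<in> C \<Longrightarrow> c *\<^sub>R x \<in> C" "forms D \<subseteq> span C"
    and p: "p \<in> C" "p \<notin> (forms_topology D) interior_of C"
  shows "\<exists>l. linear l \<and> (\<forall>y\<in>C. l y \<ge> 0) \<and> l p = (0::real) \<and> (\<exists>y\<in>forms D. l y \<noteq> 0)"
proof -
  define N where "N k = real (card {k'. mon k' = mon k})" for k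
  define \<Theta> where "\<Theta> c = (\<Sum>k\<in>UNIV. c $ k *\<^sub>R monomial (mon k))" for c :: "real ^ 'k"
  define g where "g h = (\<chi> k. h (mon k) / N k)" for h :: "('n \<Rightarrow>\<^sub>0 nat) \<Rightarrow> real"
  define s where "s f = g (Poly_Mapping.lookup f)" for f :: "'n rpoly"
  have N: "N k > 0" for k by (auto simp: N_def card_gt_0_iff)
  have lin\<Theta>: "linear \<Theta>"
    by (rule linearI) (simp_all add: \<Theta>_def scaleR_left_distrib sum.distrib scaleR_sum_right)
  have lins: "linear s"
    by (rule linearI) (simp_all add: s_def g_def vec_eq_iff lookup_add add_divide_distrib)
  have \<Theta>s: "\<Theta> (s f) = f" if f: "f \<in> forms D" for f
  proof (rule poly_mapping_eqI)
    fix m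
    have "Poly_Mapping.lookup (\<Theta> (s f)) m = (\<Sum>k\<in>UNIV. if mon k = m then Poly_Mapping.lookup f (mon k) / N k else 0)"
      unfolding \<Theta>_def lookup_sum by (rule sum.cong) (auto simp: s_def g_def lookup_single when_def)
    also have "\<dots> = (\<Sum>k\<in>{k. mon k = m}. Poly_Mapping.lookup f (mon k) / N k)"
      by (simp add: sum.If_cases)
    also have "\<dots> = (\<Sum>k\<in>{k. mon k = m}. Poly_Mapping.lookup f m / real (card {k. mon k = m}))"
      by (rule sum.cong) (auto simp: N_def)
    also have "\<dots> = Poly_Mapping.lookup f m"
    proof (cases "mdeg m = D")
      case True
      then obtain k where "mon k = m" using mon by (metis (mono_tags, lifting) imageE mem_Collect_eq)
      then have "{k. mon k = m} \<noteq> {}" by auto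
      then show ?thesis by simp
    next
      case False
      then show ?thesis using f by (auto simp: forms_iff)
    qed
    finally show "Poly_Mapping.lookup (\<Theta> (s f)) m = Poly_Mapping.lookup f m" .
  qed
  have \<Theta>f: "\<Theta> c \<in> forms D" for c
    unfolding \<Theta>_def
  proof (intro forms_sum forms_scaleR)
    fix k show "monomial (mon k) \<in> forms D" using mon forms_monom[of "mon k"] by auto
  qed
  define S where "S = {c. \<Theta> c \<in> C}"
  have ker: "z \<in> S" if "\<Theta> z = 0" for z using that C by (simp add: S_def)
  have sS: "s y \<in> S" if "y \<in> C" for y using that \<Theta>s C by (auto simp: S_def)
  have "convex S"
    by (rule convexI) (auto simp: S_def linear_add[OF lin\<Theta>] linear_cmul[OF lin\<Theta>] intro!: C)
  moreover have "s p \<in> S" using sS p by blast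
  moreover have "s p \<notin> rel_interior S"
  proof -
    have "span S = UNIV"
    proof -
      have "c \<in> span S" for c
      proof -
        have "s (\<Theta> c) \<in> s ` span C" using C(5) \<Theta>f by blast
        also have "\<dots> = span (s ` C)" by (rule linear_span_image[OF lins, symmetric])
        also have "\<dots> \<subseteq> span S" using sS by (intro real_vector.span_mono) auto
        finally have 1: "s (\<Theta> c) \<in> span S" .
        have "\<Theta> (c - s (\<Theta> c)) = 0" using \<Theta>s[OF \<Theta>f] by (simp add: linear_diff[OF lin\<Theta>])
        then have "c - s (\<Theta> c) \<in> span S" using ker real_vector.span_base by blast
        then show ?thesis using real_vector.span_add[OF _ 1] by fastforce
      qed
      then show ?thesis by blast
    qed
    moreover have "0 \<in> S" by (rule ker) (rule linear_0[OF lin\<Theta>])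
    ultimately have "affine hull S = UNIV" using affine_hull_span_0[of S] hull_inc[of 0 S affine] by simp
    then have ri: "rel_interior S = interior S" by (rule rel_interior_interior)
    have "s p \<notin> interior S"
    proof
      assume sp: "s p \<in> interior S"
      have "continuous_on UNIV g"
        unfolding g_def using N by (auto intro!: continuous_intros simp: less_imp_neq[symmetric])
      then have "open (g -` interior S)" by (intro open_vimage) auto
      then have "openin euclidean (g -` interior S)" by simp
      then have "openin (forms_topology D) (Poly_Mapping.lookup -` (g -` interior S) \<inter> forms D)"
        unfolding forms_topology_def openin_pullback_topology by blast
      moreover have "Poly_Mapping.lookup -` (g -` interior S) \<inter> forms D \<subseteq> C"
      proof
        fix f assume f: "f \<in> Poly_Mapping.lookup -` (g -` interior S) \<inter> forms D"
        then have "s f \<in> S" using interior_subset by (auto simp: s_def)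
        then show "f \<in> C" using \<Theta>s f by (auto simp: S_def)
      qed
      moreover have "p \<in> Poly_Mapping.lookup -` (g -` interior S) \<inter> forms D"
        using sp p C by (auto simp: s_def)
      ultimately show False using p(2) unfolding interior_of_def by blast
    qed
    then show ?thesis using ri by simp
  qed
  ultimately obtain a where a: "a \<noteq> 0" "\<And>y. y \<in> S \<Longrightarrow> a \<bullet> s p \<le> a \<bullet> y"
    using supporting_hyperplane_rel_boundary by metis
  have "a \<bullet> s p \<le> a \<bullet> (c *\<^sub>R s p)" if "c \<ge> 0" for c
    using a(2)[OF sS[OF C(4)[OF that p(1)]]] by (simp add: linear_cmul[OF lins])
  from this[of 0] this[of 2] have sp0: "a \<bullet> s p = 0" by simp
  have ker0: "a \<bullet> z = 0" if "\<Theta> z = 0" for z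
  proof -
    have "\<Theta> (- z) = 0" using that by (simp add: linear_neg[OF lin\<Theta>])
    then have "- z \<in> S" "z \<in> S" using ker that by auto
    then show ?thesis using a(2)[of z] a(2)[of "- z"] sp0 by simp
  qed
  define l where "l f = a \<bullet> s f" for f
  have "linear l"
    by (rule linearI) (simp_all add: l_def linear_add[OF lins] linear_cmul[OF lins] inner_right_distrib)
  moreover have "l y \<ge> 0" if "y \<in> C" for y using a(2)[OF sS[OF that]] sp0 by (simp add: l_def)
  moreover have "l p = 0" using sp0 by (simp add: l_def)
  moreover have "\<exists>y\<in>forms D. l y \<noteq> 0"
  proof (rule ccontr)
    assume "\<not> ?thesis"
    then have 0: "a \<bullet> s (\<Theta> a) = 0" using \<Theta>f by (auto simp: l_def)
    have "\<Theta> (a - s (\<Theta> a)) = 0" using \<Theta>s[OF \<Theta>f] by (simp add: linear_diff[OF lin\<Theta>])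
    then have "a \<bullet> (a - s (\<Theta> a)) = 0" by (rule ker0)
    then show False using 0 a(1) by (simp add: inner_diff_right)
  qed
  ultimately show ?thesis by blast
qed

lemma sum_of_form_squares_add:
  assumes "sum_of_form_squares k d f" "sum_of_form_squares n d g"
  shows "sum_of_form_squares (k + n) d (f + g)"
proof -
  obtain q r where q: "\<And>i. i < k \<Longrightarrow> q i \<in> forms d" "f = (\<Sum>i<k. (q i)\<^sup>2)"
    and r: "\<And>i. i < n \<Longrightarrow> r i \<in> forms d" "g = (\<Sum>i<n. (r i)\<^sup>2)"
    using assms by (auto simp: sum_of_form_squares_def)
  have "(\<Sum>i<k+n. (if i < k then q i else r (i - k))\<^sup>2) = f + g"
    unfolding q(2) r(2) lessThan_atLeast0
    by (subst sum.atLeastLessThan_concat[symmetric, of 0 k "k + n"])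
      (auto simp: sum.shift_bounds_nat_ivl[of _ 0 k n, simplified add.commute, simplified])
  then show ?thesis unfolding sum_of_form_squares_def
    by (intro exI[of _ "\<lambda>i. if i < k then q i else r (i - k)"]) (auto simp: q r)
qed

lemma square_in_sos_cone: "f \<in> forms d \<Longrightarrow> f\<^sup>2 \<in> sos_cone d"
  unfolding sos_cone_def sum_of_form_squares_def
  by (auto intro!: forms_power_eq exI[of _ "1::nat"] exI[of _ "\<lambda>_. f"])

lemma sos_cone_forms: "sos_cone d \<subseteq> forms (2 * d)"
  by (auto simp: sos_cone_def)

lemma sos_cone_0: "0 \<in> sos_cone d"
  by (auto simp: sos_cone_def sum_of_form_squares_def intro!: exI[of _ "0::nat"])

lemma sos_cone_add: "f \<in> sos_cone d \<Longrightarrow> g \<in> sos_cone d \<Longrightarrow> f + g \<in> sos_cone d"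
  unfolding sos_cone_def using sum_of_form_squares_add forms_add by blast

lemma sos_cone_scaleR:
  assumes "c \<ge> 0" "f \<in> sos_cone d" shows "c *\<^sub>R f \<in> sos_cone d"
proof -
  obtain k :: nat and q where q: "\<forall>i<k. q i \<in> forms d" "f = (\<Sum>i<k. (q i)\<^sup>2)" "f \<in> forms (2 * d)"
    using assms(2) unfolding sos_cone_def sum_of_form_squares_def by blast
  have "c *\<^sub>R f = (\<Sum>i<k. (sqrt c *\<^sub>R q i)\<^sup>2)"
    using assms(1) by (simp add: q(2) scaleR_power_rpoly scaleR_sum_right)
  then show ?thesis unfolding sos_cone_def sum_of_form_squares_def
    using q(1) forms_scaleR[OF q(3), of c] by (auto intro!: forms_scaleR exI[of _ k] exI[of _ "\<lambda>i. sqrt c *\<^sub>R q i"])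
qed

lemma product_in_span_squares:
  assumes "f \<in> forms d" "g \<in> forms d"
  shows "f * g \<in> span ((\<lambda>u. u\<^sup>2) ` forms d)"
proof -
  have "f * g = (1/4) *\<^sub>R (f + g)\<^sup>2 - (1/4) *\<^sub>R (f - g)\<^sup>2"
  proof -
    have "(f + g)\<^sup>2 - (f - g)\<^sup>2 = 4 *\<^sub>R (f * g)"
      by (simp add: power2_sum power2_diff numeral_mult_eq_scaleR scaleR_left_distrib[symmetric])
    then show ?thesis by (simp add: scaleR_diff_right[symmetric])
  qed
  moreover have "(f + g)\<^sup>2 \<in> span ((\<lambda>u. u\<^sup>2) ` forms d)" "(f - g)\<^sup>2 \<in> span ((\<lambda>u. u\<^sup>2) ` forms d)"
    using assms by (auto intro!: real_vector.span_base forms_add forms_diff)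
  ultimately show ?thesis by (simp only: real_vector.span_diff real_vector.span_scale)
qed

lemma forms_subset_span_squares: "forms (2 * d) \<subseteq> span ((\<lambda>u. u\<^sup>2) ` forms d)"
proof -
  have "{f * g | f g. f \<in> forms d \<and> g \<in> forms d} \<subseteq> span ((\<lambda>u. u\<^sup>2) ` forms d)"
    using product_in_span_squares by blast
  then have "span {f * g | f g. f \<in> forms d \<and> g \<in> forms d} \<subseteq> span ((\<lambda>u. u\<^sup>2) ` forms d)"
    by (rule real_vector.span_minimal) auto
  then show ?thesis using subset_trans[OF forms_plus_subset_span[of d d]] by (simp add: mult_2)
qed

section \<open>Extremal functionals\<close>

lemma nonneg_quadratic_linear_coeff:
  fixes a b :: real
  assumes "\<And>t. t * a + t\<^sup>2 * b \<ge> 0" shows "a = 0"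
proof (rule ccontr)
  assume "a \<noteq> 0"
  define t where "t = - a / (\<bar>b\<bar> + 1)"
  have "t * a + t\<^sup>2 * b \<le> t * a + t\<^sup>2 * \<bar>b\<bar>" by (simp add: mult_left_mono)
  also have "\<dots> = - (a\<^sup>2 / (\<bar>b\<bar> + 1)\<^sup>2)"
  proof -
    have "\<bar>b\<bar> + 1 \<noteq> 0" by linarith
    then show ?thesis unfolding t_def by (simp add: divide_simps) (simp add: algebra_simps power2_eq_square)
  qed
  also have "\<dots> < 0" using \<open>a \<noteq> 0\<close> by (simp add: zero_less_divide_iff)
  finally show False using assms[of t] by simp
qed

text \<open>The maximum of the Rayleigh quotient of \<open>- b2\<close> by \<open>b1\<close> on the unit sphere of the orthogonal complement of the
kernel of \<open>b1\<close> is the reciprocal of the first \<open>t\<close> at which \<open>b1 + t b2\<close> acquires a new null vector.\<close>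

lemma pencil_boundary:
  fixes b1 b2 :: "'a::euclidean_space \<Rightarrow> 'a \<Rightarrow> real"
  assumes bil: "bilinear b1" "bilinear b2" and sym: "\<And>x y. b1 x y = b1 y x" "\<And>x y. b2 x y = b2 y x"
    and psd: "\<And>x. b1 x x \<ge> 0" and ker: "\<And>x y. (\<And>z. b1 x z = 0) \<Longrightarrow> b2 x y = 0"
    and neg: "b2 x0 x0 < 0"
  shows "\<exists>t>0. (\<forall>x. b1 x x + t * b2 x x \<ge> 0) \<and> (\<exists>x. b1 x x > 0 \<and> b1 x x + t * b2 x x = 0)"
proof -
  have exp: "b (x + y) (x + y) = b x x + 2 * b x y + b y y" if "bilinear b" "\<And>x y. b x y = b y x" for b :: "'a \<Rightarrow> 'a \<Rightarrow> real" and x y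
    using that(2)[of x y] by (simp add: bilinear_ladd[OF that(1)] bilinear_radd[OF that(1)])
  have sc: "b (c *\<^sub>R x) (c *\<^sub>R x) = c\<^sup>2 * b x x" if "bilinear b" for b :: "'a \<Rightarrow> 'a \<Rightarrow> real" and x c
    by (simp add: bilinear_lmul[OF that] bilinear_rmul[OF that] power2_eq_square)
  have cs: "b1 x y = 0" if "b1 x x = 0" for x y
  proof -
    have "t * (2 * b1 x y) + t\<^sup>2 * b1 y y \<ge> 0" for t
      using psd[of "x + t *\<^sub>R y"] that by (simp add: exp[OF bil(1) sym(1)] bilinear_lmul[OF bil(1)] bilinear_rmul[OF bil(1)] power2_eq_square mult_ac)
    then show ?thesis using nonneg_quadratic_linear_coeff by fastforce
  qed
  define K where "K = {x. b1 x x = 0}"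
  have K: "subspace K"
    unfolding K_def by (rule real_vector.subspaceI)
      (auto simp: bilinear_lzero[OF bil(1)] exp[OF bil(1) sym(1)] sc[OF bil(1)] cs)
  have b2K: "b2 x y = 0" if "x \<in> K" for x y
    using that ker cs by (auto simp: K_def)
  define V where "V = {z. \<forall>k\<in>K. orthogonal z k}"
  have V: "subspace V"
    unfolding V_def by (rule real_vector.subspaceI) (auto simp: orthogonal_def inner_left_distrib)
  have dec: "\<exists>z\<in>V. b1 x x = b1 z z \<and> b2 x x = b2 z z" for x
  proof -
    obtain y z where yz: "y \<in> span K" "\<And>w. w \<in> span K \<Longrightarrow> orthogonal z w" "x = y + z"
      using orthogonal_subspace_decomp_exists[of K x] by metis
    have "span K = K" using K by (simp only: span_eq_iff)
    with yz(1) have "y \<in> K" by (simp only:)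
    then have "b1 x x = b1 z z" "b2 x x = b2 z z"
      using cs b2K by (auto simp: yz(3) exp[OF bil(1) sym(1)] exp[OF bil(2) sym(2)] K_def)
    moreover have "z \<in> V" using yz(2) by (auto simp: V_def intro: span_base)
    ultimately show ?thesis by blast
  qed
  have pos: "b1 z z > 0" if "z \<in> V" "z \<noteq> 0" for z
  proof -
    have "b1 z z \<noteq> 0" using that by (auto simp: V_def K_def orthogonal_def)
    then show ?thesis using psd[of z] by simp
  qed
  obtain z1 where z1: "z1 \<in> V" "b2 z1 z1 < 0" using dec[of x0] neg by metis
  have "z1 \<noteq> 0" using z1(2) by (auto simp: bilinear_lzero[OF bil(2)])
  define S where "S = sphere 0 1 \<inter> V"
  have comp: "compact S" unfolding S_def using V by (intro compact_Int_closed closed_subspace) auto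
  have unit: "z /\<^sub>R norm z \<in> S" if "z \<in> V" "z \<noteq> 0" for z
    using that V by (auto simp: S_def real_vector.subspace_scale)
  then have nonempty: "S \<noteq> {}" using z1 \<open>z1 \<noteq> 0\<close> by blast
  have "continuous_on S (\<lambda>z. - b2 z z / b1 z z)"
  proof -
    have nz: "b1 z z \<noteq> 0" if "z \<in> S" for z
    proof -
      have "z \<in> V" "z \<noteq> 0" using that by (auto simp: S_def)
      then show ?thesis using pos[of z] by simp
    qed
    have cont: "continuous_on S (\<lambda>z. b z z)" if "bilinear b" for b :: "'a \<Rightarrow> 'a \<Rightarrow> real"
      by (rule bilinear_continuous_on_compose[OF continuous_on_id continuous_on_id that])
    show ?thesis
      by (intro continuous_on_divide continuous_on_minus cont[OF bil(1)] cont[OF bil(2)] ballI nz)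
  qed
  then obtain z0 where z0: "z0 \<in> S" "\<And>z. z \<in> S \<Longrightarrow> - b2 z z / b1 z z \<le> - b2 z0 z0 / b1 z0 z0"
    using continuous_attains_sup[OF comp nonempty] by blast
  define M where "M = - b2 z0 z0 / b1 z0 z0"
  have le: "- b2 z z / b1 z z \<le> M" if "z \<in> V" "z \<noteq> 0" for z
    using z0(2)[OF unit[OF that]] that by (simp add: sc[OF bil(1)] sc[OF bil(2)] M_def)
  have z0': "z0 \<in> V" "z0 \<noteq> 0" using z0(1) by (auto simp: S_def)
  have "- b2 z1 z1 / b1 z1 z1 > 0" using z1(2) pos[OF z1(1) \<open>z1 \<noteq> 0\<close>] by (simp add: divide_neg_pos)
  then have M: "M > 0" using le[OF z1(1) \<open>z1 \<noteq> 0\<close>] by linarith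
  have "b1 x x + (1 / M) * b2 x x \<ge> 0" for x
  proof -
    obtain z where z: "z \<in> V" "b1 x x = b1 z z" "b2 x x = b2 z z" using dec by blast
    show ?thesis
    proof (cases "z = 0")
      case True
      then show ?thesis using z by (simp add: bilinear_lzero[OF bil(1)] bilinear_lzero[OF bil(2)])
    next
      case False
      then have "- b2 z z \<le> M * b1 z z" using iffD1[OF pos_divide_le_eq le] pos z(1) by blast
      then show ?thesis using M z by (simp add: field_simps)
    qed
  qed
  moreover have "b1 z0 z0 + (1 / M) * b2 z0 z0 = 0"
  proof -
    have "b2 z0 z0 = - M * b1 z0 z0" using pos[OF z0'] by (simp add: M_def)
    then show ?thesis using M by simp
  qed
  ultimately show ?thesis using M pos[OF z0'] by (intro exI[of _ "1 / M"]) auto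
qed

definition sq_kernel :: "('n::finite rpoly \<Rightarrow> real) \<Rightarrow> nat \<Rightarrow> 'n rpoly set" where
  "sq_kernel l d = {f \<in> forms d. \<forall>g\<in>forms d. l (f * g) = 0}"

lemma subspace_sq_kernel: "linear l \<Longrightarrow> subspace (sq_kernel l d)"
  unfolding sq_kernel_def
  by (rule real_vector.subspaceI) (auto simp: linear_0 distrib_right linear_add linear_cmul intro: forms_add forms_scaleR)

text \<open>The Cauchy-Schwarz inequality for a positive semidefinite form, in the degenerate case.\<close>

lemma sq_kernelI:
  assumes l: "linear l" "\<And>u. u \<in> forms d \<Longrightarrow> l (u\<^sup>2) \<ge> 0" and f: "f \<in> forms d" "l (f\<^sup>2) = 0"
  shows "f \<in> sq_kernel l d"
proof -
  have "l (f * g) = 0" if g: "g \<in> forms d" for g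
  proof -
    have "t * (2 * l (f * g)) + t\<^sup>2 * l (g\<^sup>2) \<ge> 0" for t
    proof -
      have "(f + t *\<^sub>R g)\<^sup>2 = f\<^sup>2 + (2 * t) *\<^sub>R (f * g) + t\<^sup>2 *\<^sub>R g\<^sup>2"
        by (simp add: power2_sum numeral_mult_eq_scaleR scaleR_power_rpoly)
      then show ?thesis
        using l(2)[OF forms_add[OF f(1) forms_scaleR[OF g, of t]]] f(2)
        by (simp add: linear_add[OF l(1)] linear_cmul[OF l(1)])
    qed
    then show ?thesis using nonneg_quadratic_linear_coeff by fastforce
  qed
  then show ?thesis using f by (simp add: sq_kernel_def)
qed

text \<open>Matrices parametrise quadrics linearly, which moves the pencil of forms to a Euclidean space; the
kernel of the parametrisation does no harm, because semidefinite forms are allowed there.\<close>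

lemma larger_kernel:
  fixes l m :: "'n::finite rpoly \<Rightarrow> real"
  assumes lin: "linear l" "linear m" and psd: "\<And>u. u \<in> forms 2 \<Longrightarrow> l (u\<^sup>2) \<ge> 0"
    and ker: "\<And>f g. f \<in> sq_kernel l 2 \<Longrightarrow> g \<in> forms 2 \<Longrightarrow> m (f * g) = 0"
    and neg: "f0 \<in> forms 2" "m (f0\<^sup>2) < 0"
  shows "\<exists>t>0. (\<forall>u\<in>forms 2. l (u\<^sup>2) + t * m (u\<^sup>2) \<ge> 0) \<and>
     (\<exists>u\<in>forms 2. l (u\<^sup>2) > 0 \<and> l (u\<^sup>2) + t * m (u\<^sup>2) = 0)"
proof -
  define F where "F A = (\<Sum>k\<in>UNIV. A $ k *\<^sub>R (var (fst k) * var (snd k)))" for A :: "real ^ ('n \<times> 'n)"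
  have linF: "linear F"
    by (rule linearI) (simp_all add: F_def scaleR_left_distrib sum.distrib scaleR_sum_right)
  have xx: "var i * var j \<in> forms 2" for i j :: 'n
    using forms_mult[OF forms_var forms_var, of i j] by (simp add: numeral_2_eq_2)
  have F: "F A \<in> forms 2" for A unfolding F_def by (intro forms_sum forms_scaleR xx)
  have surj: "\<exists>A. u = F A" if "u \<in> forms 2" for u
  proof -
    have "var i * var j \<in> range F" for i j
    proof
      have "F (axis (i, j) 1) = (\<Sum>k\<in>UNIV. if k = (i, j) then var (fst k) * var (snd k) else 0)"
        unfolding F_def by (rule sum.cong) (auto simp: axis_def)
      then show "var i * var j = F (axis (i, j) 1)" by simp
    qed simp
    then have "span {var i * var j | i j. True} \<subseteq> range F"
      by (intro real_vector.span_minimal linear_subspace_image[OF linF]) auto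
    then show ?thesis using that forms_2_subset_span by blast
  qed
  have bil: "bilinear (\<lambda>A B. h (F A * F B))" if "linear h" for h :: "'n rpoly \<Rightarrow> real"
    unfolding bilinear_def
    by (intro conjI allI linearI)
      (simp_all add: linear_add[OF linF] linear_cmul[OF linF] distrib_left distrib_right linear_add[OF that] linear_cmul[OF that])
  obtain A0 where A0: "f0 = F A0" using surj neg by blast
  have "\<exists>t>0. (\<forall>A. l (F A * F A) + t * m (F A * F A) \<ge> 0) \<and>
      (\<exists>A. l (F A * F A) > 0 \<and> l (F A * F A) + t * m (F A * F A) = 0)"
  proof (rule pencil_boundary[where ?b1.0 = "\<lambda>A B. l (F A * F B)" and ?b2.0 = "\<lambda>A B. m (F A * F B)" and ?x0.0 = A0])
    show "bilinear (\<lambda>A B. l (F A * F B))" "bilinear (\<lambda>A B. m (F A * F B))" by (rule bil, rule lin)+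
    show "l (F A * F A) \<ge> 0" for A using psd[OF F[of A]] by (simp add: power2_eq_square)
    show "m (F A * F B) = 0" if "\<And>B. l (F A * F B) = 0" for A B
    proof (rule ker[OF _ F])
      show "F A \<in> sq_kernel l 2" unfolding sq_kernel_def using that surj F by auto
    qed
    show "m (F A0 * F A0) < 0" using neg A0 by (simp add: power2_eq_square)
  qed (simp_all add: mult.commute)
  then show ?thesis using surj F unfolding power2_eq_square by metis
qed

lemma separating_functional:
  fixes y :: "'a::real_vector"
  assumes "y \<notin> span S"
  shows "\<exists>h. linear h \<and> (\<forall>x\<in>S. h x = (0::real)) \<and> h y = 1"
proof -
  obtain B where B: "B \<subseteq> S" "independent B" "S \<subseteq> span B"
    by (rule real_vector.maximal_independent_subset)
  have "span B \<subseteq> span S" by (rule real_vector.span_mono[OF B(1)])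
  then have "y \<notin> span B" using assms by blast
  then have "independent (insert y B)" using B by (simp add: real_vector.independent_insertI)
  then obtain h where h: "linear h" "\<And>x. x \<in> insert y B \<Longrightarrow> h x = (if x = y then 1 else (0::real))"
    using linear_independent_extend[of "insert y B" "\<lambda>x. if x = y then 1 else 0"] by blast
  have "h x = 0" if "x \<in> B" for x using h(2)[of x] that \<open>y \<notin> span B\<close> real_vector.span_base by auto
  then have "h x = 0" if "x \<in> S" for x
    using linear_eq_0_on_span[OF h(1), of B x] B(3) that by blast
  then show ?thesis using h by (intro exI[of _ h]) auto
qed

text \<open>Otherwise some functional \<open>\<mu>\<close> on quintics is nonzero and kills \<open>W\<close> times the cubics. For each variable, \<open>\<mu> (var i * y)\<close> is a functional on
quartics that kills \<open>W\<close> times the quadrics, hence \<open>c i\<close> times \<open>l\<close>. Exchanging two variables in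
\<open>\<mu> (var i * var j * w)\<close> shows that \<open>l\<close> is a multiple of the evaluation at the point with coordinates
\<open>c\<close>, but \<open>p\<close> is positive there while \<open>l p = 0\<close>.\<close>

lemma extremal_irrelevant:
  fixes l :: "'n::finite rpoly \<Rightarrow> real"
  assumes lin: "linear l" and ext: "\<And>m. linear m \<Longrightarrow>
       (\<And>f g. f \<in> sq_kernel l 2 \<Longrightarrow> g \<in> forms 2 \<Longrightarrow> m (f * g) = 0) \<Longrightarrow> \<exists>c. \<forall>y\<in>forms 4. m y = c * l y"
    and p: "p \<in> forms 4" "l p = 0" "\<And>v. v \<noteq> 0 \<Longrightarrow> poly_value p v > 0" and ne: "y0 \<in> forms 4" "l y0 \<noteq> 0"
  shows "irrelevant (sq_kernel l 2)"
proof (rule ccontr)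
  assume not_irr: "\<not> ?thesis"
  let ?W = "sq_kernel l 2"
  define T where "T = {f * g | f g. f \<in> ?W \<and> g \<in> forms 3}"
  have "T \<subseteq> ideal.span ?W" unfolding T_def by (auto intro: ideal_multR ideal.span_base)
  then have Ts: "span T \<subseteq> ideal.span ?W" by (rule real_vector.span_minimal[OF _ subspace_ideal])
  have "\<not> forms 5 \<subseteq> span T"
  proof
    assume "forms 5 \<subseteq> span T"
    moreover have "var i ^ 5 \<in> forms 5" for i :: 'n by (rule forms_power_eq[OF forms_var]) simp
    ultimately have "irrelevant ?W" using Ts by (auto simp: irrelevant_def)
    with not_irr show False by simp
  qed
  then obtain z where z: "z \<in> forms 5" "z \<notin> span T" by blast
  then obtain \<mu> where \<mu>: "linear \<mu>" "\<And>x. x \<in> T \<Longrightarrow> \<mu> x = (0::real)" "\<mu> z = 1"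
    using separating_functional by metis
  have lin_mult: "linear (\<lambda>y. h (a * y))" if "linear h" for h :: "'n rpoly \<Rightarrow> real" and a
    using linear_compose[OF linear_mult_left that] by (simp add: o_def)
  have "\<exists>c. \<forall>y\<in>forms 4. \<mu> (var i * y) = c * l y" for i
  proof (rule ext[OF lin_mult[OF \<mu>(1)]])
    fix f g :: "'n rpoly" assume fg: "f \<in> ?W" "g \<in> forms 2"
    have "var i * g \<in> forms 3" by (rule forms_mult_eq[OF forms_var fg(2)]) simp
    then have "f * (var i * g) \<in> T" using fg T_def by blast
    then show "\<mu> (var i * (f * g)) = 0" using \<mu>(2) by (simp add: mult.left_commute)
  qed
  then obtain c where c: "\<And>i y. y \<in> forms 4 \<Longrightarrow> \<mu> (var i * y) = c i * l y" by metis
  have "\<exists>i. c i \<noteq> 0"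
  proof (rule ccontr)
    assume "\<not> ?thesis"
    then have "\<mu> x = 0" if "x \<in> {var i * g | i g. g \<in> forms 4}" for x using that c by auto
    moreover have "z \<in> span {var i * g | i g. g \<in> forms 4}"
      using forms_Suc_subset_span[of 4] z(1) by auto
    ultimately have "\<mu> z = 0" using linear_eq_0_on_span[OF \<mu>(1)] by blast
    then show False using \<mu>(3) by simp
  qed
  then obtain i0 where i0: "c i0 \<noteq> 0" by blast
  define v :: "real ^ 'n" where "v = (\<chi> i. c i / c i0)"
  have "v $ i0 = 1" using i0 by (simp add: v_def)
  then have v0: "v \<noteq> 0" by (metis zero_index zero_neq_one)
  have shift: "l (var i * w) = v $ i * l (var i0 * w)" if "w \<in> forms 3" for i w
  proof -
    have w4: "var j * w \<in> forms 4" for j by (rule forms_mult_eq[OF forms_var that]) simp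
    have "c i0 * l (var i * w) = \<mu> (var i0 * (var i * w))" using c[OF w4] by simp
    also have "\<dots> = \<mu> (var i * (var i0 * w))" by (simp add: mult.left_commute)
    also have "\<dots> = c i * l (var i0 * w)" using c[OF w4] by simp
    finally show ?thesis using i0 by (simp add: v_def field_simps)
  qed
  have ev: "l (y * u) = poly_value y v * l (var i0 ^ d * u)" if "d \<le> 4" "y \<in> forms d" "u \<in> forms (4 - d)" for d y u
    using that
  proof (induction d arbitrary: y u)
    case 0
    then obtain c where "y = c *\<^sub>R 1" using forms_0_eq by blast
    moreover have "poly_value (1 :: 'n rpoly) v = 1" using poly_value_monom[of 0 v] by simp
    ultimately show ?case by (simp add: linear_cmul[OF lin] linear_cmul[OF linear_poly_value])
  next
    case (Suc d)
    have "y \<in> span {var i * g | i g. g \<in> forms d}" using Suc.prems forms_Suc_subset_span by blast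
    then show ?case
    proof (induction rule: real_vector.span_induct_alt)
      case base
      then show ?case by (simp add: linear_0[OF lin] linear_0[OF linear_poly_value])
    next
      case (step k x y)
      then obtain i g where x: "x = var i * g" "g \<in> forms d" by blast
      have gu: "g * u \<in> forms 3" by (rule forms_mult_eq[OF x(2) Suc.prems(3)]) (use Suc.prems(1) in simp)
      have u': "var i0 * u \<in> forms (4 - d)" by (rule forms_mult_eq[OF forms_var Suc.prems(3)]) (use Suc.prems(1) in simp)
      have "l (x * u) = v $ i * l (g * (var i0 * u))"
        using shift[OF gu, of i] by (simp add: x mult_ac)
      also have "\<dots> = v $ i * (poly_value g v * l (var i0 ^ d * (var i0 * u)))"
        using Suc.IH[OF _ x(2) u'] Suc.prems(1) by simp
      also have "\<dots> = poly_value x v * l (var i0 ^ Suc d * u)"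
        by (simp add: x poly_value_mult poly_value_var mult_ac)
      finally show ?case
        using step by (simp add: distrib_right linear_add[OF lin] linear_cmul[OF lin]
          linear_add[OF linear_poly_value] linear_cmul[OF linear_poly_value])
    qed
  qed
  have l_ev: "l y = poly_value y v * l (var i0 ^ 4)" if "y \<in> forms 4" for y
    using ev[of 4 y 1] that by simp
  have "l (var i0 ^ 4) = 0" using l_ev[OF p(1)] p(2) p(3)[OF v0] by auto
  then show False using l_ev[OF ne(1)] ne(2) by simp
qed

text \<open>Take a supporting functional whose kernel has maximal dimension. A functional \<open>m\<close> that kills \<open>W\<close> times the
quadrics and is no multiple of \<open>l\<close> could be added to \<open>l\<close>, up to sign, until semidefiniteness is about to fail;
the sum still vanishes at \<open>p\<close> and has a larger kernel.\<close>

lemma exists_extremal_functional: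
  fixes p :: "'n::finite rpoly"
  assumes p: "p \<in> sos_cone 2" "p \<notin> (forms_topology 4) interior_of (sos_cone 2)"
    and pos: "\<And>v. v \<noteq> 0 \<Longrightarrow> poly_value p v > 0"
  shows "\<exists>l. linear l \<and> (\<forall>u\<in>forms 2. l (u\<^sup>2) \<ge> 0) \<and> l p = 0 \<and> (\<exists>y\<in>forms 4. l y \<noteq> 0) \<and> irrelevant (sq_kernel l 2)"
proof -
  define good where "good l \<longleftrightarrow> linear l \<and> (\<forall>u\<in>forms 2. l (u\<^sup>2) \<ge> 0) \<and> l p = 0 \<and> (\<exists>y\<in>forms 4. l y \<noteq> 0)"
    for l :: "'n rpoly \<Rightarrow> real"
  have p4: "p \<in> forms 4" using p(1) sos_cone_forms[of 2] by auto
  have "\<exists>l. good l"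
  proof -
    let ?mon = "\<lambda>((i, j), (k, l)). Poly_Mapping.single i 1 + Poly_Mapping.single j 1 + Poly_Mapping.single k 1 + Poly_Mapping.single l 1
        :: 'n \<Rightarrow>\<^sub>0 nat"
    have "m \<in> range ?mon" if m: "mdeg m = 4" for m :: "'n \<Rightarrow>\<^sub>0 nat"
    proof -
      have step: "\<exists>i m'. mdeg m' = d \<and> m = Poly_Mapping.single i 1 + m'" if "mdeg m = Suc d" for m :: "'n \<Rightarrow>\<^sub>0 nat" and d
      proof -
        obtain i m' where i: "mdeg m' = d" "monomial m = var i * monomial m'" using exists_var_factor[OF \<open>mdeg m = Suc d\<close>] by blast
        then have "monomial m = monomial (Poly_Mapping.single i 1 + m')" by (simp add: var_def mult_single)
        then have "m = Poly_Mapping.single i 1 + m'" by (metis keys_single singleton_inject zero_neq_one)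
        with i show ?thesis by blast
      qed
      obtain i m1 where 1: "mdeg m1 = 3" "m = Poly_Mapping.single i 1 + m1" using step[of m 3] m by auto
      obtain j m2 where 2: "mdeg m2 = 2" "m1 = Poly_Mapping.single j 1 + m2" using step[of m1 2] 1 by auto
      obtain k m3 where 3: "mdeg m3 = 1" "m2 = Poly_Mapping.single k 1 + m3" using step[of m2 1] 2 by auto
      obtain h m4 where 4: "mdeg m4 = 0" "m3 = Poly_Mapping.single h 1 + m4" using step[of m3 0] 3 by auto
      have "m = ?mon ((i, j), (k, h))" using 1 2 3 4 by (simp add: mdeg_eq_0_iff add.assoc)
      then show ?thesis by blast
    qed
    then have mon: "range ?mon = {m. mdeg m = 4}" by (auto simp: mdeg_add)
    have "\<exists>l. linear l \<and> (\<forall>y\<in>sos_cone 2. l y \<ge> (0::real)) \<and> l p = 0 \<and> (\<exists>y\<in>forms 4. l y \<noteq> 0)"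
    proof (rule supporting_functional[OF mon])
      show "sos_cone 2 \<subseteq> forms 4" using sos_cone_forms[of 2] by simp
      have "(\<lambda>u. u\<^sup>2) ` forms 2 \<subseteq> sos_cone 2" using square_in_sos_cone by blast
      then have "span ((\<lambda>u. u\<^sup>2) ` forms 2) \<subseteq> span (sos_cone 2 :: 'n rpoly set)"
        by (rule real_vector.span_mono)
      then show "forms 4 \<subseteq> span (sos_cone 2 :: 'n rpoly set)"
        using subset_trans[OF forms_subset_span_squares[of 2]] by simp
    qed (use p in \<open>auto intro: sos_cone_0 sos_cone_add sos_cone_scaleR\<close>)
    then show ?thesis unfolding good_def using square_in_sos_cone by blast
  qed
  then obtain l1 where l1: "good l1" by blast
  obtain B :: "'n rpoly set" where B: "finite B" "forms 2 \<subseteq> span B" using forms_dim_bound by blast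
  have kB: "sq_kernel l 2 \<subseteq> span B" for l using B(2) by (auto simp: sq_kernel_def)
  have "\<exists>l. good l \<and> (\<forall>l'. good l' \<longrightarrow> dim (sq_kernel l' 2) \<le> dim (sq_kernel l 2))"
    by (rule ex_has_greatest_nat[of _ l1 _ "Suc (card B)"])
      (use l1 real_vector.dim_le_card[OF kB B(1)] in \<open>auto simp: less_Suc_eq_le\<close>)
  then obtain l where l: "good l" and max: "\<And>l'. good l' \<Longrightarrow> dim (sq_kernel l' 2) \<le> dim (sq_kernel l 2)"
    by blast
  have lin: "linear l" and psd: "\<And>u. u \<in> forms 2 \<Longrightarrow> l (u\<^sup>2) \<ge> 0" and lp: "l p = 0" using l by (auto simp: good_def)
  obtain y0 where y0: "y0 \<in> forms 4" "l y0 \<noteq> 0" using l good_def by blast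
  obtain k q where q: "\<And>i. i < (k::nat) \<Longrightarrow> q i \<in> forms 2" "p = (\<Sum>i<k. (q i)\<^sup>2)"
    using p(1) by (auto simp: sos_cone_def sum_of_form_squares_def)
  have qk: "q i \<in> sq_kernel l 2" if "i < k" for i
  proof -
    have "(\<Sum>i<k. l ((q i)\<^sup>2)) = 0" using lp by (simp add: q(2) linear_sum[OF lin])
    then have "l ((q i)\<^sup>2) = 0"
      using sum_nonneg_eq_0_iff[of "{..<k}" "\<lambda>i. l ((q i)\<^sup>2)"] psd q(1) that by auto
    then show ?thesis using sq_kernelI[OF lin psd] q(1) that by blast
  qed
  have "\<exists>c. \<forall>y\<in>forms 4. m y = c * l y"
    if m: "linear m" and ker: "\<And>f g. f \<in> sq_kernel l 2 \<Longrightarrow> g \<in> forms 2 \<Longrightarrow> m (f * g) = 0" for m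
  proof (rule ccontr)
    assume neg: "\<not> ?thesis"
    have "\<exists>f\<in>forms 2. m (f\<^sup>2) \<noteq> 0"
    proof (rule ccontr)
      assume "\<not> ?thesis"
      then have "m y = 0" if "y \<in> forms 4" for y
        using linear_eq_0_on_span[OF m, of "(\<lambda>u. u\<^sup>2) ` forms 2" y] forms_subset_span_squares[of 2] that by auto
      then show False using neg by (auto intro: exI[of _ 0])
    qed
    then obtain f where f: "f \<in> forms 2" "m (f\<^sup>2) \<noteq> 0" by blast
    define e where "e = (if m (f\<^sup>2) < 0 then 1 else - 1 :: real)"
    define m' where "m' y = e * m y" for y
    have m': "linear m'" unfolding m'_def using linear_compose[OF m linear_times[of e]] by (simp add: o_def)
    have ker': "\<And>f g. f \<in> sq_kernel l 2 \<Longrightarrow> g \<in> forms 2 \<Longrightarrow> m' (f * g) = 0" using ker by (simp add: m'_def)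
    have "m' (f\<^sup>2) < 0" using f by (auto simp: m'_def e_def)
    then obtain t u where t: "t > 0" "\<And>u. u \<in> forms 2 \<Longrightarrow> l (u\<^sup>2) + t * m' (u\<^sup>2) \<ge> 0"
      and u: "u \<in> forms 2" "l (u\<^sup>2) > 0" "l (u\<^sup>2) + t * m' (u\<^sup>2) = 0"
      using larger_kernel[OF lin m' psd ker' f(1)] by blast
    define l' where "l' y = l y + t * m' y" for y
    have l': "linear l'"
      unfolding l'_def by (rule linearI) (simp_all add: linear_add[OF lin] linear_add[OF m'] linear_cmul[OF lin] linear_cmul[OF m'] algebra_simps)
    have "m' p = 0" using ker'[OF qk q(1)] by (simp add: q(2) linear_sum[OF m'] power2_eq_square)
    moreover have "\<exists>y\<in>forms 4. l' y \<noteq> 0"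
    proof (rule ccontr)
      assume "\<not> ?thesis"
      then have "m y = (- 1 / (t * e)) * l y" if "y \<in> forms 4" for y
        using that t(1) by (auto simp: l'_def m'_def e_def field_simps split: if_splits)
      then show False using neg by blast
    qed
    ultimately have good': "good l'" unfolding good_def using l' t lp by (auto simp: l'_def)
    have psd': "\<And>u. u \<in> forms 2 \<Longrightarrow> l' (u\<^sup>2) \<ge> 0" using t(2) by (simp add: l'_def)
    have "sq_kernel l 2 = sq_kernel l' 2"
    proof (rule subspace_eq_of_dim_le[OF subspace_sq_kernel[OF lin] subspace_sq_kernel[OF l'] _ max[OF good'] B(1) kB])
      show "sq_kernel l 2 \<subseteq> sq_kernel l' 2" using ker' by (auto simp: sq_kernel_def l'_def)
    qed
    moreover have "u \<in> sq_kernel l' 2" by (rule sq_kernelI[OF l' psd' u(1)]) (use u(3) in \<open>simp_all add: l'_def\<close>)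
    moreover have "u \<notin> sq_kernel l 2" using u(1,2) by (force simp: sq_kernel_def power2_eq_square)
    ultimately show False by simp
  qed
  then have "irrelevant (sq_kernel l 2)"
    by (intro extremal_irrelevant[OF lin _ p4 lp pos y0]) auto
  then show ?thesis using l unfolding good_def by blast
qed

section \<open>Lengths of sums of squares\<close>

text \<open>If \<open>s\<close> is the combination of the \<open>u i\<close> with coefficients \<open>d i\<close>, then the sum of all \<open>(u i)\<^sup>2\<close> plus \<open>s\<^sup>2\<close> is
the sum of all \<open>(u i + t * d i * s)\<^sup>2\<close> as soon as \<open>2 * t + t\<^sup>2 * D = 1\<close>, where \<open>D\<close> is the sum of all \<open>(d i)\<^sup>2\<close>.\<close>

lemma shorten_sum_of_squares:
  fixes q :: "nat \<Rightarrow> 'n::finite rpoly"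
  assumes W: "subspace W" and q: "\<And>i. i \<le> k \<Longrightarrow> q i \<in> W"
    and dep: "(\<Sum>i\<le>k. c i *\<^sub>R q i) = 0" "j \<le> k" "c j \<noteq> 0"
  shows "\<exists>r. (\<forall>i<k. r i \<in> W) \<and> (\<Sum>i\<le>k. (q i)\<^sup>2) = (\<Sum>i<k. (r i)\<^sup>2)"
proof -
  define \<pi> where "\<pi> = Transposition.transpose j k"
  have \<pi>: "bij_betw \<pi> {..k} {..k}"
    unfolding \<pi>_def using dep(2) by (intro bij_betw_byWitness[where f' = "Transposition.transpose j k"]) (auto simp: Transposition.transpose_def)
  \<comment> \<open>the transposition moves the dependent square to the last position\<close>
  define u where "u i = q (\<pi> i)" for i
  define d where "d i = - c (\<pi> i) / c j" for i
  have uW: "u i \<in> W" if "i \<le> k" for i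
    using q \<pi> that by (auto simp: u_def bij_betw_def)
  have "(\<Sum>i\<le>k. c (\<pi> i) *\<^sub>R u i) = 0"
    using sum.reindex_bij_betw[OF \<pi>, of "\<lambda>i. c i *\<^sub>R q i"] dep(1) by (simp add: u_def)
  then have "(\<Sum>i<k. c (\<pi> i) *\<^sub>R u i) + c j *\<^sub>R u k = 0"
    by (simp add: lessThan_Suc_atMost[symmetric] \<pi>_def)
  then have "(- 1 / c j) *\<^sub>R ((\<Sum>i<k. c (\<pi> i) *\<^sub>R u i) + c j *\<^sub>R u k) = 0" by simp
  then have uk: "u k = (\<Sum>i<k. d i *\<^sub>R u i)"
    using dep(3) by (simp add: scaleR_add_right scaleR_sum_right d_def)
  define D where "D = (\<Sum>i<k. (d i)\<^sup>2)"
  define t where "t = 1 / (1 + sqrt (1 + D))"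
  have D: "D \<ge> 0" unfolding D_def by (intro sum_nonneg) simp
  have "1 + sqrt (1 + D) \<noteq> 0" using D by (smt (verit) real_sqrt_ge_zero)
  moreover have "(sqrt (1 + D))\<^sup>2 = 1 + D" using D by simp
  ultimately have t: "2 * t + t\<^sup>2 * D = 1"
    unfolding t_def by (simp add: divide_simps) (simp add: algebra_simps power2_eq_square)
  define r where "r i = u i + (t * d i) *\<^sub>R u k" for i
  have "(\<Sum>i<k. (r i)\<^sup>2) = (\<Sum>i<k. (u i)\<^sup>2 + (2 * t) *\<^sub>R (d i *\<^sub>R u i * u k) + (t\<^sup>2 * (d i)\<^sup>2) *\<^sub>R (u k)\<^sup>2)"
    by (rule sum.cong) (auto simp: r_def power2_sum numeral_mult_eq_scaleR scaleR_power_rpoly power_mult_distrib)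
  also have "\<dots> = (\<Sum>i<k. (u i)\<^sup>2) + (2 * t) *\<^sub>R ((\<Sum>i<k. d i *\<^sub>R u i) * u k) + (t\<^sup>2 * D) *\<^sub>R (u k)\<^sup>2"
    unfolding D_def sum.distrib scaleR_sum_right sum_distrib_right sum_distrib_left scaleR_sum_left ..
  also have "\<dots> = (\<Sum>i<k. (u i)\<^sup>2) + (2 * t + t\<^sup>2 * D) *\<^sub>R (u k)\<^sup>2"
    unfolding uk[symmetric] by (simp add: scaleR_add_left power2_eq_square)
  also have "\<dots> = (\<Sum>i\<le>k. (u i)\<^sup>2)" by (simp add: t lessThan_Suc_atMost[symmetric])
  also have "\<dots> = (\<Sum>i\<le>k. (q i)\<^sup>2)"
    using sum.reindex_bij_betw[OF \<pi>, of "\<lambda>i. (q i)\<^sup>2"] by (simp add: u_def)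
  finally have "(\<Sum>i\<le>k. (q i)\<^sup>2) = (\<Sum>i<k. (r i)\<^sup>2)" by simp
  moreover have "r i \<in> W" if "i < k" for i
    unfolding r_def using that W by (intro real_vector.subspace_add real_vector.subspace_scale uW) auto
  ultimately show ?thesis by blast
qed

lemma sum_of_squares_in_subspace:
  fixes q :: "nat \<Rightarrow> 'n::finite rpoly"
  assumes W: "subspace W" "finite F" "W \<subseteq> span F" "card F \<le> n" and q: "\<And>i. i < k \<Longrightarrow> q i \<in> W"
  shows "\<exists>r. (\<forall>i<n. r i \<in> W) \<and> (\<Sum>i<k. (q i)\<^sup>2) = (\<Sum>i<n. (r i)\<^sup>2)"
  using q
proof (induction k arbitrary: q)
  case 0
  then show ?case using real_vector.subspace_0[OF W(1)] by (intro exI[of _ "\<lambda>_. 0"]) auto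
next
  case (Suc k)
  show ?case
  proof (cases "Suc k \<le> n")
    case True
    let ?r = "\<lambda>i. if i < Suc k then q i else 0"
    have "(\<Sum>i<Suc k. (q i)\<^sup>2) = (\<Sum>i<Suc k. (?r i)\<^sup>2)" by (rule sum.cong) auto
    also have "\<dots> = (\<Sum>i<n. (?r i)\<^sup>2)"
      by (rule sum.mono_neutral_left) (use True in auto)
    finally show ?thesis using Suc.prems real_vector.subspace_0[OF W(1)] by (intro exI[of _ ?r]) auto
  next
    case False
    then have "card F \<le> k" using W(4) by simp
    then obtain c j where c: "j \<le> k" "c j \<noteq> 0" "(\<Sum>i\<le>k. c i *\<^sub>R q i) = 0"
      using dependent_family[OF W(2), of k q] W(3) Suc.prems by (auto simp: subset_iff)
    obtain r where r: "\<forall>i<k. r i \<in> W" "(\<Sum>i\<le>k. (q i)\<^sup>2) = (\<Sum>i<k. (r i)\<^sup>2)"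
      using shorten_sum_of_squares[OF W(1) _ c(3,1,2)] Suc.prems by auto
    then show ?thesis using Suc.IH[of r] by (simp add: lessThan_Suc_atMost)
  qed
qed

section \<open>The two bounds on the length\<close>

lemma ideal_forms_span:
  assumes A: "A \<subseteq> forms e" and y: "y \<in> ideal.span A" "y \<in> forms d"
  shows "y \<in> span {a * g | a g. a \<in> A \<and> g \<in> forms (d - e)}"
proof -
  let ?T = "{a * g | a g. a \<in> A \<and> g \<in> forms (d - e)}"
  have "hcomp d y \<in> span ?T"
    using y(1)
  proof (induction rule: ideal.span_induct_alt)
    case base
    then show ?case by (simp add: real_vector.span_zero)
  next
    case (step c a z)
    then have "a \<in> forms e" using A by blast
    moreover have "a * hcomp (d - e) c \<in> span ?T"
      using step hcomp_forms by (intro real_vector.span_base) blast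
    ultimately have "hcomp d (a * c) \<in> span ?T"
      by (simp add: hcomp_mult real_vector.span_zero)
    then show ?case using step by (simp add: hcomp_add mult.commute real_vector.span_add)
  qed
  then show ?thesis using hcomp_id[OF y(2)] by simp
qed

lemma ideal_forms_same_degree:
  assumes "A \<subseteq> forms e" "y \<in> ideal.span A" "y \<in> forms e"
  shows "y \<in> span A"
proof -
  have "{a * g | a g. a \<in> A \<and> g \<in> forms (e - e)} \<subseteq> span A"
    using forms_0_eq by (force intro: real_vector.span_scale real_vector.span_base)
  then have "span {a * g | a g. a \<in> A \<and> g \<in> forms (e - e)} \<subseteq> span A"
    by (rule real_vector.span_minimal) auto
  then show ?thesis using ideal_forms_span[OF assms] by blast
qed

lemma independent_monom:
  assumes "finite A" shows "independent (monomial ` A :: 'n rpoly set)"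
proof (rule real_vector.independent_if_scalars_zero)
  show "finite (monomial ` A :: 'n rpoly set)" using assms by simp
  fix f and x :: "'n rpoly"
  assume *: "(\<Sum>x\<in>monomial ` A. f x *\<^sub>R x) = 0" and x: "x \<in> monomial ` A"
  then obtain m where m: "m \<in> A" "x = monomial m" by blast
  have inj: "inj_on (monomial :: _ \<Rightarrow> 'n rpoly) A"
    by (rule inj_onI) (metis keys_single singleton_inject zero_neq_one)
  have "0 = Poly_Mapping.lookup (\<Sum>x\<in>monomial ` A. f x *\<^sub>R x) m" using * by simp
  also have "\<dots> = (\<Sum>n\<in>A. f (monomial n) * (if n = m then 1 else 0))"
    unfolding sum.reindex[OF inj] o_def lookup_sum by (rule sum.cong) (auto simp: lookup_single when_def)
  also have "\<dots> = f x" using m assms by (simp add: if_distrib[where f="\<lambda>x. _ * x"] cong: if_cong)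
  finally show "f x = 0" by simp
qed

text \<open>The four squares and the three remaining multiples of one variable are already seven independent
monomials.\<close>

lemma forms_2_not_small:
  assumes "finite B" "card B \<le> 5" shows "\<not> forms 2 \<subseteq> span (B :: 4 rpoly set)"
proof
  assume sub: "forms 2 \<subseteq> span B"
  define A :: "(4 \<Rightarrow>\<^sub>0 nat) set" where
    "A = range (\<lambda>i. Poly_Mapping.single i 2) \<union> (\<lambda>j. Poly_Mapping.single 0 1 + Poly_Mapping.single j 1) ` (UNIV - {0})"
  have fin: "finite A" by (simp add: A_def)
  have "card (range (\<lambda>i :: 4. Poly_Mapping.single i (2::nat))) = 4"
  proof -
    have "inj (\<lambda>i :: 4. Poly_Mapping.single i (2::nat))"
      by (rule injI) (metis keys_single singleton_inject zero_neq_numeral)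
    then show ?thesis by (simp add: card_image)
  qed
  moreover have "card ((\<lambda>j :: 4. Poly_Mapping.single 0 1 + Poly_Mapping.single j (1::nat)) ` (UNIV - {0})) = 3"
  proof -
    have "inj_on (\<lambda>j :: 4. Poly_Mapping.single 0 1 + Poly_Mapping.single j (1::nat)) (UNIV - {0})"
      by (rule inj_onI) (metis add_left_cancel keys_single singleton_inject zero_neq_one)
    then show ?thesis by (simp add: card_image card_Diff_singleton)
  qed
  moreover have "range (\<lambda>i :: 4. Poly_Mapping.single i (2::nat)) \<inter>
      (\<lambda>j. Poly_Mapping.single 0 1 + Poly_Mapping.single j 1) ` (UNIV - {0}) = {}"
  proof -
    have "Poly_Mapping.single i (2::nat) \<noteq> Poly_Mapping.single 0 1 + Poly_Mapping.single j 1" if "j \<noteq> 0" for i j :: 4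
    proof
      assume "Poly_Mapping.single i (2::nat) = Poly_Mapping.single 0 1 + Poly_Mapping.single j 1"
      then have "Poly_Mapping.lookup (Poly_Mapping.single i (2::nat)) j = Poly_Mapping.lookup (Poly_Mapping.single 0 1 + Poly_Mapping.single j 1) j"
        by simp
      then show False using that by (auto simp: lookup_add lookup_single when_def split: if_splits)
    qed
    then show ?thesis by auto
  qed
  ultimately have "card A = 7" unfolding A_def by (subst card_Un_disjoint) auto
  moreover have "monomial ` A \<subseteq> span B"
  proof -
    have "mdeg m = 2" if "m \<in> A" for m using that by (auto simp: A_def mdeg_add)
    then have "monomial m \<in> forms 2" if "m \<in> A" for m using forms_monom[of m] that by simp
    then have "monomial ` A \<subseteq> forms 2" by blast
    then show ?thesis using sub by blast
  qed
  then have "card (monomial ` A :: 4 rpoly set) \<le> card B"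
    using real_vector.independent_span_bound[OF assms(1) independent_monom[OF fin]] by blast
  moreover have "inj_on (monomial :: _ \<Rightarrow> 4 rpoly) A"
    by (rule inj_onI) (metis keys_single singleton_inject zero_neq_one)
  then have "card (monomial ` A :: 4 rpoly set) = card A" by (rule card_image)
  ultimately show False using assms(2) by simp
qed

theorem corollary1p4:
  fixes p :: "4 rpoly"
  assumes "p \<in> sos_cone 2"
    and "p \<in> (forms_topology 4) frontier_of (sos_cone 2)"
    and "\<And>x :: real ^ 4. x \<noteq> 0 \<Longrightarrow> poly_value p x > 0"
  shows "sum_of_form_squares 4 2 p \<and> \<not> sum_of_form_squares 3 2 p"
proof -
  have "p \<notin> (forms_topology 4) interior_of (sos_cone 2)"
    using assms(2) by (simp add: frontier_of_def)
  then obtain l where lin: "linear l" and psd: "\<And>u. u \<in> forms 2 \<Longrightarrow> l (u\<^sup>2) \<ge> 0" and lp: "l p = 0"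
    and ne: "\<exists>y\<in>forms 4. l y \<noteq> 0" and irr: "irrelevant (sq_kernel l 2)"
    using exists_extremal_functional[OF assms(1) _ assms(3)] by blast
  define W where "W = sq_kernel l 2"
  have W: "subspace W" "W \<subseteq> forms 2"
    unfolding W_def using subspace_sq_kernel[OF lin] by (auto simp: sq_kernel_def)
  have Wl: "l (f * g) = 0" if "f \<in> W" "g \<in> forms 2" for f g
    using that by (simp add: W_def sq_kernel_def)
  have kerW: "u \<in> W" if "u \<in> forms 2" "l (u\<^sup>2) = 0" for u
    unfolding W_def by (rule sq_kernelI[OF lin psd that])
  obtain B :: "4 rpoly set" where B: "finite B" "forms 2 \<subseteq> span B" using forms_dim_bound by blast
  obtain T where T: "T \<subseteq> W" "independent T" "W \<subseteq> span T" by (rule real_vector.maximal_independent_subset)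
  have "T \<subseteq> span B" using T(1) W(2) B(2) by auto
  then have finT: "finite T" using real_vector.independent_span_bound[OF B(1) T(2)] by blast
  have "irrelevant T"
    by (rule irrelevant_mono[OF irr]) (use T(3) span_subset_ideal[of T] in \<open>auto simp: W_def\<close>)
  then obtain ws where ws: "length ws = 4" "set ws \<subseteq> W" "regular_over {} ws" "irrelevant (set ws)"
    and soc: "simple_socle (ideal.span (set ws)) 4"
    using regular_sequence_of_quadrics[OF W finT T(1)] by auto
  define I where "I = ideal.span (set ws)"
  have wf: "set ws \<subseteq> forms 2" using ws(2) W(2) by auto
  have socI: "socle I d \<subseteq> I" if "d \<noteq> 4" for d
    using soc that unfolding simple_socle_def I_def by blast
  have sub_l: "l y = 0" if A: "A \<subseteq> W" and y: "y \<in> ideal.span A" "y \<in> forms 4" for A y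
  proof -
    have "y \<in> span {a * g | a g. a \<in> A \<and> g \<in> forms (4 - 2)}"
      by (rule ideal_forms_span[OF _ y]) (use A W(2) in auto)
    moreover have "l x = 0" if "x \<in> {a * g | a g. a \<in> A \<and> g \<in> forms (4 - 2)}" for x
      using that A Wl by auto
    ultimately show ?thesis using linear_eq_0_on_span[OF lin] by blast
  qed
  \<comment> \<open>socle degree four and finite length bound the degrees of the quotient by four\<close>
  have high: "forms d \<subseteq> I" if d: "d \<ge> 5" for d
  proof -
    obtain N where N: "\<forall>d\<ge>N. forms d \<subseteq> I" using irrelevant_forms[OF ws(4)] I_def by blast
    have "forms (max 5 N - k) \<subseteq> I" if "max 5 N - k \<ge> 5" for k
      using that
    proof (induction k)
      case 0
      then show ?case using N by simp
    next
      case (Suc k)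
      then have e: "max 5 N - k = Suc (max 5 N - Suc k)" "max 5 N - Suc k \<noteq> 4" by linarith+
      then have "forms (Suc (max 5 N - Suc k)) \<subseteq> I" using Suc by simp
      then have "forms (max 5 N - Suc k) \<subseteq> socle I (max 5 N - Suc k)"
        using forms_mult[OF forms_var] by (auto simp: socle_def)
      then show ?case using socI[OF e(2)] by blast
    qed
    from this[of "max 5 N - d"] show ?thesis using d N by (cases "d \<le> max 5 N") auto
  qed
  \<comment> \<open>all quartics are socle elements, so they are at most one-dimensional modulo \<open>I\<close>, and \<open>l\<close> detects that dimension\<close>
  have kerI: "y \<in> I" if y: "y \<in> forms 4" "l y = 0" for y
  proof -
    obtain y1 where y1: "y1 \<in> forms 4" "l y1 \<noteq> 0" using ne by blast
    have "forms 4 \<subseteq> socle I 4"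
    proof
      fix x :: "4 rpoly" assume x: "x \<in> forms 4"
      have "var i * x \<in> forms 5" for i by (rule forms_mult_eq[OF forms_var x]) simp
      then show "x \<in> socle I 4" using high[of 5] x by (auto simp: socle_def)
    qed
    then have "y \<in> socle I 4" "y1 \<in> socle I 4" using y y1 by auto
    then obtain c c' where c: "c \<noteq> 0 \<or> c' \<noteq> 0" "c *\<^sub>R y + c' *\<^sub>R y1 \<in> I"
      using soc unfolding simple_socle_def I_def by blast
    have "c *\<^sub>R y + c' *\<^sub>R y1 \<in> forms 4" by (intro forms_add forms_scaleR y y1)
    then have "l (c *\<^sub>R y + c' *\<^sub>R y1) = 0" using sub_l[OF ws(2)] c(2) I_def by blast
    then have "c' = 0" using y y1 by (simp add: linear_add[OF lin] linear_cmul[OF lin])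
    then have "c \<noteq> 0" "c *\<^sub>R y \<in> I" using c by auto
    then have "inverse c *\<^sub>R c *\<^sub>R y \<in> I" unfolding I_def by (rule_tac ideal_scaleR)
    then show ?thesis using \<open>c \<noteq> 0\<close> by simp
  qed
  \<comment> \<open>Gorenstein duality: what pairs to zero with all quadrics is zero in the quotient\<close>
  have Wsp: "W \<subseteq> span (set ws)"
  proof
    fix f assume f: "f \<in> W"
    then have f2: "f \<in> forms 2" using W by blast
    have "var i * f \<in> I" for i
    proof -
      have f3: "var i * f \<in> forms 3" by (rule forms_mult_eq[OF forms_var f2]) simp
      have "var j * (var i * f) \<in> I" for j
      proof (rule kerI)
        show "var j * (var i * f) \<in> forms 4" by (rule forms_mult_eq[OF forms_var f3]) simp
        have "var j * var i \<in> (forms 2 :: 4 rpoly set)" by (rule forms_mult_eq[OF forms_var forms_var]) simp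
        then have "l (f * (var j * var i)) = 0" by (rule Wl[OF f])
        then show "l (var j * (var i * f)) = 0" by (simp add: mult_ac)
      qed
      then have "var i * f \<in> socle I 3" using f3 by (simp add: socle_def)
      then show ?thesis using socI[of 3] by auto
    qed
    then have "f \<in> socle I 2" using f2 by (simp add: socle_def)
    then have "f \<in> ideal.span (set ws)" using socI[of 2] I_def by auto
    then show "f \<in> span (set ws)" using ideal_forms_same_degree[OF wf _ f2] by blast
  qed
  have in_W: "q i \<in> W" if p: "p = (\<Sum>i<k. (q i)\<^sup>2)" "\<forall>i<k. q i \<in> forms 2" and i: "i < k"
    for q :: "nat \<Rightarrow> 4 rpoly" and k i
  proof -
    have "(\<Sum>i<k. l ((q i)\<^sup>2)) = 0" using lp by (simp add: p(1) linear_sum[OF lin])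
    then have "l ((q i)\<^sup>2) = 0"
      using sum_nonneg_eq_0_iff[of "{..<k}" "\<lambda>i. l ((q i)\<^sup>2)"] psd p(2) i by auto
    then show ?thesis using kerW p(2) i by blast
  qed
  have "sum_of_form_squares 4 2 p"
  proof -
    obtain k q where q: "\<forall>i<(k::nat). q i \<in> forms 2" "p = (\<Sum>i<k. (q i)\<^sup>2)"
      using assms(1) unfolding sos_cone_def sum_of_form_squares_def by blast
    have "card (set ws) \<le> 4" using ws(1) card_length by metis
    then obtain r where "\<forall>i<(4::nat). r i \<in> W" "(\<Sum>i<k. (q i)\<^sup>2) = (\<Sum>i<4. (r i)\<^sup>2)"
      using sum_of_squares_in_subspace[OF W(1) _ Wsp, of 4 k q] in_W[OF q(2,1)] by auto
    then show ?thesis unfolding sum_of_form_squares_def using q(2) W(2) by auto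
  qed
  moreover have "\<not> sum_of_form_squares 3 2 p"
  proof
    assume "sum_of_form_squares 3 2 p"
    then obtain q where q: "\<forall>i<3. q i \<in> forms 2" "p = (\<Sum>i<(3::nat). (q i)\<^sup>2)"
      unfolding sum_of_form_squares_def by blast
    have qW: "q i \<in> W" if "i < 3" for i using in_W[OF q(2,1) that] .
    obtain Z where Z: "Z \<subseteq> q ` {..<3}" "independent Z" "q ` {..<3} \<subseteq> span Z"
      by (rule real_vector.maximal_independent_subset)
    have finZ: "finite Z" using Z(1) finite_subset by blast
    have "card Z \<le> card {..<(3::nat)}" using surj_card_le[of "{..<3}" Z q] Z(1) by simp
    then have cZ: "card Z \<le> 3" by simp
    obtain qs where qs: "set qs = Z" "distinct qs" using finite_distinct_list[OF finZ] by blast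
    have lqs: "length qs \<le> 3" using cZ qs distinct_card by metis
    have "Z \<subseteq> W" using Z(1) qW by auto
    then obtain bs where bs: "length (qs @ bs) = 4" "set bs \<subseteq> W" "W \<subseteq> span (set (qs @ bs))" "regular_over {} (qs @ bs)"
      using regular_sequence_steinitz[OF W ws(1,2) Wsp ws(3,4), of qs] qs Z(2) by auto
    have "bs \<noteq> []" using bs(1) lqs by auto
    then obtain cs a where cs: "bs = cs @ [a]" by (metis rev_exhaust)
    define Q where "Q = set (qs @ cs)"
    have full: "set (qs @ bs) = insert a Q" by (auto simp: Q_def cs)
    have QW: "insert a Q \<subseteq> W" using full bs(2) \<open>Z \<subseteq> W\<close> qs(1) by auto
    have QF: "Q \<subseteq> forms 2" using QW W(2) by auto
    have "length (qs @ cs) = 3" using bs(1) cs by simp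
    then have cQ: "card Q \<le> 3" unfolding Q_def using card_length by metis
    have Iup: "I \<subseteq> ideal.span (insert a Q)"
    proof -
      have "set ws \<subseteq> ideal.span (insert a Q)"
        using ws(2) bs(3) span_subset_ideal[of "insert a Q"] unfolding full by blast
      then show ?thesis unfolding I_def by (rule ideal.span_minimal[OF _ ideal.subspace_span])
    qed
    \<comment> \<open>the squared quadrics are in the span of \<open>Q\<close>, so they vanish at every common zero of \<open>Q\<close>\<close>
    interpret lorentzian l Q a
    proof (rule lorentzian.intro)
      show "linear l" by (rule lin)
      show "Q \<subseteq> forms 2" by (rule QF)
      show "a \<in> forms 2" using QW W(2) by auto
      have "regular_over {} ((qs @ cs) @ [a])" using bs(4) cs by simp
      then show "nzd a (ideal.span Q)" by (simp only: regular_over_append) (simp add: Q_def)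
      show "forms d \<subseteq> ideal.span (insert a Q)" if "d \<ge> 5" for d using high[OF that] Iup by blast
      show "l y = 0 \<longleftrightarrow> y \<in> ideal.span (insert a Q)" if "y \<in> forms 4" for y
        using kerI[OF that] Iup sub_l[OF QW _ that] by blast
      show "l (u\<^sup>2) \<ge> 0" if "u \<in> forms 2" for u by (rule psd[OF that])
      show "\<exists>c. u - c *\<^sub>R a \<in> ideal.span Q" if "u \<in> forms 2" "l (u\<^sup>2) = 0" for u
      proof -
        have "u \<in> span (insert a Q)" using kerW[OF that] bs(3) full by auto
        then show ?thesis using span_subset_ideal[of Q] by (auto simp: real_vector.span_breakdown_eq)
      qed
      show "\<not> forms 2 \<subseteq> span (insert e1 (insert e2 (ideal.span Q \<inter> forms 2)))" for e1 e2
      proof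
        assume "forms 2 \<subseteq> span (insert e1 (insert e2 (ideal.span Q \<inter> forms 2)))"
        moreover have "insert e1 (insert e2 (ideal.span Q \<inter> forms 2)) \<subseteq> span (insert e1 (insert e2 Q))"
          using ideal_forms_same_degree[OF QF] real_vector.span_mono[of Q "insert e1 (insert e2 Q)"]
          by (auto intro: real_vector.span_base)
        then have "span (insert e1 (insert e2 (ideal.span Q \<inter> forms 2))) \<subseteq> span (insert e1 (insert e2 Q))"
          by (rule real_vector.span_minimal) simp
        ultimately have "forms 2 \<subseteq> span (insert e1 (insert e2 Q))" by blast
        moreover have "finite Q" by (simp add: Q_def)
        then have "card (insert e1 (insert e2 Q)) \<le> 5" using cQ by (simp add: card_insert_if)
        ultimately show False using forms_2_not_small[of "insert e1 (insert e2 Q)"] by (simp add: Q_def)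
      qed
    qed
    obtain v where v: "v \<noteq> 0" "\<And>g. g \<in> Q \<Longrightarrow> poly_value g v = 0" using common_real_zero by blast
    have "poly_value (q i) v = 0" if "i < 3" for i
    proof -
      have "q i \<in> span Z" using Z(3) that by auto
      moreover have "poly_value x v = 0" if "x \<in> Z" for x using that v(2) qs(1) by (auto simp: Q_def)
      ultimately show ?thesis using linear_eq_0_on_span[OF linear_poly_value] by blast
    qed
    then have "poly_value p v = 0"
      by (simp add: q(2) linear_sum[OF linear_poly_value] power2_eq_square poly_value_mult)
    then show False using assms(3)[OF v(1)] by simp
  qed
  ultimately show ?thesis by blast
qed

end
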